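(* Let $(M^9,g,\Upsilon,\omega)$ be a nearly integrable irreducible $SO(3)\times SO(3)$ geometry. Then it admits an $\mathfrak{so}(3)_L\oplus\mathfrak{so}(3)_R$-valued connection $\Gamma$ whose torsion is totally antisymmetric. This connection is unique, and in any adapted coframe $\theta$ it is determined by $$\overset{LC}{\Gamma}{}^i{}_{jk}=\Gamma^i{}_{jk}+\tfrac12T^i{}_{jk},$$ where $\overset{LC}{\Gamma}{}^i{}_j=\overset{LC}{\Gamma}{}^i{}_{jk}\theta^k$ is the Levi-Civita connection $1$-form of $g$ in the coframe $\theta$, $\Gamma=(\Gamma^i{}_{jk}\theta^k)$ is a $1$-form with values in $\mathfrak{so}(3)_L\oplus\mathfrak{so}(3)_R\subset\mathfrak{so}(9)$, and $T_{ijk}=g_{il}T^l{}_{jk}$ is totally antisymmetric. Conversely, every irreducible $SO(3)\times SO(3)$ geometry in dimension nine admitting a unique $\mathfrak{so}(3)_L\oplus\mathfrak{so}(3)_R$-valued connection with totally skew-symmetric torsion is nearly integrable.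
   Context: Identify $\mathbb R^9$ with $M_3(\mathbb R)$ via $\sigma(a)=\begin{pmatrix} a^1 & a^2 & a^3 \\ a^4 & a^5 & a^6 \\ a^7 & a^8 & a^9 \end{pmatrix}$. $SO(3)\times SO(3)$ acts on $\mathbb R^9$ by $(h_L,h_R)\cdot a=\sigma^{-1}(h_L\sigma(a)h_R^{-1})$; the Lie algebras of the two factors, as subalgebras of $\mathfrak{so}(9)$, are $\mathfrak{so}(3)_L=\{X\mapsto BX\}$ and $\mathfrak{so}(3)_R=\{X\mapsto -XB\}$, $B\in\mathfrak{so}(3)$. An irreducible $SO(3)\times SO(3)$ geometry $(M^9,g,\Upsilon,\omega)$ is a $9$-manifold with a reduction of its frame bundle to this $SO(3)\times SO(3)$, given by tensor fields which near every point have, in some local coframe $\theta^1,\dots,\theta^9$ (called adapted), the form $g=\sum_i(\theta^i)^2$, $\Upsilon=\det\begin{pmatrix}\theta^1&\theta^2&\theta^3\\ \theta^4&\theta^5&\theta^6\\ \theta^7&\theta^8&\theta^9\end{pmatrix}$ (symmetric products of the entries), $\omega=\theta^{1245}+\theta^{1278}+\theta^{1346}+\theta^{1379}+\theta^{2356}+\theta^{2389}+\theta^{4578}+\theta^{4679}+\theta^{5689}$ with $\theta^{ijkl}=\theta^i\wedge\theta^j\wedge\theta^k\wedge\theta^l$. The geometry is nearly integrable if $(\nabla^{LC}_X\Upsilon)(X,X,X)=0$ for all tangent vectors $X$, where $\nabla^{LC}$ is the Levi-Civita connection of $g$. The torsion of a connection $\Gamma=(\Gamma^i{}_j)$ is $T^i=d\theta^i+\Gamma^i{}_j\wedge\theta^j=\tfrac12T^i{}_{jk}\theta^j\wedge\theta^k$.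 *)

theory Defs
  imports "HOL-Analysis.Analysis"
begin

section \<open>Smooth manifolds in local coordinates\<close>

text \<open>
  A manifold is a (Hausdorff, second countable) type together with a smooth atlas. Tensor fields,
  coframes and connections are given by their components in each chart of the atlas, subject to the
  usual transformation laws on overlaps. A component function of a chart is a function on the
  manifold itself; only its values on the domain of the chart matter.
\<close>

fun Ck_on :: "nat \<Rightarrow> 'a::real_normed_vector set \<Rightarrow> ('a \<Rightarrow> 'b::real_normed_vector) \<Rightarrow> bool" where
  "Ck_on 0 S f \<longleftrightarrow> continuous_on S f"
| "Ck_on (Suc k) S f \<longleftrightarrow>
     f differentiable_on S \<and> (\<forall>v. Ck_on k S (\<lambda>x. frechet_derivative f (at x) v))"

text \<open>Only meant for open sets.\<close>
definition smooth_on :: "'a::real_normed_vector set \<Rightarrow> ('a \<Rightarrow> 'b::real_normed_vector) \<Rightarrow> bool" where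
  "smooth_on S f \<longleftrightarrow> (\<forall>k. Ck_on k S f)"

type_synonym ('a, 'n) chart = "'a set \<times> ('a \<Rightarrow> real ^ 'n)"

abbreviation chart_inv :: "('a, 'n) chart \<Rightarrow> real ^ 'n \<Rightarrow> 'a" where
  "chart_inv c \<equiv> inv_into (fst c) (snd c)"

definition smooth_atlas :: "('a::topological_space, 'n::finite) chart set \<Rightarrow> bool" where
  "smooth_atlas A \<longleftrightarrow>
     (\<forall>c\<in>A. open (fst c) \<and> open (snd c ` fst c) \<and>
        homeomorphism (fst c) (snd c ` fst c) (snd c) (chart_inv c)) \<and>
     (\<Union>c\<in>A. fst c) = UNIV \<and>
     (\<forall>c\<in>A. \<forall>c'\<in>A. smooth_on (snd c ` (fst c \<inter> fst c')) (snd c' \<circ> chart_inv c))"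

text \<open>Derivative at \<open>p\<close>, read in the chart \<open>c\<close>, of a vector-valued function \<open>F\<close> on the manifold in the
  coordinate direction \<open>u\<close>. With \<open>F = snd c'\<close> it is the derivative of the change of charts.\<close>
definition chart_deriv ::
    "('a, 'n::finite) chart \<Rightarrow> ('a \<Rightarrow> 'b::real_normed_vector) \<Rightarrow> 'a \<Rightarrow> real ^ 'n \<Rightarrow> 'b" where
  "chart_deriv c F p u = frechet_derivative (F \<circ> chart_inv c) (at (snd c p)) u"

type_synonym ('a, 'n) tensor2 = "('a, 'n) chart \<Rightarrow> 'a \<Rightarrow> real ^ 'n \<Rightarrow> real ^ 'n \<Rightarrow> real"
type_synonym ('a, 'n) tensor3 =
  "('a, 'n) chart \<Rightarrow> 'a \<Rightarrow> real ^ 'n \<Rightarrow> real ^ 'n \<Rightarrow> real ^ 'n \<Rightarrow> real"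
type_synonym ('a, 'n) tensor4 =
  "('a, 'n) chart \<Rightarrow> 'a \<Rightarrow> real ^ 'n \<Rightarrow> real ^ 'n \<Rightarrow> real ^ 'n \<Rightarrow> real ^ 'n \<Rightarrow> real"

text \<open>The forms \<open>\<theta>\<^sup>1, \<dots>, \<theta>\<^sup>n\<close> are bundled into one vector-valued form:
  \<open>\<theta> c p v $ i\<close> is the value of \<open>\<theta>\<^sup>i\<close> at \<open>p\<close> on the vector with coordinates \<open>v\<close> in the chart \<open>c\<close>.\<close>
type_synonym ('a, 'n) coframe = "('a, 'n) chart \<Rightarrow> 'a \<Rightarrow> real ^ 'n \<Rightarrow> real ^ 'n"

definition coframe_on ::
    "('a::topological_space, 'n::finite) chart set \<Rightarrow> 'a set \<Rightarrow> ('a, 'n) coframe \<Rightarrow> bool" where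
  "coframe_on A U \<theta> \<longleftrightarrow> open U \<and>
     (\<forall>c\<in>A. (\<forall>p\<in>U \<inter> fst c. linear (\<theta> c p) \<and> bij (\<theta> c p)) \<and>
        (\<forall>v. smooth_on (snd c ` (U \<inter> fst c)) ((\<lambda>q. \<theta> c q v) \<circ> chart_inv c))) \<and>
     (\<forall>c\<in>A. \<forall>c'\<in>A. \<forall>p\<in>U \<inter> fst c \<inter> fst c'. \<forall>v. \<theta> c p v = \<theta> c' p (chart_deriv c (snd c') p v))"

text \<open>The dual frame \<open>e\<^sub>1, \<dots>, e\<^sub>n\<close>.\<close>
definition dual_frame :: "('a, 'n::finite) coframe \<Rightarrow> ('a, 'n) chart \<Rightarrow> 'a \<Rightarrow> 'n \<Rightarrow> real ^ 'n" where
  "dual_frame \<theta> c p j = inv (\<theta> c p) (axis j 1)"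


section \<open>Connections on the tangent bundle\<close>

text \<open>\<open>N c p\<close> are the Christoffel symbols in the chart \<open>c\<close>: in coordinates,
  \<open>\<nabla>\<^sub>u Y = D\<^sub>u Y + N c p u Y\<close>. The last conjunct of \<open>affine_connection\<close> is the transformation
  law of Christoffel symbols. The values outside the charts are normalised to 0 so that a connection
  is a unique function.\<close>
type_synonym ('a, 'n) connection = "('a, 'n) chart \<Rightarrow> 'a \<Rightarrow> real ^ 'n \<Rightarrow> real ^ 'n \<Rightarrow> real ^ 'n"

definition affine_connection ::
    "('a::topological_space, 'n::finite) chart set \<Rightarrow> ('a, 'n) connection \<Rightarrow> bool" where
  "affine_connection A N \<longleftrightarrow>
     (\<forall>c p. c \<notin> A \<or> p \<notin> fst c \<longrightarrow> N c p = (\<lambda>u v. 0)) \<and>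
     (\<forall>c\<in>A. (\<forall>p\<in>fst c. bilinear (N c p)) \<and>
        (\<forall>u v. smooth_on (snd c ` fst c) ((\<lambda>q. N c q u v) \<circ> chart_inv c))) \<and>
     (\<forall>c\<in>A. \<forall>c'\<in>A. \<forall>p\<in>fst c \<inter> fst c'. \<forall>u v.
        chart_deriv c (snd c') p (N c p u v) =
          chart_deriv c (\<lambda>q. chart_deriv c (snd c') q v) p u +
          N c' p (chart_deriv c (snd c') p u) (chart_deriv c (snd c') p v))"

definition cov_deriv_vector ::
    "('a, 'n::finite) connection \<Rightarrow> ('a, 'n) chart \<Rightarrow> ('a \<Rightarrow> real ^ 'n) \<Rightarrow> 'a \<Rightarrow> real ^ 'n \<Rightarrow> real ^ 'n"
  where "cov_deriv_vector N c Y p x = chart_deriv c Y p x + N c p x (Y p)"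

definition cov_deriv2 ::
    "('a, 'n::finite) connection \<Rightarrow> ('a, 'n) tensor2 \<Rightarrow> ('a, 'n) chart \<Rightarrow> 'a \<Rightarrow> real ^ 'n \<Rightarrow>
      real ^ 'n \<Rightarrow> real ^ 'n \<Rightarrow> real" where
  "cov_deriv2 N g c p x u v =
     chart_deriv c (\<lambda>q. g c q u v) p x - g c p (N c p x u) v - g c p u (N c p x v)"

definition cov_deriv3 ::
    "('a, 'n::finite) connection \<Rightarrow> ('a, 'n) tensor3 \<Rightarrow> ('a, 'n) chart \<Rightarrow> 'a \<Rightarrow> real ^ 'n \<Rightarrow>
      real ^ 'n \<Rightarrow> real ^ 'n \<Rightarrow> real ^ 'n \<Rightarrow> real" where
  "cov_deriv3 N \<Upsilon> c p x u v w =
     chart_deriv c (\<lambda>q. \<Upsilon> c q u v w) p x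
     - \<Upsilon> c p (N c p x u) v w - \<Upsilon> c p u (N c p x v) w - \<Upsilon> c p u v (N c p x w)"

definition is_levi_civita ::
    "('a::topological_space, 'n::finite) chart set \<Rightarrow> ('a, 'n) tensor2 \<Rightarrow> ('a, 'n) connection \<Rightarrow> bool"
  where
  "is_levi_civita A g N \<longleftrightarrow> affine_connection A N \<and>
     (\<forall>c\<in>A. \<forall>p\<in>fst c. (\<forall>u v. N c p u v = N c p v u) \<and>
        (\<forall>x u v. cov_deriv2 N g c p x u v = 0))"

definition levi_civita ::
    "('a::topological_space, 'n::finite) chart set \<Rightarrow> ('a, 'n) tensor2 \<Rightarrow> ('a, 'n) connection" where
  "levi_civita A g = (THE N. is_levi_civita A g N)"

text \<open>The matrix \<open>(\<Gamma>\<^sup>i\<^sub>j)\<close> of connection 1-forms in the coframe \<open>\<theta>\<close>, evaluated on \<open>u\<close>: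
  \<open>\<Gamma>\<^sup>i\<^sub>j(u) = \<theta>\<^sup>i(\<nabla>\<^sub>u e\<^sub>j)\<close>. Its components \<open>\<Gamma>\<^sup>i\<^sub>j\<^sub>k\<close> have the form index last,
  \<open>\<Gamma>\<^sup>i\<^sub>j = \<Gamma>\<^sup>i\<^sub>j\<^sub>k \<theta>\<^sup>k\<close>.\<close>
definition connection_form ::
    "('a, 'n::finite) connection \<Rightarrow> ('a, 'n) coframe \<Rightarrow> ('a, 'n) chart \<Rightarrow> 'a \<Rightarrow> real ^ 'n \<Rightarrow>
      real ^ 'n ^ 'n" where
  "connection_form N \<theta> c p u =
     (\<chi> i j. \<theta> c p (cov_deriv_vector N c (\<lambda>q. dual_frame \<theta> c q j) p u) $ i)"

definition connection_coeff ::
    "('a, 'n::finite) connection \<Rightarrow> ('a, 'n) coframe \<Rightarrow> ('a, 'n) chart \<Rightarrow> 'a \<Rightarrow> 'n \<Rightarrow> 'n \<Rightarrow> 'n \<Rightarrow> real"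
  where "connection_coeff N \<theta> c p i j k = connection_form N \<theta> c p (dual_frame \<theta> c p k) $ i $ j"

text \<open>\<open>T\<^sup>i = d\<theta>\<^sup>i + \<Gamma>\<^sup>i\<^sub>j \<and> \<theta>\<^sup>j = 1/2 T\<^sup>i\<^sub>j\<^sub>k \<theta>\<^sup>j \<and> \<theta>\<^sup>k\<close>, with the convention
  \<open>(\<alpha> \<and> \<beta>)(u, v) = \<alpha>(u) \<beta>(v) - \<alpha>(v) \<beta>(u)\<close>, so that \<open>T\<^sup>i\<^sub>j\<^sub>k = T\<^sup>i(e\<^sub>j, e\<^sub>k)\<close>.\<close>
definition torsion_form ::
    "('a, 'n::finite) connection \<Rightarrow> ('a, 'n) coframe \<Rightarrow> ('a, 'n) chart \<Rightarrow> 'a \<Rightarrow> real ^ 'n \<Rightarrow>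
      real ^ 'n \<Rightarrow> real ^ 'n" where
  "torsion_form N \<theta> c p u v =
     (chart_deriv c (\<lambda>q. \<theta> c q v) p u - chart_deriv c (\<lambda>q. \<theta> c q u) p v) +
     (connection_form N \<theta> c p u *v \<theta> c p v - connection_form N \<theta> c p v *v \<theta> c p u)"

definition torsion_coeff ::
    "('a, 'n::finite) connection \<Rightarrow> ('a, 'n) coframe \<Rightarrow> ('a, 'n) chart \<Rightarrow> 'a \<Rightarrow> 'n \<Rightarrow> 'n \<Rightarrow> 'n \<Rightarrow> real"
  where
  "torsion_coeff N \<theta> c p i j k = torsion_form N \<theta> c p (dual_frame \<theta> c p j) (dual_frame \<theta> c p k) $ i"

text \<open>\<open>T\<^sub>i\<^sub>j\<^sub>k = g\<^sub>i\<^sub>l T\<^sup>l\<^sub>j\<^sub>k\<close>, where \<open>g\<^sub>i\<^sub>l\<close> are the components of \<open>g\<close> in the coframe \<open>\<theta>\<close>.\<close>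
definition lower_index ::
    "('a, 'n::finite) tensor2 \<Rightarrow> ('a, 'n) coframe \<Rightarrow> ('a, 'n) chart \<Rightarrow> 'a \<Rightarrow>
      ('n \<Rightarrow> 'n \<Rightarrow> 'n \<Rightarrow> real) \<Rightarrow> 'n \<Rightarrow> 'n \<Rightarrow> 'n \<Rightarrow> real" where
  "lower_index g \<theta> c p T i j k =
     (\<Sum>l\<in>UNIV. g c p (dual_frame \<theta> c p i) (dual_frame \<theta> c p l) * T l j k)"

definition totally_antisymmetric :: "('n \<Rightarrow> 'n \<Rightarrow> 'n \<Rightarrow> real) \<Rightarrow> bool" where
  "totally_antisymmetric T \<longleftrightarrow> (\<forall>i j k. T j i k = - T i j k \<and> T i k j = - T i j k)"


section \<open>The algebraic model\<close>

text \<open>In the index type \<open>9\<close> the numerals \<open>1, \<dots>, 9\<close> are the nine distinct elements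
  (with \<open>9 = 0\<close>); similarly for \<open>3\<close> and \<open>4\<close>.\<close>
definition \<sigma> :: "real ^ 9 \<Rightarrow> real ^ 3 ^ 3" where
  "\<sigma> a = vector [vector [a $ 1, a $ 2, a $ 3],
                  vector [a $ 4, a $ 5, a $ 6],
                  vector [a $ 7, a $ 8, a $ 9]]"

definition so3 :: "(real ^ 3 ^ 3) set" where
  "so3 = {B. transpose B = - B}"

definition so3_L :: "(real ^ 9 ^ 9) set" where
  "so3_L = {M. \<exists>B\<in>so3. \<forall>a. \<sigma> (M *v a) = B ** \<sigma> a}"

definition so3_R :: "(real ^ 9 ^ 9) set" where
  "so3_R = {M. \<exists>B\<in>so3. \<forall>a. \<sigma> (M *v a) = - (\<sigma> a ** B)}"

definition so3_LR :: "(real ^ 9 ^ 9) set" where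
  "so3_LR = {M + M' | M M'. M \<in> so3_L \<and> M' \<in> so3_R}"

text \<open>Symmetric product of three linear forms, normalised such that
  \<open>(\<alpha> \<beta> \<gamma>)(u, u, u) = \<alpha>(u) \<beta>(u) \<gamma>(u)\<close>.\<close>
definition sym_prod3 ::
    "('v \<Rightarrow> real) \<Rightarrow> ('v \<Rightarrow> real) \<Rightarrow> ('v \<Rightarrow> real) \<Rightarrow> 'v \<Rightarrow> 'v \<Rightarrow> 'v \<Rightarrow> real" where
  "sym_prod3 \<alpha> \<beta> \<gamma> u v w =
     (\<alpha> u * \<beta> v * \<gamma> w + \<alpha> u * \<beta> w * \<gamma> v + \<alpha> v * \<beta> u * \<gamma> w +
      \<alpha> v * \<beta> w * \<gamma> u + \<alpha> w * \<beta> u * \<gamma> v + \<alpha> w * \<beta> v * \<gamma> u) / 6"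

text \<open>The determinant of \<open>\<sigma>\<close> expanded with symmetric products of its entries.\<close>
definition Upsilon0 :: "real ^ 9 \<Rightarrow> real ^ 9 \<Rightarrow> real ^ 9 \<Rightarrow> real" where
  "Upsilon0 u v w =
     (\<Sum>\<pi> | \<pi> permutes (UNIV :: 3 set). of_int (sign \<pi>) *
        sym_prod3 (\<lambda>a. \<sigma> a $ 1 $ \<pi> 1) (\<lambda>a. \<sigma> a $ 2 $ \<pi> 2) (\<lambda>a. \<sigma> a $ 3 $ \<pi> 3) u v w)"

lemma Upsilon0_diagonal: "Upsilon0 a a a = det (\<sigma> a)"
proof -
  have sym: "sym_prod3 \<alpha> \<beta> \<gamma> u u u = \<alpha> u * \<beta> u * \<gamma> u" for \<alpha> \<beta> \<gamma> :: "real ^ 9 \<Rightarrow> real" and u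
    by (simp add: sym_prod3_def)
  have prod3: "(\<Prod>i\<in>UNIV. f i) = f 1 * f 2 * f 3" for f :: "3 \<Rightarrow> real"
    unfolding UNIV_3 by (simp add: mult.assoc)
  show ?thesis
    unfolding Upsilon0_def det_def sym prod3 by (rule refl)
qed

definition wedge4 :: "9 \<Rightarrow> 9 \<Rightarrow> 9 \<Rightarrow> 9 \<Rightarrow> real ^ 9 \<Rightarrow> real ^ 9 \<Rightarrow> real ^ 9 \<Rightarrow> real ^ 9 \<Rightarrow> real" where
  "wedge4 i j k l u v w x =
     det (vector [vector [u $ i, u $ j, u $ k, u $ l],
                  vector [v $ i, v $ j, v $ k, v $ l],
                  vector [w $ i, w $ j, w $ k, w $ l],
                  vector [x $ i, x $ j, x $ k, x $ l]] :: real ^ 4 ^ 4)"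

definition omega0 :: "real ^ 9 \<Rightarrow> real ^ 9 \<Rightarrow> real ^ 9 \<Rightarrow> real ^ 9 \<Rightarrow> real" where
  "omega0 u v w x =
     wedge4 1 2 4 5 u v w x + wedge4 1 2 7 8 u v w x + wedge4 1 3 4 6 u v w x +
     wedge4 1 3 7 9 u v w x + wedge4 2 3 5 6 u v w x + wedge4 2 3 8 9 u v w x +
     wedge4 4 5 7 8 u v w x + wedge4 4 6 7 9 u v w x + wedge4 5 6 8 9 u v w x"


section \<open>Irreducible SO(3)xSO(3) geometries\<close>

definition adapted_coframe ::
    "('a::topological_space, 9) chart set \<Rightarrow> ('a, 9) tensor2 \<Rightarrow> ('a, 9) tensor3 \<Rightarrow> ('a, 9) tensor4 \<Rightarrow>
      'a set \<Rightarrow> ('a, 9) coframe \<Rightarrow> bool" where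
  "adapted_coframe A g \<Upsilon> \<omega> U \<theta> \<longleftrightarrow> coframe_on A U \<theta> \<and>
     (\<forall>c\<in>A. \<forall>p\<in>U \<inter> fst c.
        (\<forall>u v. g c p u v = (\<Sum>i\<in>UNIV. \<theta> c p u $ i * \<theta> c p v $ i)) \<and>
        (\<forall>u v w. \<Upsilon> c p u v w = Upsilon0 (\<theta> c p u) (\<theta> c p v) (\<theta> c p w)) \<and>
        (\<forall>u v w x. \<omega> c p u v w x = omega0 (\<theta> c p u) (\<theta> c p v) (\<theta> c p w) (\<theta> c p x)))"

text \<open>Smoothness, multilinearity and the transformation laws of \<open>g\<close>, \<open>\<Upsilon>\<close> and \<open>\<omega>\<close> are inherited from
  the adapted coframes.\<close>
definition irreducible_geometry ::
    "('a::topological_space, 9) chart set \<Rightarrow> ('a, 9) tensor2 \<Rightarrow> ('a, 9) tensor3 \<Rightarrow> ('a, 9) tensor4 \<Rightarrow> bool"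
  where
  "irreducible_geometry A g \<Upsilon> \<omega> \<longleftrightarrow> (\<forall>p. \<exists>U \<theta>. p \<in> U \<and> adapted_coframe A g \<Upsilon> \<omega> U \<theta>)"

definition nearly_integrable ::
    "('a::topological_space, 'n::finite) chart set \<Rightarrow> ('a, 'n) tensor2 \<Rightarrow> ('a, 'n) tensor3 \<Rightarrow> bool" where
  "nearly_integrable A g \<Upsilon> \<longleftrightarrow>
     (\<forall>c\<in>A. \<forall>p\<in>fst c. \<forall>x. cov_deriv3 (levi_civita A g) \<Upsilon> c p x x x x = 0)"

definition so3_LR_connection ::
    "('a::topological_space, 9) chart set \<Rightarrow> ('a, 9) tensor2 \<Rightarrow> ('a, 9) tensor3 \<Rightarrow> ('a, 9) tensor4 \<Rightarrow>
      ('a, 9) connection \<Rightarrow> bool" where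
  "so3_LR_connection A g \<Upsilon> \<omega> N \<longleftrightarrow> affine_connection A N \<and>
     (\<forall>U \<theta>. adapted_coframe A g \<Upsilon> \<omega> U \<theta> \<longrightarrow>
        (\<forall>c\<in>A. \<forall>p\<in>U \<inter> fst c. \<forall>u. connection_form N \<theta> c p u \<in> so3_LR))"

definition antisymmetric_torsion ::
    "('a::topological_space, 9) chart set \<Rightarrow> ('a, 9) tensor2 \<Rightarrow> ('a, 9) tensor3 \<Rightarrow> ('a, 9) tensor4 \<Rightarrow>
      ('a, 9) connection \<Rightarrow> bool" where
  "antisymmetric_torsion A g \<Upsilon> \<omega> N \<longleftrightarrow>
     (\<forall>U \<theta>. adapted_coframe A g \<Upsilon> \<omega> U \<theta> \<longrightarrow>
        (\<forall>c\<in>A. \<forall>p\<in>U \<inter> fst c.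
           totally_antisymmetric (lower_index g \<theta> c p (torsion_coeff N \<theta> c p))))"

end

theory Submission
  imports Defs
begin

text \<open>
  Everything reduces to algebra at one point. In an adapted coframe the metric and the cubic form
  \<open>\<Upsilon>\<close> have constant coefficients, so \<open>(\<nabla>\<^sub>X\<Upsilon>)(X, X, X)\<close> is, up to a factor, the derivative of the
  determinant at \<open>X\<close> in the direction \<open>Q(X) = \<Gamma>(X) X\<close>, where \<open>\<Gamma>\<close> is the Levi-Civita connection form.
  The quadratic map \<open>Q\<close> is tangent to the spheres, since \<open>\<Gamma>\<close> is skew. Near integrability
  thus says that \<open>Q\<close> is tangent to the level sets of the norm and of the determinant on three by three
  matrices.

  The core of the proof is that such a quadratic map is generated by the Lie algebra of
  \<open>SO(3) \<times> SO(3)\<close>: \<open>Q(X) = b(X) X + X c(X)\<close> with skew \<open>b(X)\<close>, \<open>c(X)\<close> depending linearly on \<open>X\<close>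
  (\<open>quadratic_tangent_to_orbits\<close>). On a rank one matrix \<open>u v\<^sup>T\<close> the determinant
  condition forces \<open>Q(u v\<^sup>T) = \<alpha> v\<^sup>T + u \<beta>\<^sup>T\<close>, from which \<open>b\<close> and \<open>c\<close> can be read off. After subtracting them,
  \<open>Q\<close> vanishes on rank one matrices and factors through the cofactor matrix as \<open>L (cof X)\<close>; then \<open>L\<close> is
  an infinitesimal symmetry of the determinant, hence consists of a left and a right rotation, and these
  can be rewritten in the required form. If \<open>G\<close> denotes the resulting
  Lie algebra valued form, the trilinear form of \<open>\<Gamma>(X) Y - G(X) Y\<close> is skew in its last two arguments and vanishes for \<open>X = Y\<close>,
  so it is totally antisymmetric: it is half the torsion. The splitting is unique because a totally
  antisymmetric tensor with values in the Lie algebra vanishes (\<open>skew_torsion_part_unique\<close>, seen on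
  matrix units). Hence there is a linear projection onto the torsion part
  (\<open>skew_torsion_projection\<close>), and the torsion is as smooth as the Levi-Civita coefficients.

  The Lie algebra is the stabiliser of the metric and \<open>\<Upsilon>\<close> (\<open>so3_LR_iff\<close>), so that both conditions on
  the connection are pointwise conditions on its Christoffel symbols which do not refer to a coframe. A
  pointwise condition with a unique, locally smooth solution that is compatible with
  changes of charts defines a connection (\<open>affine_connection_of_pointwise\<close>). This is
  used for the Levi-Civita connection, with the Koszul formula as solution, and for the connection with
  skew torsion. Conversely, a connection with skew torsion and the Levi-Civita connection agree on
  \<open>\<nabla>\<^sub>X X\<close>, and \<open>(\<nabla>\<^sub>X\<Upsilon>)(X, X, X)\<close> involves nothing else.
\<close>

section \<open>Three by three matrices, cross products and cofactors\<close>

definition outer :: "real ^ 3 \<Rightarrow> real ^ 3 \<Rightarrow> real ^ 3 ^ 3" where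
  "outer u v = (\<chi> i j. u $ i * v $ j)"

definition hat :: "real ^ 3 \<Rightarrow> real ^ 3 ^ 3" where
  "hat a = matrix (cross3 a)"

text \<open>The cofactor matrix: the gradient of the determinant.\<close>
definition cof :: "real ^ 3 ^ 3 \<Rightarrow> real ^ 3 ^ 3" where
  "cof X = vector [cross3 (X $ 2) (X $ 3), cross3 (X $ 3) (X $ 1), cross3 (X $ 1) (X $ 2)]"

lemma hat_nth [simp]:
  "hat a $ 1 $ 1 = 0" "hat a $ 1 $ 2 = - a $ 3" "hat a $ 1 $ 3 = a $ 2"
  "hat a $ 2 $ 1 = a $ 3" "hat a $ 2 $ 2 = 0" "hat a $ 2 $ 3 = - a $ 1"
  "hat a $ 3 $ 1 = - a $ 2" "hat a $ 3 $ 2 = a $ 1" "hat a $ 3 $ 3 = 0"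
  by (simp_all add: hat_def matrix_def cross3_def axis_def)

lemma cof_nth [simp]:
  "cof X $ 1 = cross3 (X $ 2) (X $ 3)" "cof X $ 2 = cross3 (X $ 3) (X $ 1)"
  "cof X $ 3 = cross3 (X $ 1) (X $ 2)"
  by (simp_all add: cof_def)

lemma cross_nth [simp]:
  "cross3 a b $ 1 = a $ 2 * b $ 3 - a $ 3 * b $ 2"
  "cross3 a b $ 2 = a $ 3 * b $ 1 - a $ 1 * b $ 3"
  "cross3 a b $ 3 = a $ 1 * b $ 2 - a $ 2 * b $ 1"
  by (simp_all add: cross3_def)

lemma outer_nth [simp]: "outer u v $ i $ j = u $ i * v $ j"
  by (simp add: outer_def)

lemma matrix_mult_nth3:
  "(A ** B) $ i $ j = A $ i $ 1 * B $ 1 $ j + A $ i $ 2 * B $ 2 $ j + A $ i $ 3 * B $ 3 $ j"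
  for A B :: "real ^ 3 ^ 3"
  by (simp add: matrix_matrix_mult_def sum_3)

lemma matrix_vector_nth3:
  "(A *v x) $ i = A $ i $ 1 * x $ 1 + A $ i $ 2 * x $ 2 + A $ i $ 3 * x $ 3"
  for A :: "real ^ 3 ^ 3"
  by (simp add: matrix_vector_mult_def sum_3)

lemma matrix_eq3: "X = Y \<longleftrightarrow>
    X$1$1 = Y$1$1 \<and> X$1$2 = Y$1$2 \<and> X$1$3 = Y$1$3 \<and>
    X$2$1 = Y$2$1 \<and> X$2$2 = Y$2$2 \<and> X$2$3 = Y$2$3 \<and>
    X$3$1 = Y$3$1 \<and> X$3$2 = Y$3$2 \<and> X$3$3 = Y$3$3" for X Y :: "real ^ 3 ^ 3"
  by (simp add: vec_eq_iff forall_3)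

lemma inner_matrix3: "X \<bullet> Y =
    X$1$1 * Y$1$1 + X$1$2 * Y$1$2 + X$1$3 * Y$1$3 +
    X$2$1 * Y$2$1 + X$2$2 * Y$2$2 + X$2$3 * Y$2$3 +
    X$3$1 * Y$3$1 + X$3$2 * Y$3$2 + X$3$3 * Y$3$3" for X Y :: "real ^ 3 ^ 3"
  by (simp add: inner_vec_def sum_3)

lemma inner_vec3: "x \<bullet> y = x$1 * y$1 + x$2 * y$2 + x$3 * y$3" for x y :: "real ^ 3"
  by (simp add: inner_vec_def sum_3)

lemmas comp3 = matrix_eq3 inner_matrix3 inner_vec3 matrix_mult_nth3 matrix_vector_nth3

lemma transpose_nth [simp]: "transpose X $ i $ j = X $ j $ i"
  by (simp add: transpose_def)

lemma bilinear_outer: "bilinear outer"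
  by (auto simp: bilinear_def intro!: linearI simp: vec_eq_iff algebra_simps)

lemma inner_outer: "X \<bullet> outer w z = w \<bullet> (X *v z)"
  by (simp add: comp3 algebra_simps)

lemma transpose_outer: "transpose (outer u v) = outer v u"
  by (simp add: vec_eq_iff algebra_simps)

lemma transpose_hat: "transpose (hat a) = - hat a"
  by (simp add: comp3)

lemma inner_transpose: "transpose X \<bullet> transpose Y = X \<bullet> Y" for X Y :: "real ^ 3 ^ 3"
  by (simp add: comp3)

lemma linear_hat: "linear hat"
  by (auto intro!: linearI simp: matrix_eq3)

text \<open>Skew matrices are the cross product matrices, so vectors can be used as coordinates on the Lie algebra.\<close>
lemma so3_eq_range_hat: "{B. transpose B = - B} = range hat"
proof (intro equalityI subsetI)
  fix B :: "real ^ 3 ^ 3" assume "B \<in> {B. transpose B = - B}"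
  then have B: "transpose B = - B" by simp
  have skew: "B $ i $ j = - B $ j $ i" for i j
    using B by (metis transpose_nth vector_uminus_component)
  have "B = hat (vector [B $ 3 $ 2, B $ 1 $ 3, B $ 2 $ 1])"
    using skew[of 1 1] skew[of 2 2] skew[of 3 3] skew[of 1 2] skew[of 2 3] skew[of 3 1]
    unfolding matrix_eq3 hat_nth vector_3 by linarith
  then show "B \<in> range hat" by blast
qed (auto simp: transpose_hat)

text \<open>The determinant vanishes on matrices of rank at most two, and on such a pencil its gradient is linear
  in \<open>t\<close> and of rank one. An identity against \<open>cof\<close> can therefore be divided by \<open>t\<close>, which
  turns it into a statement about the single rank one matrix \<open>outer u v\<close>.\<close>
lemma cof_rank_two:
  "cof (outer u v + t *\<^sub>R outer w z) = t *\<^sub>R outer (cross3 u w) (cross3 v z)"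
  by (simp add: matrix_eq3) (simp add: algebra_simps)

lemma orthogonal_imp_cross:
  assumes "u \<bullet> w = 0" "u \<noteq> 0"
  shows "\<exists>w'. w = cross3 u w'"
proof
  have uu: "u \<bullet> u \<noteq> 0" using assms(2) by simp
  have "cross3 u (cross3 u w) = - ((u \<bullet> u) *\<^sub>R w)"
    unfolding Lagrange assms(1) by simp
  then have "cross3 u (- ((1 / (u \<bullet> u)) *\<^sub>R cross3 u w)) = (1 / (u \<bullet> u)) *\<^sub>R (u \<bullet> u) *\<^sub>R w"
    by (simp only: cross_minus_right cross_mult_right scaleR_minus_right minus_minus)
  then show "w = cross3 u (- ((1 / (u \<bullet> u)) *\<^sub>R cross3 u w))"
    using uu by simp
qed

lemma hat_orthogonal:
  "(hat a ** X) \<bullet> X = 0" "(X ** hat a) \<bullet> X = 0"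
  "(hat a ** X) \<bullet> cof X = 0" "(X ** hat a) \<bullet> cof X = 0"
  by (simp_all add: comp3 algebra_simps del: transpose_matrix_vector)

text \<open>Since \<open>(X k) \<times> (X w) = cof X (k \<times> w)\<close>, a fixed infinitesimal rotation applied to \<open>cof X\<close> is
  the same as one that depends linearly on \<open>X\<close>, applied to \<open>X\<close> from the other side. This absorbs the
  part of a quadratic map that rank one matrices do not see.\<close>
lemma cof_hat: "cof X ** hat k = hat (X *v k) ** X" "hat k ** cof X = X ** hat (transpose X *v k)"
  by (simp_all add: comp3 algebra_simps del: transpose_matrix_vector)

lemma cof_cof: "cof (cof X) = det X *\<^sub>R X"
  by (simp add: comp3 det_3 algebra_simps)

lemma cof_scaleR: "cof (s *\<^sub>R X) = s\<^sup>2 *\<^sub>R cof X"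
  by (simp add: comp3 power2_eq_square algebra_simps)

section \<open>Quadratic maps at rank one matrices\<close>

lemmas bilinear_rules = bilinear_ladd bilinear_radd bilinear_lmul bilinear_rmul
  bilinear_lneg bilinear_rneg bilinear_lzero bilinear_rzero bilinear_lsub bilinear_rsub

text \<open>The condition at \<open>outer u v + t *\<^sub>R outer w' z'\<close> is \<open>t\<close> times a quadratic polynomial in \<open>t\<close>; its
  constant term is the claim, because \<open>cross3 u w'\<close> and \<open>cross3 v z'\<close> run through the orthogonal
  complements of \<open>u\<close> and \<open>v\<close>.\<close>
lemma quadratic_normal_zero:
  assumes B: "bilinear B" and cof: "\<And>X. B X X \<bullet> cof X = 0" and "u \<bullet> w = 0" "v \<bullet> z = 0"
  shows "B (outer u v) (outer u v) \<bullet> outer w z = 0"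
proof (cases "u = 0 \<or> v = 0")
  case True
  then have "outer u v = 0" by (auto simp: vec_eq_iff)
  then show ?thesis using B by (simp add: bilinear_rules)
next
  case False
  then obtain w' z' where w: "w = cross3 u w'" and z: "z = cross3 v z'"
    using orthogonal_imp_cross assms(3,4) by metis
  define X Y where "X = outer u v" and "Y = outer w' z'"
  have "t * (B X X \<bullet> outer w z + t * ((B X Y + B Y X) \<bullet> outer w z) + t * t * (B Y Y \<bullet> outer w z)) = 0" for t
    using cof[of "X + t *\<^sub>R Y"]
    unfolding X_def Y_def cof_rank_two w z
    by (simp add: bilinear_rules[OF B] inner_add_left inner_add_right algebra_simps)
  from this[of 1] this[of "-1"] this[of 2] show ?thesis
    unfolding X_def[symmetric] by simp
qed

lemma linear_normal_zero:
  assumes L: "linear L" and cof: "\<And>X. L X \<bullet> cof X = 0" and "u \<bullet> w = 0" "v \<bullet> z = 0"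
  shows "L (outer u v) \<bullet> outer w z = 0"
proof (cases "u = 0 \<or> v = 0")
  case True
  then have "outer u v = 0" by (auto simp: vec_eq_iff)
  then show ?thesis using L by (simp add: linear_0)
next
  case False
  then obtain w' z' where w: "w = cross3 u w'" and z: "z = cross3 v z'"
    using orthogonal_imp_cross assms(3,4) by metis
  define X Y where "X = outer u v" and "Y = outer w' z'"
  have "t * (L X \<bullet> outer w z + t * (L Y \<bullet> outer w z)) = 0" for t
    using cof[of "X + t *\<^sub>R Y"]
    unfolding X_def Y_def cof_rank_two w z
    by (simp add: linear_add[OF L] linear_scale[OF L] inner_add_left algebra_simps)
  from this[of 1] this[of "-1"] show ?thesis
    unfolding X_def[symmetric] by simp
qed

abbreviation ax :: "3 \<Rightarrow> real ^ 3" where "ax i \<equiv> axis i 1"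

lemma vec3_expand: "v = v $ 1 *\<^sub>R ax 1 + v $ 2 *\<^sub>R ax 2 + v $ 3 *\<^sub>R ax 3"
  by (simp add: vec_eq_iff forall_3 axis_def)

lemma ax_nth [simp]: "ax i $ j = (if i = j then 1 else 0)"
  by (auto simp: axis_def)

lemma ax_inner [simp]: "ax i \<bullet> ax j = (if i = j then 1 else 0)"
  by (auto simp: inner_axis)

text \<open>A quadratic map whose value at \<open>v\<close> is always a multiple of \<open>v\<close> has the form \<open>l(v) v\<close> with \<open>l\<close> linear,
  so its values on a basis determine it. Concretely, the mixed coefficient of two basis vectors is
  parallel to their sum and to their difference.\<close>
lemma quadratic_radial_zero:
  fixes f :: "real ^ 3 \<Rightarrow> real ^ 3 \<Rightarrow> real ^ 3"
  assumes f: "bilinear f" and radial: "\<And>v w. v \<bullet> w = 0 \<Longrightarrow> f v v \<bullet> w = 0"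
    and basis: "\<And>j. f (ax j) (ax j) = 0"
  shows "f v v = 0"
proof -
  have mixed: "f (ax j) (ax k) + f (ax k) (ax j) = 0" if "j \<noteq> k" for j k
  proof -
    define s where "s = f (ax j) (ax k) + f (ax k) (ax j)"
    have s1: "s \<bullet> w = 0" if "(ax j + ax k) \<bullet> w = 0" for w
    proof -
      have "f (ax j + ax k) (ax j + ax k) = s"
        by (simp add: s_def bilinear_rules[OF f] basis)
      then show ?thesis using radial[OF that] by simp
    qed
    have s2: "s \<bullet> w = 0" if "(ax j - ax k) \<bullet> w = 0" for w
    proof -
      have "f (ax j - ax k) (ax j - ax k) = - s"
        by (simp add: s_def bilinear_rules[OF f] basis)
      then show ?thesis using radial[OF that] by simp
    qed
    have "s \<bullet> (ax j - ax k) = 0"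
      by (rule s1) (use that in \<open>simp add: inner_add_left inner_diff_right\<close>)
    moreover have "s \<bullet> (ax j + ax k) = 0"
      by (rule s2) (use that in \<open>simp add: inner_diff_left inner_add_right\<close>)
    ultimately have jk: "s $ j = 0" "s $ k = 0"
      by (simp_all add: inner_add_right inner_diff_right inner_axis)
    have "s $ l = 0" if "l \<noteq> j" "l \<noteq> k" for l
      using s1[of "ax l"] that by (simp add: inner_axis inner_add_left)
    then have "s = 0" using jk unfolding vec_eq_iff by (metis zero_index)
    then show ?thesis by (simp add: s_def)
  qed
  have "f v v = f (v $ 1 *\<^sub>R ax 1 + v $ 2 *\<^sub>R ax 2 + v $ 3 *\<^sub>R ax 3) (v $ 1 *\<^sub>R ax 1 + v $ 2 *\<^sub>R ax 2 + v $ 3 *\<^sub>R ax 3)"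
    using vec3_expand[of v] by simp
  also have "\<dots> = (v $ 1 * v $ 2) *\<^sub>R (f (ax 1) (ax 2) + f (ax 2) (ax 1)) +
      (v $ 1 * v $ 3) *\<^sub>R (f (ax 1) (ax 3) + f (ax 3) (ax 1)) + (v $ 2 * v $ 3) *\<^sub>R (f (ax 2) (ax 3) + f (ax 3) (ax 2))"
    by (simp add: bilinear_rules[OF f] basis algebra_simps)
  also have "\<dots> = 0" by (simp add: mixed)
  finally show ?thesis .
qed

text \<open>Quadratic vector fields on three-space that are tangent to all spheres form a space of dimension
  \<open>18 - 10 = 8\<close>, as do the matrices \<open>M\<close> modulo multiples of the identity.\<close>
lemma quadratic_tangential:
  fixes f :: "real ^ 3 \<Rightarrow> real ^ 3 \<Rightarrow> real ^ 3"
  assumes f: "bilinear f" and tangential: "\<And>v. f v v \<bullet> v = 0"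
  shows "\<exists>M :: real ^ 3 ^ 3. \<forall>v. f v v = cross3 (M *v v) v"
proof -
  define F where "F i j k = f (ax j) (ax k) $ i" for i j k
  have F: "f v v $ i = v $ 1 * v $ 1 * F i 1 1 + v $ 2 * v $ 2 * F i 2 2 + v $ 3 * v $ 3 * F i 3 3 +
    v $ 1 * v $ 2 * (F i 1 2 + F i 2 1) + v $ 1 * v $ 3 * (F i 1 3 + F i 3 1) + v $ 2 * v $ 3 * (F i 2 3 + F i 3 2)" for v i
  proof -
    have "f v v = f (v $ 1 *\<^sub>R ax 1 + v $ 2 *\<^sub>R ax 2 + v $ 3 *\<^sub>R ax 3) (v $ 1 *\<^sub>R ax 1 + v $ 2 *\<^sub>R ax 2 + v $ 3 *\<^sub>R ax 3)"
      using vec3_expand[of v] by simp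
    then show ?thesis by (simp add: bilinear_rules[OF f] F_def algebra_simps)
  qed
  have *: "f (vector [a, b, c]) (vector [a, b, c]) \<bullet> vector [a, b, c] = 0" for a b c :: real
    by (rule tangential)
  note eqs = *[unfolded inner_vec3 F vector_3]
  \<comment> \<open>Up to sign, the off-diagonal entries of \<open>M\<close> are the coefficients of squares. The diagonal, free up to a common summand, is normalised by \<open>M $ 3 $ 3 = 0\<close>.\<close>
  define s1 s2 where "s1 = F 1 2 3 + F 1 3 2" and "s2 = F 2 1 3 + F 2 3 1"
  define M :: "real ^ 3 ^ 3" where
    "M = vector [vector [- s2, F 3 2 2, - F 2 3 3], vector [- F 3 1 1, s1, F 1 3 3], vector [F 2 1 1, - F 1 2 2, 0]]"
  have d: "F 1 1 1 = 0" "F 2 2 2 = 0" "F 3 3 3 = 0"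
    using eqs[of 1 0 0] eqs[of 0 1 0] eqs[of 0 0 1] by simp_all
  have m: "F 1 1 2 + F 1 2 1 = - F 2 1 1" "F 2 1 2 + F 2 2 1 = - F 1 2 2"
    "F 1 1 3 + F 1 3 1 = - F 3 1 1" "F 3 1 3 + F 3 3 1 = - F 1 3 3"
    "F 2 2 3 + F 2 3 2 = - F 3 2 2" "F 3 2 3 + F 3 3 2 = - F 2 3 3"
    using eqs[of 1 1 0] eqs[of 1 "-1" 0] eqs[of 1 0 1] eqs[of 1 0 "-1"] eqs[of 0 1 1] eqs[of 0 1 "-1"] d by simp_all
  have s: "F 3 1 2 + F 3 2 1 = - s1 - s2"
    using eqs[of 1 1 1] d m by (simp add: s1_def s2_def)
  have "f v v = cross3 (M *v v) v" for v
    unfolding vec_eq_iff forall_3 cross_nth matrix_vector_nth3 F d m s M_def vector_3 s1_def[symmetric] s2_def[symmetric]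
    by (simp add: algebra_simps)
  then show ?thesis by blast
qed


lemma bilinear_matrix_vector: "bilinear ((*v) :: real ^ 3 ^ 3 \<Rightarrow> _)"
  by (auto simp: bilinear_def intro!: linearI simp: vec_eq_iff matrix_vector_nth3 algebra_simps)

lemma bilinear_matrix_mult: "bilinear ((**) :: real ^ 3 ^ 3 \<Rightarrow> real ^ 3 ^ 3 \<Rightarrow> _)"
  by (auto simp: bilinear_def intro!: linearI simp: vec_eq_iff matrix_mult_nth3 algebra_simps)

lemmas outer_rules = bilinear_rules[OF bilinear_outer]
  and matrix_vector_rules = bilinear_rules[OF bilinear_matrix_vector]
  and matrix_mult_rules = bilinear_rules[OF bilinear_matrix_mult]

lemma linear_transpose3: "linear (transpose :: real ^ 3 ^ 3 \<Rightarrow> _)"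
  by (auto intro!: linearI simp: vec_eq_iff)

lemma bilinear_transpose:
  fixes B :: "real ^ 3 ^ 3 \<Rightarrow> real ^ 3 ^ 3 \<Rightarrow> real ^ 3 ^ 3"
  assumes "bilinear B"
  shows "bilinear (\<lambda>X Y. transpose (B (transpose X) (transpose Y)))"
  using linear_add[OF linear_transpose3] linear_scale[OF linear_transpose3]
  by (auto simp: bilinear_def bilinear_rules[OF assms] intro!: linearI)

lemma outer_vector [simp]: "outer u v *v z = (v \<bullet> z) *\<^sub>R u"
  by (simp add: vec_eq_iff forall_3 matrix_vector_nth3 inner_vec3 algebra_simps)

lemma matrix_zeroI:
  fixes M :: "real ^ 3 ^ 3"
  assumes "\<And>i j. ax i \<bullet> (M *v ax j) = 0" shows "M = 0"
  using assms by (simp add: vec_eq_iff matrix_vector_mult_basis inner_axis' column_def)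

text \<open>The \<open>j\<close>-th column of the value at \<open>outer u (ax j)\<close> is a quadratic field in \<open>u\<close> tangent to the spheres.
  This produces the left infinitesimal rotation on the matrices \<open>outer u (ax j)\<close>, and linearity
  extends it. The right one comes from the transposed map.\<close>
lemma column_generator:
  fixes B :: "real ^ 3 ^ 3 \<Rightarrow> real ^ 3 ^ 3 \<Rightarrow> real ^ 3 ^ 3"
  assumes B: "bilinear B" and radial: "\<And>X. B X X \<bullet> X = 0"
  shows "\<exists>b. linear b \<and> (\<forall>u j. B (outer u (ax j)) (outer u (ax j)) *v ax j = cross3 (b (outer u (ax j))) u)"
proof -
  have "\<exists>M :: real ^ 3 ^ 3. \<forall>u. B (outer u (ax j)) (outer u (ax j)) *v ax j = cross3 (M *v u) u" for j
  proof (rule quadratic_tangential[where f = "\<lambda>u u'. B (outer u (ax j)) (outer u' (ax j)) *v ax j"])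
    show "bilinear (\<lambda>u u'. B (outer u (ax j)) (outer u' (ax j)) *v ax j)"
      by (auto simp: bilinear_def intro!: linearI
          simp: bilinear_rules[OF B] outer_rules matrix_vector_rules)
    show "(B (outer v (ax j)) (outer v (ax j)) *v ax j) \<bullet> v = 0" for v
      using radial[of "outer v (ax j)"] by (simp add: inner_outer inner_commute[of _ v])
  qed
  then obtain M :: "3 \<Rightarrow> real ^ 3 ^ 3"
    where M: "\<And>j u. B (outer u (ax j)) (outer u (ax j)) *v ax j = cross3 (M j *v u) u" by metis
  define b where "b X = (\<Sum>i\<in>UNIV. M i *v (X *v ax i))" for X :: "real ^ 3 ^ 3"
  have "linear b"
    unfolding b_def by (auto intro!: linearI
        simp: matrix_vector_rules sum.distrib scaleR_sum_right)
  moreover have "b (outer u (ax j)) = M j *v u" for u j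
  proof -
    have "b (outer u (ax j)) = (\<Sum>i\<in>UNIV. if i = j then M j *v u else 0)"
      unfolding b_def by (rule sum.cong) (auto simp: matrix_vector_rules)
    then show ?thesis by simp
  qed
  ultimately show ?thesis using M by auto
qed

text \<open>Every column of the value at \<open>outer u v\<close> is a multiple of \<open>u\<close>. This uses twice that a radial quadratic map
  which vanishes on a basis is zero: first in \<open>u\<close>, for the columns of the value at \<open>outer u (ax j)\<close>,
  and then in \<open>v\<close>.\<close>
lemma quadratic_rank_one_rows:
  fixes B :: "real ^ 3 ^ 3 \<Rightarrow> real ^ 3 ^ 3 \<Rightarrow> real ^ 3 ^ 3"
  assumes B: "bilinear B"
    and normal: "\<And>u v w z. u \<bullet> w = 0 \<Longrightarrow> v \<bullet> z = 0 \<Longrightarrow> B (outer u v) (outer u v) \<bullet> outer w z = 0"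
    and col: "\<And>u j. B (outer u (ax j)) (outer u (ax j)) *v ax j = 0"
    and corner: "\<And>i j. B (outer (ax i) (ax j)) (outer (ax i) (ax j)) = 0"
    and "u \<bullet> w = 0"
  shows "transpose (B (outer u v) (outer u v)) *v w = 0"
proof -
  note simps = bilinear_rules[OF B] outer_rules matrix_vector_rules
  have "B (outer u (ax j)) (outer u (ax j)) *v ax l = 0" for j l
  proof (cases "l = j")
    case False
    show ?thesis
    proof (rule quadratic_radial_zero[where f = "\<lambda>u u'. B (outer u (ax j)) (outer u' (ax j)) *v ax l"])
      show "bilinear (\<lambda>u u'. B (outer u (ax j)) (outer u' (ax j)) *v ax l)"
        by (auto simp: bilinear_def intro!: linearI simp: simps)
      show "(B (outer v (ax j)) (outer v (ax j)) *v ax l) \<bullet> w = 0" if "v \<bullet> w = 0" for v w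
        using normal[OF that, of "ax j" "ax l"] False by (simp add: inner_outer inner_commute[of _ w])
    qed (simp add: corner simps)
  qed (simp add: col)
  then have column: "B (outer u (ax j)) (outer u (ax j)) = 0" for j
    by (intro matrix_zeroI) simp
  show ?thesis
  proof (rule quadratic_radial_zero[where f = "\<lambda>v v'. transpose (B (outer u v) (outer u v')) *v w"])
    show "bilinear (\<lambda>v v'. transpose (B (outer u v) (outer u v')) *v w)"
      using linear_add[OF linear_transpose3] linear_scale[OF linear_transpose3]
      by (auto simp: bilinear_def intro!: linearI simp: simps simp del: transpose_matrix_vector)
    show "(transpose (B (outer u v) (outer u v)) *v w) \<bullet> z = 0" if "v \<bullet> z = 0" for v z
      using normal[OF assms(5) that] by (simp add: inner_outer dot_lmul_matrix)
  qed (simp add: column simps linear_0[OF linear_transpose3] del: transpose_matrix_vector)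
qed

lemma orthogonal_decomposition:
  fixes u x :: "real ^ 3" assumes "u \<noteq> 0" shows "\<exists>k w. x = k *\<^sub>R u + w \<and> u \<bullet> w = 0"
proof (intro exI conjI)
  show "x = ((u \<bullet> x) / (u \<bullet> u)) *\<^sub>R u + (x - ((u \<bullet> x) / (u \<bullet> u)) *\<^sub>R u)" by simp
  show "u \<bullet> (x - ((u \<bullet> x) / (u \<bullet> u)) *\<^sub>R u) = 0" using assms by (simp add: inner_diff_right)
qed

text \<open>By the preceding lemma and its transpose, the value at \<open>outer u v\<close> is a multiple of \<open>outer u v\<close>;
  it is also orthogonal to \<open>outer u v\<close>, hence zero.\<close>
lemma quadratic_rank_one_zero:
  fixes B :: "real ^ 3 ^ 3 \<Rightarrow> real ^ 3 ^ 3 \<Rightarrow> real ^ 3 ^ 3"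
  assumes B: "bilinear B" and radial: "\<And>X. B X X \<bullet> X = 0"
    and normal: "\<And>u v w z. u \<bullet> w = 0 \<Longrightarrow> v \<bullet> z = 0 \<Longrightarrow> B (outer u v) (outer u v) \<bullet> outer w z = 0"
    and col: "\<And>u j. B (outer u (ax j)) (outer u (ax j)) *v ax j = 0"
    and row: "\<And>i v. transpose (B (outer (ax i) v) (outer (ax i) v)) *v ax i = 0"
  shows "B (outer u v) (outer u v) = 0"
proof (cases "u = 0 \<or> v = 0")
  case True
  then have "outer u v = 0" by (auto simp: vec_eq_iff)
  then show ?thesis by (simp add: bilinear_rules[OF B])
next
  case False
  have corner: "B (outer (ax i) (ax j)) (outer (ax i) (ax j)) = 0" for i j
  proof (rule matrix_zeroI)
    fix k l
    have "ax k \<bullet> (B (outer (ax i) (ax j)) (outer (ax i) (ax j)) *v ax l) = 0" if "k \<noteq> i" "l \<noteq> j"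
      using normal[of "ax i" "ax k" "ax j" "ax l"] that by (simp add: inner_outer)
    moreover have "ax i \<bullet> (B (outer (ax i) (ax j)) (outer (ax i) (ax j)) *v ax l) = 0"
      using row[of i "ax j"] by (simp add: dot_lmul_matrix[symmetric])
    ultimately show "ax k \<bullet> (B (outer (ax i) (ax j)) (outer (ax i) (ax j)) *v ax l) = 0"
      using col[of "ax i" j] by (cases "k = i"; cases "l = j") auto
  qed
  define M where "M = B (outer u v) (outer u v)"
  have M1: "w \<bullet> (M *v y) = 0" if "u \<bullet> w = 0" for w y
  proof -
    have "transpose M *v w = 0"
      unfolding M_def by (rule quadratic_rank_one_rows[OF B normal col corner that])
    then show ?thesis by (simp flip: dot_lmul_matrix)
  qed
  have M2: "M *v z = 0" if "v \<bullet> z = 0" for z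
  proof -
    have "transpose (transpose (B (transpose (outer v u)) (transpose (outer v u)))) *v z = 0"
    proof (rule quadratic_rank_one_rows[where B = "\<lambda>X Y. transpose (B (transpose X) (transpose Y))",
          OF bilinear_transpose[OF B] _ _ _ that])
      show "transpose (B (transpose (outer u v)) (transpose (outer u v))) \<bullet> outer w z = 0"
        if "u \<bullet> w = 0" "v \<bullet> z = 0" for u v w z
        using normal[OF that(2,1)] inner_transpose[of _ "outer z w"] by (simp add: transpose_outer)
    qed (use row corner in \<open>simp_all add: transpose_outer linear_0[OF linear_transpose3] del: transpose_matrix_vector\<close>)
    then show ?thesis by (simp add: transpose_outer M_def)
  qed
  have M3: "u \<bullet> (M *v v) = 0"
    using radial[of "outer u v"] by (simp add: M_def inner_outer)
  have "M = 0"
  proof (rule matrix_zeroI)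
    fix i j
    obtain k w where x: "ax i = k *\<^sub>R u + w" "u \<bullet> w = 0" using orthogonal_decomposition False by metis
    obtain k' z where y: "ax j = k' *\<^sub>R v + z" "v \<bullet> z = 0" using orthogonal_decomposition False by metis
    show "ax i \<bullet> (M *v ax j) = 0"
      unfolding x y using M1[OF x(2)] M2[OF y(2)] M3
      by (simp add: matrix_vector_rules inner_add_left inner_add_right)
  qed
  then show ?thesis by (simp add: M_def)
qed

section \<open>Cofactors and the stabiliser of the determinant\<close>

lemma alternating_via_cross:
  fixes F :: "real ^ 3 \<Rightarrow> real ^ 3 \<Rightarrow> 'v::real_vector"
  assumes F: "bilinear F" and alt: "\<And>x. F x x = 0"
  shows "\<exists>\<Lambda>. linear \<Lambda> \<and> (\<forall>x y. F x y = \<Lambda> (cross3 x y))"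
proof -
  define \<Lambda> where "\<Lambda> z = z $ 1 *\<^sub>R F (ax 2) (ax 3) + z $ 2 *\<^sub>R F (ax 3) (ax 1) + z $ 3 *\<^sub>R F (ax 1) (ax 2)" for z :: "real ^ 3"
  have skew: "F x y = - F y x" for x y
  proof -
    have "F x y + F y x = 0"
      using alt[of "x + y"] alt[of x] alt[of y] by (simp add: bilinear_rules[OF F] add.commute)
    then show ?thesis using eq_neg_iff_add_eq_0 by blast
  qed
  have "linear \<Lambda>"
    by (auto intro!: linearI simp: \<Lambda>_def algebra_simps)
  moreover have "F x y = \<Lambda> (cross3 x y)" for x y
  proof -
    have "F x y = F (x $ 1 *\<^sub>R ax 1 + x $ 2 *\<^sub>R ax 2 + x $ 3 *\<^sub>R ax 3) (y $ 1 *\<^sub>R ax 1 + y $ 2 *\<^sub>R ax 2 + y $ 3 *\<^sub>R ax 3)"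
      using vec3_expand[of x] vec3_expand[of y] by simp
    also have "\<dots> = \<Lambda> (cross3 x y)"
      using skew[of "ax 2" "ax 1"] skew[of "ax 3" "ax 2"] skew[of "ax 1" "ax 3"]
      by (simp add: bilinear_rules[OF F] alt \<Lambda>_def algebra_simps)
    finally show ?thesis .
  qed
  ultimately show ?thesis by blast
qed

lemma matrix_rows_expand:
  "X = outer (ax 1) (X $ 1) + outer (ax 2) (X $ 2) + outer (ax 3) (X $ 3)"
  by (simp add: matrix_eq3)

text \<open>The symmetric square of \<open>E \<otimes> F\<close> is \<open>S\<^sup>2E \<otimes> S\<^sup>2F \<oplus> \<Lambda>\<^sup>2E \<otimes> \<Lambda>\<^sup>2F\<close>. Rank one matrices
  detect the first summand; the second one is read off from the two by two minors, which are
  the entries of \<open>cof X\<close>.\<close>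
lemma quadratic_via_cof:
  fixes B :: "real ^ 3 ^ 3 \<Rightarrow> real ^ 3 ^ 3 \<Rightarrow> 'v::real_vector"
  assumes B: "bilinear B" and rank_one: "\<And>u v. B (outer u v) (outer u v) = 0"
  shows "\<exists>L. linear L \<and> (\<forall>X. B X X = L (cof X))"
proof -
  note simps = bilinear_rules[OF B] outer_rules
  have "\<exists>\<Lambda>. linear \<Lambda> \<and> (\<forall>x y. B (outer (ax i) x) (outer (ax j) y) + B (outer (ax j) y) (outer (ax i) x) = \<Lambda> (cross3 x y))"
    for i j
  proof (rule alternating_via_cross[where F = "\<lambda>x y. B (outer (ax i) x) (outer (ax j) y) + B (outer (ax j) y) (outer (ax i) x)"])
    show "bilinear (\<lambda>x y. B (outer (ax i) x) (outer (ax j) y) + B (outer (ax j) y) (outer (ax i) x))"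
      by (auto simp: bilinear_def intro!: linearI simp: simps algebra_simps)
    show "B (outer (ax i) x) (outer (ax j) x) + B (outer (ax j) x) (outer (ax i) x) = 0" for x
      using rank_one[of "ax i + ax j" x] by (simp add: simps rank_one add.commute)
  qed
  then obtain \<Lambda> where \<Lambda>: "\<And>i j. linear (\<Lambda> i j)"
    "\<And>i j x y. B (outer (ax i) x) (outer (ax j) y) + B (outer (ax j) y) (outer (ax i) x) = \<Lambda> i j (cross3 x y)"
    by metis
  define L where "L C = \<Lambda> 2 3 (C $ 1) + \<Lambda> 3 1 (C $ 2) + \<Lambda> 1 2 (C $ 3)" for C :: "real ^ 3 ^ 3"
  have "linear L"
    by (auto intro!: linearI simp: L_def linear_add[OF \<Lambda>(1)] linear_scale[OF \<Lambda>(1)] algebra_simps)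
  moreover have "B X X = L (cof X)" for X
  proof -
    have "B X X = B (outer (ax 1) (X $ 1) + outer (ax 2) (X $ 2) + outer (ax 3) (X $ 3))
      (outer (ax 1) (X $ 1) + outer (ax 2) (X $ 2) + outer (ax 3) (X $ 3))"
      using matrix_rows_expand[of X] by simp
    also have "\<dots> = L (cof X)"
      by (simp add: simps rank_one L_def flip: \<Lambda>(2))
    finally show ?thesis .
  qed
  ultimately show ?thesis by blast
qed

text \<open>Taking cofactors twice multiplies by the determinant. (As \<open>det (cof X) = (det X)\<^sup>2\<close>, a negative
  determinant is impossible.)\<close>
lemma cof_surj_det_pos:
  assumes "det C > 0" shows "\<exists>X. cof X = C"
proof
  \<comment> \<open>Two scalings by the fourth root of \<open>1 / det C\<close>, since \<open>cof\<close> is homogeneous of degree two.\<close>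
  show "cof ((1 / sqrt (sqrt (det C))) *\<^sub>R ((1 / sqrt (sqrt (det C))) *\<^sub>R cof C)) = C"
    using assms by (simp add: cof_scaleR cof_cof power2_eq_square)
qed

text \<open>The determinant is a monic cubic polynomial in \<open>s\<close>; an explicit bound for its roots.\<close>
lemma det_shift_pos:
  fixes C :: "real ^ 3 ^ 3"
  shows "\<exists>s0. \<forall>s\<ge>s0. det (C + s *\<^sub>R mat 1) > 0"
proof -
  define \<alpha> \<beta> where "\<alpha> = C$1$1 + C$2$2 + C$3$3" and
    "\<beta> = C$1$1 * C$2$2 + C$1$1 * C$3$3 + C$2$2 * C$3$3 - C$1$2 * C$2$1 - C$1$3 * C$3$1 - C$2$3 * C$3$2"
  have det: "det (C + s *\<^sub>R mat 1) = s * (s * s) + \<alpha> * (s * s) + \<beta> * s + det C" for s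
    by (simp add: det_3 mat_def \<alpha>_def \<beta>_def algebra_simps)
  have "det (C + s *\<^sub>R mat 1) > 0" if s: "s \<ge> 1 + \<bar>\<alpha>\<bar> + \<bar>\<beta>\<bar> + \<bar>det C\<bar>" for s
  proof -
    have s1: "1 \<le> s" using s by linarith
    then have ss: "s \<le> s * s" using mult_left_mono[of 1 s s] by simp
    then have ss1: "1 \<le> s * s" using s1 by linarith
    have "s * (s * s) \<ge> (1 + \<bar>\<alpha>\<bar> + \<bar>\<beta>\<bar> + \<bar>det C\<bar>) * (s * s)"
      using s by (intro mult_right_mono) simp_all
    moreover have "\<alpha> * (s * s) \<ge> - \<bar>\<alpha>\<bar> * (s * s)" by (intro mult_right_mono) simp_all
    moreover have "\<beta> * s \<ge> - (\<bar>\<beta>\<bar> * (s * s))"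
    proof -
      have "\<bar>\<beta>\<bar> * s \<le> \<bar>\<beta>\<bar> * (s * s)" using ss by (intro mult_left_mono) simp_all
      moreover have "- \<bar>\<beta>\<bar> * s \<le> \<beta> * s" using s1 by (intro mult_right_mono) simp_all
      ultimately show ?thesis by simp
    qed
    moreover have "\<bar>det C\<bar> * 1 \<le> \<bar>det C\<bar> * (s * s)" using ss1 by (intro mult_left_mono) simp_all
    ultimately show ?thesis unfolding det using ss1 by (simp add: algebra_simps)
  qed
  then show ?thesis by blast
qed

text \<open>For all large \<open>s\<close> the matrix \<open>C + s *\<^sub>R mat 1\<close> is a cofactor matrix, so a quadratic polynomial in \<open>s\<close>
  vanishes for large \<open>s\<close>, hence at \<open>s = 0\<close>.\<close>
lemma linear_skew_on_cof:
  fixes L :: "real ^ 3 ^ 3 \<Rightarrow> real ^ 3 ^ 3"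
  assumes L: "linear L" and skew: "\<And>X. L (cof X) \<bullet> cof X = 0"
  shows "L C \<bullet> C = 0"
proof -
  obtain s0 where s0: "\<And>s. s \<ge> s0 \<Longrightarrow> det (C + s *\<^sub>R mat 1) > 0" using det_shift_pos by blast
  define I where "I = (mat 1 :: real ^ 3 ^ 3)"
  have zero: "L C \<bullet> C + s * (L C \<bullet> I + L I \<bullet> C) + s * s * (L I \<bullet> I) = 0" if s: "s \<ge> s0" for s
  proof -
    obtain X where "cof X = C + s *\<^sub>R I" using cof_surj_det_pos s0[OF s] I_def by blast
    then have "L (C + s *\<^sub>R I) \<bullet> (C + s *\<^sub>R I) = 0" using skew by metis
    then show ?thesis
      by (simp add: linear_add[OF L] linear_scale[OF L] inner_add_left inner_add_right algebra_simps)
  qed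
  define a b c where "a = L C \<bullet> C" and "b = L C \<bullet> I + L I \<bullet> C" and "c = L I \<bullet> I"
  have "a + s0 * b + s0 * s0 * c = 0" "a + (s0 + 1) * b + (s0 + 1) * (s0 + 1) * c = 0"
    "a + (s0 + 2) * b + (s0 + 2) * (s0 + 2) * c = 0"
    unfolding a_def b_def c_def using zero[of s0] zero[of "s0 + 1"] zero[of "s0 + 2"] by simp_all
  then have "b + 2 * s0 * c + c = 0" "2 * c = 0" by (simp_all add: algebra_simps)
  then have "c = 0" "b = 0" by simp_all
  then show ?thesis using \<open>a + s0 * b + s0 * s0 * c = 0\<close> by (simp add: a_def)
qed

abbreviation unit :: "3 \<Rightarrow> 3 \<Rightarrow> real ^ 3 ^ 3" where "unit i j \<equiv> outer (ax i) (ax j)"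

lemma linear_eq_on_units:
  fixes f g :: "real ^ 3 ^ 3 \<Rightarrow> 'v::real_vector"
  assumes f: "linear f" and g: "linear g" and units: "\<And>i j. f (unit i j) = g (unit i j)"
  shows "f X = g X"
proof -
  have X: "X = (\<Sum>i\<in>UNIV. \<Sum>j\<in>UNIV. X $ i $ j *\<^sub>R unit i j)"
    by (simp add: matrix_eq3 sum_3)
  show ?thesis
    by (subst (1 2) X) (simp add: linear_sum[OF f] linear_sum[OF g] linear_scale[OF f] linear_scale[OF g] units)
qed

lemma skew_polar:
  fixes L :: "'v::real_inner \<Rightarrow> 'v"
  assumes L: "linear L" and skew: "\<And>X. L X \<bullet> X = 0"
  shows "L X \<bullet> Y = - (X \<bullet> L Y)"
  using skew[of "X + Y"]
  by (simp add: linear_add[OF L] inner_add_left inner_add_right skew inner_commute[of X] eq_neg_iff_add_eq_0 add.commute)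

lemma exists_other_index: "\<exists>l::3. l \<noteq> j"
proof -
  have "(1::3) \<noteq> 2" by simp
  then show ?thesis by metis
qed

lemma hat_surj_skew:
  assumes "\<And>i j. K $ j $ i = - K $ i $ j" shows "\<exists>k. K = hat k"
proof -
  have "transpose K $ i $ j = (- K) $ i $ j" for i j
    using assms[of j i] by simp
  then have "K \<in> {B. transpose B = - B}" by (simp only: vec_eq_iff mem_Collect_eq) blast
  then show ?thesis unfolding so3_eq_range_hat by blast
qed

text \<open>The infinitesimal stabiliser of the determinant in the orthogonal Lie algebra consists of left and right
  multiplications by skew matrices. On matrix units, orthogonality to the normal directions
  kills every entry of \<open>L (unit i j)\<close> outside row \<open>i\<close> and column \<open>j\<close>; applied to the sum of
  two units in the same row or column it shows that the column entries do not depend on \<open>j\<close>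
  and the row entries do not depend on \<open>i\<close>.\<close>
lemma det_stabilizer:
  fixes L :: "real ^ 3 ^ 3 \<Rightarrow> real ^ 3 ^ 3"
  assumes L: "linear L" and skew: "\<And>X. L X \<bullet> X = 0" and cof: "\<And>X. L X \<bullet> cof X = 0"
  shows "\<exists>a k. \<forall>X. L X = hat a ** X + X ** hat k"
proof -
  define l where "l i j k m = ax k \<bullet> (L (unit i j) *v ax m)" for i j k m
  note simps = linear_add[OF L] linear_diff[OF L] linear_scale[OF L] outer_rules matrix_vector_rules
  have normal: "w \<bullet> (L (outer u v) *v z) = 0" if "u \<bullet> w = 0" "v \<bullet> z = 0" for u v w z
    using linear_normal_zero[OF L cof that] by (simp add: inner_outer)
  have lskew: "l i j k m = - l k m i j" for i j k m
    using skew_polar[OF L skew, of "unit i j" "unit k m"]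
    by (simp add: l_def inner_outer inner_commute[of "unit i j"])
  have off: "l i j k m = 0" if "i \<noteq> k" "j \<noteq> m" for i j k m
    unfolding l_def using that by (intro normal) simp_all
  have col: "l i j k j = l i n k n" if "i \<noteq> k" for i j k n
  proof (cases "j = n")
    case False
    have "ax k \<bullet> (L (outer (ax i) (ax j + ax n)) *v (ax j - ax n)) = 0"
      using that False by (intro normal) (simp_all add: inner_add_left inner_diff_right)
    then have "l i j k j - l i j k n + l i n k j - l i n k n = 0"
      by (simp add: simps l_def inner_add_right inner_diff_right)
    then show ?thesis using off[OF that, of j n] off[OF that, of n j] False by simp
  qed simp
  have row: "l i j i m = l n j n m" if "j \<noteq> m" for i j m n
  proof (cases "i = n")
    case False
    have "(ax i - ax n) \<bullet> (L (outer (ax i + ax n) (ax j)) *v ax m) = 0"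
      using that False by (intro normal) (simp_all add: inner_add_left inner_diff_right)
    then have "l i j i m + l n j i m - l i j n m - l n j n m = 0"
      by (simp add: simps l_def inner_add_right inner_diff_left)
    then show ?thesis using off[of i n j m] off[of n i j m] that False by simp
  qed simp
  obtain a where a: "(\<chi> k i. l i 1 k 1) = hat a"
    using hat_surj_skew[of "\<chi> k i. l i 1 k 1"] lskew unfolding vec_lambda_beta by metis
  obtain h where h: "(\<chi> j m. l 1 j 1 m) = hat h"
    using hat_surj_skew[of "\<chi> j m. l 1 j 1 m"] lskew unfolding vec_lambda_beta by metis
  have a': "hat a $ k $ i = l i 1 k 1" for k i using a by (simp add: vec_eq_iff)
  have h': "hat h $ j $ m = l 1 j 1 m" for j m using h by (simp add: vec_eq_iff)
  have diag: "l i j i j = 0" for i j using lskew[of i j i j] by simp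
  have "L X = hat a ** X + X ** hat h" for X
  proof (rule linear_eq_on_units[OF L])
    show "linear (\<lambda>X. hat a ** X + X ** hat h)"
      by (auto intro!: linearI simp: matrix_mult_rules algebra_simps)
    fix i j
    have entry: "ax k \<bullet> ((hat a ** unit i j + unit i j ** hat h) *v ax m) =
       (if m = j then hat a $ k $ i else 0) + (if k = i then hat h $ j $ m else 0)" for k m
      by (simp add: inner_axis' matrix_vector_mult_basis column_def matrix_matrix_mult_def if_distrib[of "\<lambda>x. _ * x"]
          if_distrib[of "\<lambda>x. x * _"] cong: if_cong)
    have "l i j k m = (if m = j then hat a $ k $ i else 0) + (if k = i then hat h $ j $ m else 0)" for k m
      unfolding a' h' using off[of i k j m] col[of i k j 1] row[of j m i 1] diag[of i j] diag[of i 1] diag[of 1 j] by auto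
    then have "L (unit i j) - (hat a ** unit i j + unit i j ** hat h) = 0"
      using entry by (intro matrix_zeroI) (simp add: matrix_vector_rules inner_diff_right l_def[symmetric])
    then show "L (unit i j) = hat a ** unit i j + unit i j ** hat h" by simp
  qed
  then show ?thesis by blast
qed

section \<open>Quadratic maps tangent to the orbits\<close>

text \<open>A quadratic vector field tangent to the level sets of the norm and of the determinant comes from
  infinitesimal rotations on both sides that depend linearly on the point. Such rotations are
  found on rank one matrices; what remains after subtracting them is \<open>L (cof X)\<close>. Here the
  hypotheses force \<open>L\<close> into the stabiliser of the determinant, and \<open>cof_hat\<close> brings it into the
  required form.\<close>
theorem quadratic_tangent_to_orbits:
  fixes B :: "real ^ 3 ^ 3 \<Rightarrow> real ^ 3 ^ 3 \<Rightarrow> real ^ 3 ^ 3"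
  assumes B: "bilinear B" and radial: "\<And>X. B X X \<bullet> X = 0" and cof: "\<And>X. B X X \<bullet> cof X = 0"
  shows "\<exists>b c. linear b \<and> linear c \<and> (\<forall>X. B X X = hat (b X) ** X + X ** hat (c X))"
proof -
  obtain b where b: "linear b"
    "\<And>u j. B (outer u (ax j)) (outer u (ax j)) *v ax j = cross3 (b (outer u (ax j))) u"
    using column_generator[OF B radial] by blast
  have "transpose (B (transpose X) (transpose X)) \<bullet> X = 0" for X
    using radial[of "transpose X"] inner_transpose[of "B (transpose X) (transpose X)" "transpose X"] by simp
  then obtain c' where c': "linear c'"
    "\<And>v i. transpose (B (transpose (outer v (ax i))) (transpose (outer v (ax i)))) *v ax i = cross3 (c' (outer v (ax i))) v"
    using column_generator[OF bilinear_transpose[OF B]] by blast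
  define c where "c X = - c' (transpose X)" for X
  have c: "linear c"
    using linear_compose_neg[OF linear_compose[OF linear_transpose3 c'(1)]] by (simp add: c_def[abs_def] comp_def)
  have hat_vec: "hat a *v x = cross3 a x" "transpose (hat a) *v x = - cross3 a x" for a x
    by (simp_all add: vec_eq_iff forall_3 matrix_vector_nth3 del: transpose_matrix_vector)
  define D where "D X Y = B X Y - (hat (b X) ** Y + Y ** hat (c X))" for X Y
  have D: "bilinear D"
    unfolding D_def bilinear_def
    by (auto intro!: linearI simp: bilinear_rules[OF B] matrix_mult_rules
        linear_add[OF b(1)] linear_add[OF c] linear_scale[OF b(1)] linear_scale[OF c]
        linear_add[OF linear_hat] linear_scale[OF linear_hat] algebra_simps)
  have D_radial: "D X X \<bullet> X = 0" and D_cof: "D X X \<bullet> cof X = 0" for X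
    by (simp_all add: D_def inner_diff_left inner_add_left radial cof hat_orthogonal)
  have D_rank_one: "D (outer u v) (outer u v) = 0" for u v
  proof (rule quadratic_rank_one_zero[OF D D_radial])
    show "D (outer u v) (outer u v) \<bullet> outer w z = 0" if "u \<bullet> w = 0" "v \<bullet> z = 0" for u v w z
      by (rule quadratic_normal_zero[OF D D_cof that])
    show "D (outer u (ax j)) (outer u (ax j)) *v ax j = 0" for u j
    proof -
      have "(hat (b (outer u (ax j))) ** outer u (ax j)) *v ax j = cross3 (b (outer u (ax j))) u"
        by (simp flip: matrix_vector_mul_assoc add: hat_vec)
      moreover have "(outer u (ax j) ** hat k) *v ax j = 0" for k
        using dot_cross_self[of "ax j" k] by (simp flip: matrix_vector_mul_assoc add: hat_vec)
      ultimately show ?thesis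
        by (simp add: D_def matrix_vector_rules b(2))
    qed
    show "transpose (D (outer (ax i) v) (outer (ax i) v)) *v ax i = 0" for i v
    proof -
      have "transpose (outer (ax i) v ** hat (c (outer (ax i) v))) *v ax i = cross3 (c' (outer v (ax i))) v"
        by (simp flip: matrix_vector_mul_assoc add: matrix_transpose_mul transpose_outer hat_vec c_def del: transpose_matrix_vector)
      moreover have "transpose (hat k ** outer (ax i) v) *v ax i = 0" for k
        using dot_cross_self[of "ax i" k] by (simp flip: matrix_vector_mul_assoc
            add: matrix_transpose_mul transpose_outer hat_vec del: transpose_matrix_vector)
      moreover have "transpose (B (outer (ax i) v) (outer (ax i) v)) *v ax i = cross3 (c' (outer v (ax i))) v"
        using c'(2)[of v i] by (simp add: transpose_outer)
      ultimately show ?thesis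
        by (simp add: D_def linear_diff[OF linear_transpose3] linear_add[OF linear_transpose3]
            matrix_vector_rules del: transpose_matrix_vector)
    qed
  qed
  obtain L where L: "linear L" "\<And>X. D X X = L (cof X)"
    using quadratic_via_cof[OF D D_rank_one] by blast
  have skew: "L X \<bullet> X = 0" for X
    using linear_skew_on_cof[OF L(1)] D_cof L(2) by simp
  have "L X \<bullet> cof X = 0" for X
    using skew_polar[OF L(1) skew, of X "cof X"] D_radial[of X] L(2) by (simp add: inner_commute)
  then obtain a k where ak: "\<And>X. L X = hat a ** X + X ** hat k"
    using det_stabilizer[OF L(1) skew] by blast
  have "linear (\<lambda>X. b X + X *v k)" "linear (\<lambda>X. c X + transpose X *v a)"
    using linear_add[OF b(1)] linear_scale[OF b(1)] linear_add[OF c] linear_scale[OF c]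
      linear_add[OF linear_transpose3] linear_scale[OF linear_transpose3]
    by (auto intro!: linearI simp: matrix_vector_rules algebra_simps simp del: transpose_matrix_vector)
  moreover have "B X X = hat (b X + X *v k) ** X + X ** hat (c X + transpose X *v a)" for X
  proof -
    have "B X X = hat (b X) ** X + X ** hat (c X) + (hat a ** cof X + cof X ** hat k)"
      using L(2)[of X] ak[of "cof X"] by (simp add: D_def algebra_simps)
    then show ?thesis
      by (simp add: cof_hat linear_add[OF linear_hat] matrix_mult_rules del: transpose_matrix_vector)
  qed
  ultimately show ?thesis by blast
qed

text \<open>In terms of matrix units, \<open>B E\<^sub>i\<^sub>j E\<^sub>k\<^sub>l \<bullet> E\<^sub>m\<^sub>n\<close> can only be nonzero if \<open>E\<^sub>k\<^sub>l\<close> and \<open>E\<^sub>m\<^sub>n\<close> lie in one row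
  or one column, and by antisymmetry the same holds for every pair of the three units. But the coefficient
  that describes the left factor is independent of \<open>l = n\<close>, so \<open>l\<close> can be chosen to
  violate this for another pair; similarly for the right factor.\<close>
theorem skew_torsion_part_unique:
  fixes B :: "real ^ 3 ^ 3 \<Rightarrow> real ^ 3 ^ 3 \<Rightarrow> real ^ 3 ^ 3"
  assumes B: "bilinear B" and h: "\<And>X. \<exists>a k. \<forall>Y. B X Y = hat a ** Y + Y ** hat k"
    and skew: "\<And>X Y. B X Y = - B Y X"
  shows "B X Y = 0"
proof -
  obtain b c where bc: "\<And>X Y. B X Y = hat (b X) ** Y + Y ** hat (c X)" using h by metis
  define t where "t i j k l m n = ax m \<bullet> (B (unit i j) (unit k l) *v ax n)" for i j k l m n
  have t: "t i j k l m n = (if n = l then hat (b (unit i j)) $ m $ k else 0) +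
      (if m = k then hat (c (unit i j)) $ l $ n else 0)" for i j k l m n
    unfolding t_def bc
    by (simp add: inner_axis' matrix_vector_mult_basis column_def matrix_matrix_mult_def if_distrib[of "\<lambda>x. _ * x"]
          if_distrib[of "\<lambda>x. x * _"] cong: if_cong)
  have hat_skew: "hat a $ i $ j = - hat a $ j $ i" for a i j
    using transpose_hat[of a] by (metis transpose_nth vector_uminus_component)
  have s1: "t i j k l m n = - t k l i j m n" for i j k l m n
    unfolding t_def by (subst skew) (simp add: matrix_vector_rules)
  have s2: "t i j k l m n = - t i j m n k l" for i j k l m n
    unfolding t using hat_skew[of _ m k] hat_skew[of _ l n] by auto
  have b0: "hat (b (unit i j)) $ m $ k = 0" for i j m k
  proof (cases "m = k")
    case False
    obtain l where l: "l \<noteq> j" using exists_other_index by blast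
    have e: "t i j k l m l = hat (b (unit i j)) $ m $ k" using False by (simp add: t)
    show ?thesis
    proof (cases "i = m")
      case False
      then have "t k l i j m l = 0" using l by (simp add: t)
      then show ?thesis using s1[of i j k l m l] e by simp
    next
      case True
      then have "t m l i j k l = 0" using l False by (simp add: t)
      then show ?thesis using s1[of i j m l k l] s2[of i j k l m l] e by simp
    qed
  qed (use hat_skew[of _ m m] in simp)
  have c0: "hat (c (unit i j)) $ l $ n = 0" for i j l n
  proof (cases "l = n")
    case False
    obtain k where k: "k \<noteq> i" using exists_other_index by blast
    have e: "t i j k l k n = hat (c (unit i j)) $ l $ n" using False by (simp add: t)
    show ?thesis
    proof (cases "j = n")
      case False
      then have "t k l i j k n = 0" using k by (simp add: t)
      then show ?thesis using s1[of i j k l k n] e by simp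
    next
      case True
      then have "t k n i j k l = 0" using k False by (simp add: t)
      then show ?thesis using s1[of i j k n k l] s2[of i j k l k n] e by simp
    qed
  qed (use hat_skew[of _ l l] in simp)
  have "hat (b (unit i j)) = 0" "hat (c (unit i j)) = 0" for i j
    by (simp_all add: vec_eq_iff b0 c0)
  then have units: "B (unit i j) Y = 0" for i j Y
    by (simp add: bc matrix_mult_rules)
  show ?thesis
    by (rule linear_eq_on_units[of "\<lambda>X. B X Y" "\<lambda>_. 0"])
      (auto intro!: linearI simp: units bilinear_rules[OF B])
qed

section \<open>The algebraic model in dimension nine\<close>

lemma exhaust_9:
  fixes x :: 9
  shows "x = 1 \<or> x = 2 \<or> x = 3 \<or> x = 4 \<or> x = 5 \<or> x = 6 \<or> x = 7 \<or> x = 8 \<or> x = 9"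
proof (induct x)
  case (of_int z)
  then have "z = 0 \<or> z = 1 \<or> z = 2 \<or> z = 3 \<or> z = 4 \<or> z = 5 \<or> z = 6 \<or> z = 7 \<or> z = 8" by fastforce
  then show ?case by auto
qed

lemma forall_9: "(\<forall>i::9. P i) \<longleftrightarrow> P 1 \<and> P 2 \<and> P 3 \<and> P 4 \<and> P 5 \<and> P 6 \<and> P 7 \<and> P 8 \<and> P 9"
  by (metis exhaust_9)

lemma sum_9: "sum f (UNIV :: 9 set) = f 1 + f 2 + f 3 + f 4 + f 5 + f 6 + f 7 + f 8 + f 9"
proof -
  have U: "UNIV = {1, 2, 3, 4, 5, 6, 7, 8, 9 :: 9}" using exhaust_9 by auto
  show ?thesis unfolding U by (simp add: add.assoc)
qed

lemma sigma_nth [simp]: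
  "\<sigma> a $ 1 $ 1 = a $ 1" "\<sigma> a $ 1 $ 2 = a $ 2" "\<sigma> a $ 1 $ 3 = a $ 3"
  "\<sigma> a $ 2 $ 1 = a $ 4" "\<sigma> a $ 2 $ 2 = a $ 5" "\<sigma> a $ 2 $ 3 = a $ 6"
  "\<sigma> a $ 3 $ 1 = a $ 7" "\<sigma> a $ 3 $ 2 = a $ 8" "\<sigma> a $ 3 $ 3 = a $ 9"
  by (simp_all add: \<sigma>_def)

lemma linear_sigma: "linear \<sigma>"
  by (auto intro!: linearI simp: matrix_eq3)

lemma inner_sigma: "\<sigma> x \<bullet> \<sigma> y = x \<bullet> y"
  by (simp add: inner_matrix3 inner_vec_def[of x y] sum_9)

lemma inj_sigma: "inj \<sigma>"
  by (rule injI) (simp add: matrix_eq3 vec_eq_iff forall_9)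

lemma surj_sigma: "surj \<sigma>"
proof (rule surjI)
  fix X
  show "\<sigma> (\<chi> i. if i = 1 then X$1$1 else if i = 2 then X$1$2 else if i = 3 then X$1$3 else if i = 4 then X$2$1 else
    if i = 5 then X$2$2 else if i = 6 then X$2$3 else if i = 7 then X$3$1 else if i = 8 then X$3$2 else X$3$3) = X"
    by (simp add: matrix_eq3)
qed

definition \<tau> :: "real ^ 3 ^ 3 \<Rightarrow> real ^ 9" where "\<tau> = inv \<sigma>"

lemma sigma_tau [simp]: "\<sigma> (\<tau> X) = X" and tau_sigma [simp]: "\<tau> (\<sigma> x) = x"
  unfolding \<tau>_def by (simp_all add: surj_f_inv_f surj_sigma inj_sigma)

lemma linear_tau: "linear \<tau>"
  by (rule linearI) (metis linear_add[OF linear_sigma] linear_scale[OF linear_sigma] sigma_tau tau_sigma)+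

lemmas sigma_tau_linear = linear_add[OF linear_sigma] linear_scale[OF linear_sigma]
  linear_add[OF linear_tau] linear_scale[OF linear_tau]

lemma trilinear_Upsilon0:
  "Upsilon0 (u + u') v w = Upsilon0 u v w + Upsilon0 u' v w"
  "Upsilon0 u (v + v') w = Upsilon0 u v w + Upsilon0 u v' w"
  "Upsilon0 u v (w + w') = Upsilon0 u v w + Upsilon0 u v w'"
  "Upsilon0 (s *\<^sub>R u) v w = s * Upsilon0 u v w"
  "Upsilon0 u (s *\<^sub>R v) w = s * Upsilon0 u v w"
  "Upsilon0 u v (s *\<^sub>R w) = s * Upsilon0 u v w"
  by (simp_all add: Upsilon0_def sym_prod3_def linear_add[OF linear_sigma] linear_scale[OF linear_sigma]
      sum_distrib_left algebra_simps add_divide_distrib flip: sum.distrib)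

lemma symmetric_Upsilon0: "Upsilon0 u v w = Upsilon0 v u w" "Upsilon0 u v w = Upsilon0 u w v"
  by (simp_all add: Upsilon0_def sym_prod3_def algebra_simps)

text \<open>Polarisation: the coefficient of \<open>s\<close> in \<open>det (\<sigma> (x + s *\<^sub>R u))\<close>, extracted from \<open>s = 1\<close> and \<open>s = -1\<close>.\<close>
lemma Upsilon0_cof: "Upsilon0 u x x = (\<sigma> u \<bullet> cof (\<sigma> x)) / 3"
proof -
  have pm: "det (\<sigma> (x + s *\<^sub>R u)) = det (\<sigma> x) + 3 * s * Upsilon0 u x x + 3 * s * s * Upsilon0 u u x + s * s * s * det (\<sigma> u)" for s
  proof -
    have "Upsilon0 x u x = Upsilon0 u x x" "Upsilon0 x x u = Upsilon0 u x x"
      "Upsilon0 u x u = Upsilon0 u u x" "Upsilon0 x u u = Upsilon0 u u x"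
      using symmetric_Upsilon0 by metis+
    then show ?thesis
      by (simp add: trilinear_Upsilon0 algebra_simps flip: Upsilon0_diagonal)
  qed
  have "6 * Upsilon0 u x x = det (\<sigma> (x + 1 *\<^sub>R u)) - det (\<sigma> (x + (-1) *\<^sub>R u)) - 2 * det (\<sigma> u)"
    unfolding pm by simp
  also have "\<dots> = 2 * (\<sigma> u \<bullet> cof (\<sigma> x))"
    unfolding linear_add[OF linear_sigma] linear_scale[OF linear_sigma] det_3 inner_matrix3
    by (simp add: algebra_simps)
  finally show ?thesis by simp
qed

lemma so3_LR_sigma:
  "M \<in> so3_LR \<longleftrightarrow> (\<exists>a k. \<forall>x. \<sigma> (M *v x) = hat a ** \<sigma> x + \<sigma> x ** hat k)"
proof
  assume "M \<in> so3_LR"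
  then obtain M1 M2 B1 B2 where M: "M = M1 + M2" and B: "B1 \<in> so3" "B2 \<in> so3"
    "\<And>x. \<sigma> (M1 *v x) = B1 ** \<sigma> x" "\<And>x. \<sigma> (M2 *v x) = - (\<sigma> x ** B2)"
    unfolding so3_LR_def so3_L_def so3_R_def by blast
  obtain a k where "B1 = hat a" "B2 = hat k"
    using B(1,2) unfolding so3_def so3_eq_range_hat by blast
  then have "\<sigma> (M *v x) = hat a ** \<sigma> x + \<sigma> x ** hat (- k)" for x
    using B(3,4)[of x]
    by (simp add: M matrix_vector_mult_add_rdistrib linear_add[OF linear_sigma] linear_neg[OF linear_hat]
        matrix_mult_rules)
  then show "\<exists>a k. \<forall>x. \<sigma> (M *v x) = hat a ** \<sigma> x + \<sigma> x ** hat k" by blast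
next
  assume "\<exists>a k. \<forall>x. \<sigma> (M *v x) = hat a ** \<sigma> x + \<sigma> x ** hat k"
  then obtain a k where M: "\<And>x. \<sigma> (M *v x) = hat a ** \<sigma> x + \<sigma> x ** hat k" by blast
  define M1 where "M1 = matrix (\<lambda>x. \<tau> (hat a ** \<sigma> x))"
  have "linear (\<lambda>x. \<tau> (hat a ** \<sigma> x))"
    by (auto intro!: linearI simp: sigma_tau_linear matrix_mult_rules)
  then have M1: "\<sigma> (M1 *v x) = hat a ** \<sigma> x" for x
    unfolding M1_def by (simp add: matrix_works)
  have hat_so3: "hat h \<in> so3" for h unfolding so3_def so3_eq_range_hat by blast
  have "M1 \<in> so3_L" unfolding so3_L_def using M1 hat_so3 by blast
  moreover have "\<sigma> ((M - M1) *v x) = - (\<sigma> x ** hat (- k))" for x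
    by (simp add: matrix_vector_mult_diff_rdistrib linear_diff[OF linear_sigma] M M1 linear_neg[OF linear_hat]
        matrix_mult_rules)
  then have "M - M1 \<in> so3_R" unfolding so3_R_def using hat_so3 by blast
  ultimately show "M \<in> so3_LR" unfolding so3_LR_def by force
qed

lemma subspace_so3_LR: "subspace so3_LR"
  unfolding subspace_def
proof (intro conjI ballI allI)
  show "0 \<in> so3_LR"
    unfolding so3_LR_sigma by (rule exI[of _ 0], rule exI[of _ 0])
      (simp add: linear_0[OF linear_sigma] linear_0[OF linear_hat] matrix_mult_rules)
  fix M N assume "M \<in> so3_LR" "N \<in> so3_LR"
  then obtain a k a' k' where "\<And>x. \<sigma> (M *v x) = hat a ** \<sigma> x + \<sigma> x ** hat k"
    "\<And>x. \<sigma> (N *v x) = hat a' ** \<sigma> x + \<sigma> x ** hat k'" unfolding so3_LR_sigma by blast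
  then show "M + N \<in> so3_LR"
    unfolding so3_LR_sigma by (intro exI[of _ "a + a'"] exI[of _ "k + k'"])
      (simp add: matrix_vector_mult_add_rdistrib linear_add[OF linear_sigma] linear_add[OF linear_hat] matrix_mult_rules)
next
  fix s M assume "M \<in> so3_LR"
  then obtain a k where "\<And>x. \<sigma> (M *v x) = hat a ** \<sigma> x + \<sigma> x ** hat k" unfolding so3_LR_sigma by blast
  then show "s *\<^sub>R M \<in> so3_LR"
    unfolding so3_LR_sigma by (intro exI[of _ "s *\<^sub>R a"] exI[of _ "s *\<^sub>R k"])
      (simp add: scaleR_matrix_vector_assoc[symmetric] linear_scale[OF linear_sigma] linear_scale[OF linear_hat] matrix_mult_rules algebra_simps)
qed

text \<open>The Lie algebra as the stabiliser of the metric and of the cubic form. It turns the condition on a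
  connection form into the parallelism of two tensors, which is independent of the coframe.\<close>
lemma so3_LR_iff:
  "M \<in> so3_LR \<longleftrightarrow> (\<forall>x. (M *v x) \<bullet> x = 0) \<and> (\<forall>x. Upsilon0 (M *v x) x x = 0)"
proof
  assume "M \<in> so3_LR"
  then obtain a k where M: "\<And>x. \<sigma> (M *v x) = hat a ** \<sigma> x + \<sigma> x ** hat k"
    unfolding so3_LR_sigma by blast
  have "(M *v x) \<bullet> x = 0" for x
    by (simp add: M inner_add_left hat_orthogonal flip: inner_sigma)
  moreover have "Upsilon0 (M *v x) x x = 0" for x
    by (simp add: M inner_add_left hat_orthogonal Upsilon0_cof)
  ultimately show "(\<forall>x. (M *v x) \<bullet> x = 0) \<and> (\<forall>x. Upsilon0 (M *v x) x x = 0)" by blast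
next
  assume M: "(\<forall>x. (M *v x) \<bullet> x = 0) \<and> (\<forall>x. Upsilon0 (M *v x) x x = 0)"
  have "\<exists>a k. \<forall>X. \<sigma> (M *v \<tau> X) = hat a ** X + X ** hat k"
  proof (rule det_stabilizer)
    show "linear (\<lambda>X. \<sigma> (M *v \<tau> X))"
      by (auto intro!: linearI simp: sigma_tau_linear matrix_vector_right_distrib matrix_vector_mult_scaleR)
    show "\<sigma> (M *v \<tau> X) \<bullet> X = 0" for X
      using M inner_sigma[of _ "\<tau> X"] by simp
    show "\<sigma> (M *v \<tau> X) \<bullet> cof X = 0" for X
      using M Upsilon0_cof[of "M *v \<tau> X" "\<tau> X"] by simp
  qed
  then show "M \<in> so3_LR" unfolding so3_LR_sigma by (metis tau_sigma)
qed

text \<open>A tensor \<open>K\<^sup>i\<^sub>j\<^sub>k\<close> is stored as \<open>K $ k $ i $ j\<close>, with the form index \<open>k\<close> outermost, so that \<open>K $ k\<close> is the matrix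
  of a connection form on the \<open>k\<close>-th frame vector and \<open>contract K x\<close> is its value on \<open>x\<close>.\<close>
definition contract :: "real ^ 9 ^ 9 ^ 9 \<Rightarrow> real ^ 9 \<Rightarrow> real ^ 9 ^ 9" where
  "contract K x = (\<Sum>k\<in>UNIV. x $ k *\<^sub>R K $ k)"

lemma contract_linear_left: "contract (K + K') x = contract K x + contract K' x"
   "contract (s *\<^sub>R K) x = s *\<^sub>R contract K x" "contract (K - K') x = contract K x - contract K' x"
  by (simp_all add: contract_def algebra_simps sum.distrib scaleR_sum_right sum_subtractf)

lemma linear_contract: "linear (contract K)"
  by (rule linearI) (simp_all add: contract_def algebra_simps sum.distrib scaleR_sum_right)

lemmas contract_linear_right = linear_add[OF linear_contract] linear_scale[OF linear_contract]
  and matrix_vector_bilinear = matrix_vector_mult_add_rdistrib matrix_vector_right_distrib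
    matrix_vector_mult_scaleR scaleR_matrix_vector_assoc[symmetric]

lemma contract_vector: "contract K x *v y = (\<Sum>k\<in>UNIV. x $ k *\<^sub>R (K $ k *v y))"
proof -
  have "linear (\<lambda>M :: real ^ 9 ^ 9. M *v y)"
    by (rule linearI) (simp_all add: matrix_vector_mult_add_rdistrib scaleR_matrix_vector_assoc[symmetric])
  then show ?thesis
    unfolding contract_def scaleR_matrix_vector_assoc by (rule linear_sum)
qed

lemma contract_axis [simp]: "contract K (axis k 1) = K $ k"
  by (simp add: contract_def axis_def if_distrib[of "\<lambda>x. x *\<^sub>R _"] cong: if_cong)

lemma contract_of_linear: "linear G \<Longrightarrow> contract (\<chi> k. G (axis k 1)) x = G x"
  unfolding contract_def
  by (subst (2) basis_expansion[of x, symmetric])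
    (simp add: linear_sum linear_scale scalar_mult_eq_scaleR)

lemma so3_LR_contract: "(\<And>k. K $ k \<in> so3_LR) \<Longrightarrow> contract K x \<in> so3_LR"
  unfolding contract_def by (intro subspace_sum[OF subspace_so3_LR] subspace_scale[OF subspace_so3_LR]) simp

theorem quadratic_tangent_so3_LR:
  fixes \<Gamma> :: "real ^ 9 \<Rightarrow> real ^ 9 \<Rightarrow> real ^ 9"
  assumes \<Gamma>: "bilinear \<Gamma>" and "\<And>x. \<Gamma> x x \<bullet> x = 0" and "\<And>x. Upsilon0 (\<Gamma> x x) x x = 0"
  shows "\<exists>G. (\<forall>k. G $ k \<in> so3_LR) \<and> (\<forall>x. \<Gamma> x x = contract G x *v x)"
proof -
  define B where "B X Y = \<sigma> (\<Gamma> (\<tau> X) (\<tau> Y))" for X Y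
  have B: "bilinear B"
    unfolding B_def bilinear_def by (auto intro!: linearI simp: sigma_tau_linear bilinear_rules[OF \<Gamma>])
  have "B X X \<bullet> X = 0" "B X X \<bullet> cof X = 0" for X
    using assms(2)[of "\<tau> X"] assms(3)[of "\<tau> X"] inner_sigma[of "\<Gamma> (\<tau> X) (\<tau> X)" "\<tau> X"]
    by (simp_all add: B_def Upsilon0_cof)
  then obtain b c where bc: "linear b" "linear c" "\<And>X. B X X = hat (b X) ** X + X ** hat (c X)"
    using quadratic_tangent_to_orbits[OF B] by blast
  define F where "F x y = \<tau> (hat (b (\<sigma> x)) ** \<sigma> y + \<sigma> y ** hat (c (\<sigma> x)))" for x y
  have F: "bilinear F"
    unfolding F_def bilinear_def by (auto intro!: linearI simp: sigma_tau_linear linear_add[OF bc(1)] linear_scale[OF bc(1)]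
        linear_add[OF bc(2)] linear_scale[OF bc(2)] linear_add[OF linear_hat] linear_scale[OF linear_hat]
        matrix_mult_rules algebra_simps)
  have M: "matrix (F x) *v y = F x y" for x y
    using F by (simp add: matrix_works bilinear_def)
  have "linear (\<lambda>x. matrix (F x))"
    by (rule linearI) (simp_all add: matrix_def vec_eq_iff bilinear_rules[OF F])
  note contr = contract_of_linear[OF this]
  have "matrix (F x) \<in> so3_LR" for x
    unfolding so3_LR_sigma M F_def by auto
  moreover have "\<Gamma> x x = F x x" for x
    using bc(3)[of "\<sigma> x"] by (simp add: B_def F_def) (metis tau_sigma)
  ultimately show ?thesis
    by (intro exI[of _ "\<chi> k. matrix (F (axis k 1))"]) (simp add: contr M)
qed

lemma so3_LR_antisymmetric_zero:
  assumes h: "\<And>k. K $ k \<in> so3_LR" and skew: "\<And>x y. contract K x *v y = - (contract K y *v x)"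
  shows "K = 0"
proof -
  define B where "B X Y = \<sigma> (contract K (\<tau> X) *v \<tau> Y)" for X Y
  have "B X Y = 0" for X Y
  proof (rule skew_torsion_part_unique[where B = B])
    show "bilinear B"
      unfolding B_def bilinear_def by (auto intro!: linearI simp: sigma_tau_linear contract_linear_right
        matrix_vector_bilinear)
    show "\<exists>a k. \<forall>Y. B X Y = hat a ** Y + Y ** hat k" for X
      using so3_LR_contract[OF h, of "\<tau> X"] unfolding so3_LR_sigma B_def by (metis sigma_tau)
    show "B X Y = - B Y X" for X Y
      unfolding B_def using skew[of "\<tau> X" "\<tau> Y"] by (simp add: linear_neg[OF linear_sigma])
  qed
  then have "\<sigma> (K $ k *v x) = 0" for k x
    unfolding B_def by (metis contract_axis tau_sigma)
  then have "K $ k *v x = 0" for k x by (metis linear_0[OF linear_sigma] tau_sigma)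
  then have "K $ k = 0" for k by (simp add: matrix_eq)
  then show ?thesis by (simp add: vec_eq_iff)
qed


lemma totally_antisymmetric_iff:
  "totally_antisymmetric (\<lambda>i j k. K $ k $ i $ j) \<longleftrightarrow>
    (\<forall>x y. (contract K x *v y) \<bullet> y = 0) \<and> (\<forall>x y. contract K x *v y = - (contract K y *v x))"
  (is "?L \<longleftrightarrow> ?R1 \<and> ?R2")
proof -
  have entry: "(contract K (axis k 1) *v axis j 1) $ i = K $ k $ i $ j" for i j k
    by (simp add: matrix_vector_mult_basis column_def)
  note lin = contract_linear_right
    matrix_vector_bilinear
  have expand: "(contract K x *v y) $ i = (\<Sum>k\<in>UNIV. \<Sum>j\<in>UNIV. x $ k * y $ j * K $ k $ i $ j)" for x y i
    by (simp add: contract_def matrix_vector_mult_def sum_distrib_right sum_distrib_left algebra_simps)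
      (rule sum.swap)
  show ?thesis
  proof
    assume L: ?L
    then have s1: "K $ k $ j $ i = - K $ k $ i $ j" and s2: "K $ j $ i $ k = - K $ k $ i $ j" for i j k
      unfolding totally_antisymmetric_def by blast+
    have "(contract K x *v y) \<bullet> y = 0" for x y
    proof -
      have t1: "(K $ k *v y) \<bullet> y = (transpose (K $ k) *v y) \<bullet> y" for k
        using dot_lmul_matrix[of y "K $ k" y] by (simp add: inner_commute)
      have t2: "transpose (K $ k) = - K $ k" for k
        by (simp only: vec_eq_iff transpose_nth vector_uminus_component) (use s1 in blast)
      have t3: "(- M) *v y = - (M *v y)" for M :: "real ^ 9 ^ 9"
        by (simp add: matrix_vector_mult_def vec_eq_iff sum_negf)
      have "(K $ k *v y) \<bullet> y = - ((K $ k *v y) \<bullet> y)" for k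
        using t1[of k] unfolding t2 t3 inner_minus_left .
      then have "(K $ k *v y) \<bullet> y = 0" for k by (simp add: equal_neg_zero)
      moreover have "(contract K x *v y) \<bullet> y = (\<Sum>k\<in>UNIV. x $ k * ((K $ k *v y) \<bullet> y))"
        by (simp add: contract_vector inner_sum_left)
      ultimately show ?thesis by simp
    qed
    moreover have "contract K x *v y = - (contract K y *v x)" for x y
    proof -
      have "(contract K x *v y) $ i = - (contract K y *v x) $ i" for i
        unfolding expand by (subst sum.swap, subst s2) (simp add: sum_negf mult.commute)
      then show ?thesis by (simp add: vec_eq_iff)
    qed
    ultimately show "?R1 \<and> ?R2" by blast
  next
    assume R: "?R1 \<and> ?R2"
    have s1: "K $ k $ j $ i = - K $ k $ i $ j" for i j k
    proof -
      have "(contract K (axis k 1) *v (axis i 1 + axis j 1)) \<bullet> (axis i 1 + axis j 1) = 0"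
        "(contract K (axis k 1) *v axis i 1) \<bullet> axis i 1 = 0" "(contract K (axis k 1) *v axis j 1) \<bullet> axis j 1 = 0"
        using R by blast+
      then show ?thesis
        by (simp add: matrix_vector_right_distrib inner_add_left inner_add_right inner_axis matrix_vector_mult_basis column_def)
    qed
    have s2: "K $ j $ i $ k = - K $ k $ i $ j" for i j k
    proof -
      have "contract K (axis j 1) *v axis k 1 = - (contract K (axis k 1) *v axis j 1)" using R by blast
      then show ?thesis by (simp only: vector_uminus_component flip: entry)
    qed
    show ?L unfolding totally_antisymmetric_def using s1 s2 by blast
  qed
qed

lemma subspace_totally_antisymmetric:
  "subspace {A :: real ^ 9 ^ 9 ^ 9. totally_antisymmetric (\<lambda>i j k. A $ k $ i $ j)}"
proof -
  have add: "(A + B) $ k $ j $ i = - (A + B) $ k' $ i' $ j'"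
    if "A $ k $ j $ i = - A $ k' $ i' $ j'" "B $ k $ j $ i = - B $ k' $ i' $ j'"
    for A B :: "real ^ 9 ^ 9 ^ 9" and i j k i' j' k'
    using that by simp
  have scale: "(s *\<^sub>R A) $ k $ j $ i = - (s *\<^sub>R A) $ k' $ i' $ j'"
    if "A $ k $ j $ i = - A $ k' $ i' $ j'" for A :: "real ^ 9 ^ 9 ^ 9" and s i j k i' j' k'
    using that by simp
  have zero: "totally_antisymmetric (\<lambda>i j k. (0 :: real ^ 9 ^ 9 ^ 9) $ k $ i $ j)"
    by (simp add: totally_antisymmetric_def)
  have sum: "totally_antisymmetric (\<lambda>i j k. (A + B) $ k $ i $ j)"
    if "totally_antisymmetric (\<lambda>i j k. A $ k $ i $ j)" "totally_antisymmetric (\<lambda>i j k. B $ k $ i $ j)"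
    for A B :: "real ^ 9 ^ 9 ^ 9"
    using that unfolding totally_antisymmetric_def by (blast intro: add)
  have multiple: "totally_antisymmetric (\<lambda>i j k. (s *\<^sub>R A) $ k $ i $ j)"
    if "totally_antisymmetric (\<lambda>i j k. A $ k $ i $ j)" for A :: "real ^ 9 ^ 9 ^ 9" and s
    using that unfolding totally_antisymmetric_def by (blast intro: scale)
  show ?thesis
    by (rule subspaceI; unfold mem_Collect_eq) (rule zero, rule sum, assumption+, rule multiple, assumption)
qed

text \<open>The tensors satisfying the two conditions form the direct sum of the \<open>so3_LR\<close>-valued ones and the
  totally antisymmetric ones: every such tensor splits because its quadratic part comes from an
  \<open>so3_LR\<close>-valued one and a form skew in the first two indices with vanishing quadratic part is totally
  antisymmetric, and the intersection is trivial. The projection to the second summand is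
  extended linearly to all tensors, so that it preserves smoothness.\<close>
theorem skew_torsion_projection:
  "\<exists>P :: real ^ 9 ^ 9 ^ 9 \<Rightarrow> real ^ 9 ^ 9 ^ 9. linear P \<and>
    (\<forall>K. (\<forall>x y. (contract K x *v y) \<bullet> y = 0) \<and> (\<forall>x. Upsilon0 (contract K x *v x) x x = 0) \<longrightarrow>
      totally_antisymmetric (\<lambda>i j k. P K $ k $ i $ j) \<and> (\<forall>k. (K - P K) $ k \<in> so3_LR))"
proof -
  define V :: "((real ^ 9 ^ 9 ^ 9) \<times> (real ^ 9 ^ 9 ^ 9)) set"
    where "V = {(H, A). (\<forall>k. H $ k \<in> so3_LR) \<and> totally_antisymmetric (\<lambda>i j k. A $ k $ i $ j)}"
  define f :: "(real ^ 9 ^ 9 ^ 9) \<times> (real ^ 9 ^ 9 ^ 9) \<Rightarrow> real ^ 9 ^ 9 ^ 9" where "f z = fst z + snd z" for z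
  have f: "linear f" by (auto intro!: linearI simp: f_def algebra_simps)
  have V: "subspace V"
    using subspace_so3_LR subspace_totally_antisymmetric unfolding V_def subspace_def
    by (auto simp: zero_prod_def)
  have inj: "inj_on f V"
  proof (rule linear_inj_on_iff_eq_0[OF f V, THEN iffD2], intro ballI impI)
    fix z assume z: "z \<in> V" "f z = 0"
    obtain H A where HA: "z = (H, A)" by force
    have A: "A = - H" using z(2) by (simp add: HA f_def eq_neg_iff_add_eq_0 add.commute)
    have h: "H $ k \<in> so3_LR" for k using z(1) by (simp add: HA V_def)
    have "totally_antisymmetric (\<lambda>i j k. A $ k $ i $ j)" using z(1) by (simp add: HA V_def)
    then have "totally_antisymmetric (\<lambda>i j k. H $ k $ i $ j)"
      using subspace_neg[OF subspace_totally_antisymmetric, of A] by (simp only: A mem_Collect_eq minus_minus)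
    then have "H = 0" using h unfolding totally_antisymmetric_iff by (intro so3_LR_antisymmetric_zero) blast+
    then show "z = 0" by (simp add: HA A zero_prod_def)
  qed
  obtain g where g: "linear g" "\<And>z. z \<in> V \<Longrightarrow> g (f z) = z"
    using linear_exists_left_inverse_on[OF f V inj] by blast
  have "linear (\<lambda>K. snd (g K))"
    by (rule linearI) (simp_all add: linear_add[OF g(1)] linear_scale[OF g(1)])
  moreover have "totally_antisymmetric (\<lambda>i j k. snd (g K) $ k $ i $ j) \<and> (\<forall>k. (K - snd (g K)) $ k \<in> so3_LR)"
    if K: "\<And>x y. (contract K x *v y) \<bullet> y = 0" "\<And>x. Upsilon0 (contract K x *v x) x x = 0" for K
  proof -
    have "bilinear (\<lambda>x y. contract K x *v y)"
      unfolding bilinear_def by (auto intro!: linearI simp: contract_linear_right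
        matrix_vector_bilinear)
    then obtain G where G: "\<And>k. G $ k \<in> so3_LR" "\<And>x. contract K x *v x = contract G x *v x"
      using quadratic_tangent_so3_LR[of "\<lambda>x y. contract K x *v y"] K by blast
    define A where "A = K - G"
    have "(contract A x *v y) \<bullet> y = 0" for x y
      using K(1)[of x y] so3_LR_contract[OF G(1)] so3_LR_iff
      by (simp add: A_def contract_linear_left matrix_vector_mult_diff_rdistrib inner_diff_left)
    moreover have "contract A x *v y = - (contract A y *v x)" for x y
    proof -
      have A0: "contract A z *v z = 0" for z
        by (simp add: A_def contract_linear_left matrix_vector_mult_diff_rdistrib G(2))
      show ?thesis
        using A0[of "x + y"] A0[of x] A0[of y]
        by (simp add: linear_add[OF linear_contract] matrix_vector_mult_add_rdistrib matrix_vector_right_distrib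
          eq_neg_iff_add_eq_0 add.commute)
    qed
    ultimately have anti: "totally_antisymmetric (\<lambda>i j k. A $ k $ i $ j)"
      unfolding totally_antisymmetric_iff by blast
    then have "(G, A) \<in> V" using G(1) by (simp add: V_def)
    then have "g K = (G, A)" using g(2)[of "(G, A)"] by (simp add: f_def A_def)
    moreover have "K - A = G" by (simp add: A_def)
    ultimately show ?thesis using G(1) anti by simp
  qed
  ultimately show ?thesis by blast
qed

section \<open>Calculus of smooth functions\<close>

lemma frechet_derivative_cong_open:
  assumes "open S" "x \<in> S" "\<And>y. y \<in> S \<Longrightarrow> f y = g y"
  shows "frechet_derivative f (at x) = frechet_derivative g (at x)"
proof -
  have "(f has_derivative D) (at x) \<longleftrightarrow> (g has_derivative D) (at x)" for D
    using has_derivative_transform_within_open[OF _ assms(1,2), of f D UNIV g]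
      has_derivative_transform_within_open[OF _ assms(1,2), of g D UNIV f] assms(3) by auto
  then show ?thesis by (simp add: frechet_derivative_def)
qed

lemma frechet_derivative_eqI: "(f has_derivative D) (at x) \<Longrightarrow> frechet_derivative f (at x) v = D v"
  using frechet_derivative_at by metis

lemma Ck_on_cong:
  assumes "open S" "\<And>x. x \<in> S \<Longrightarrow> f x = g x" "Ck_on k S f"
  shows "Ck_on k S g"
  using assms(2,3)
proof (induction k arbitrary: f g)
  case 0
  then show ?case by (auto cong: continuous_on_cong)
next
  case (Suc k)
  have "g differentiable_on S"
    unfolding differentiable_on_eq_differentiable_at[OF assms(1)] differentiable_def
  proof
    fix x assume x: "x \<in> S"
    obtain D where "(f has_derivative D) (at x)"
      using Suc.prems(2) x by (auto simp: differentiable_on_eq_differentiable_at[OF assms(1)] differentiable_def)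
    then show "\<exists>D. (g has_derivative D) (at x)"
      using has_derivative_transform_within_open[OF _ assms(1) x] Suc.prems(1) by blast
  qed
  moreover have "Ck_on k S (\<lambda>x. frechet_derivative g (at x) v)" for v
  proof (rule Suc.IH)
    show "Ck_on k S (\<lambda>x. frechet_derivative f (at x) v)" using Suc.prems by simp
    show "frechet_derivative f (at x) v = frechet_derivative g (at x) v" if "x \<in> S" for x
      using frechet_derivative_cong_open[OF assms(1) that, of f g] Suc.prems by simp
  qed
  ultimately show ?case by simp
qed

lemma Ck_on_subset: "Ck_on k S f \<Longrightarrow> T \<subseteq> S \<Longrightarrow> Ck_on k T f"
  by (induction k arbitrary: f) (auto intro: continuous_on_subset differentiable_on_subset)

lemma Ck_on_local:
  assumes "open S" "\<And>x. x \<in> S \<Longrightarrow> \<exists>T. open T \<and> x \<in> T \<and> Ck_on k T f"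
  shows "Ck_on k S f"
  using assms(2)
proof (induction k arbitrary: f)
  case 0
  have "isCont f x" if "x \<in> S" for x
    using 0[OF that] continuous_on_eq_continuous_at by fastforce
  then show ?case using continuous_at_imp_continuous_on by auto
next
  case (Suc k)
  have "f differentiable at x" if x: "x \<in> S" for x
  proof -
    obtain T where "open T" "x \<in> T" "f differentiable_on T" using Suc.prems[OF x] by auto
    then show ?thesis by (simp add: differentiable_on_eq_differentiable_at)
  qed
  moreover have "Ck_on k S (\<lambda>x. frechet_derivative f (at x) v)" for v
    by (rule Suc.IH) (use Suc.prems in \<open>fastforce\<close>)
  ultimately show ?case by (simp add: differentiable_on_eq_differentiable_at[OF assms(1)])
qed

lemma smooth_on_cong: "open S \<Longrightarrow> (\<And>x. x \<in> S \<Longrightarrow> f x = g x) \<Longrightarrow> smooth_on S f \<Longrightarrow> smooth_on S g"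
  using Ck_on_cong unfolding smooth_on_def by blast

lemma smooth_on_subset: "smooth_on S f \<Longrightarrow> T \<subseteq> S \<Longrightarrow> smooth_on T f"
  using Ck_on_subset unfolding smooth_on_def by blast

lemma smooth_on_local:
  assumes "open S" "\<And>x. x \<in> S \<Longrightarrow> \<exists>T. open T \<and> x \<in> T \<and> smooth_on T f"
  shows "smooth_on S f"
  unfolding smooth_on_def
proof
  fix k
  show "Ck_on k S f"
  proof (rule Ck_on_local[OF assms(1)])
    fix x assume "x \<in> S"
    then obtain T where "open T" "x \<in> T" "smooth_on T f" using assms(2) by blast
    then show "\<exists>T. open T \<and> x \<in> T \<and> Ck_on k T f" unfolding smooth_on_def by blast
  qed
qed

lemma smooth_on_derivative: "smooth_on S f \<Longrightarrow> smooth_on S (\<lambda>x. frechet_derivative f (at x) v)"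
  unfolding smooth_on_def by (metis Ck_on.simps(2))

lemma smooth_on_has_derivative:
  assumes "smooth_on S f" "open S" "x \<in> S"
  shows "(f has_derivative frechet_derivative f (at x)) (at x)"
proof -
  have "Ck_on (Suc 0) S f" using assms(1) unfolding smooth_on_def by blast
  then have "f differentiable_on S" by simp
  then show ?thesis
    using assms(2,3) by (simp add: differentiable_on_eq_differentiable_at frechet_derivative_works)
qed

lemma smooth_on_continuous: "smooth_on S f \<Longrightarrow> continuous_on S f"
  unfolding smooth_on_def by (metis Ck_on.simps(1))

lemma Ck_on_bounded_linear:
  assumes L: "bounded_linear L" and S: "open S" and "Ck_on k S f"
  shows "Ck_on k S (\<lambda>x. L (f x))"
  using assms(3)
proof (induction k arbitrary: f)
  case 0
  then show ?case using bounded_linear.continuous_on[OF L] by auto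
next
  case (Suc k)
  have f: "(f has_derivative frechet_derivative f (at x)) (at x)" if "x \<in> S" for x
    using Suc.prems that S by (simp add: differentiable_on_eq_differentiable_at frechet_derivative_works)
  have d: "((\<lambda>x. L (f x)) has_derivative (\<lambda>v. L (frechet_derivative f (at x) v))) (at x)" if "x \<in> S" for x
    by (rule bounded_linear.has_derivative[OF L f[OF that]])
  have "Ck_on k S (\<lambda>x. frechet_derivative (\<lambda>x. L (f x)) (at x) v)" for v
    by (rule Ck_on_cong[OF S _ Suc.IH[of "\<lambda>x. frechet_derivative f (at x) v"]])
      (use Suc.prems frechet_derivative_eqI[OF d] in auto)
  then show ?case using d S by (auto simp: differentiable_on_eq_differentiable_at differentiable_def)
qed

lemma Ck_on_add:
  assumes S: "open S" and "Ck_on k S f" "Ck_on k S g"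
  shows "Ck_on k S (\<lambda>x. f x + g x)"
  using assms(2,3)
proof (induction k arbitrary: f g)
  case 0
  then show ?case by (auto intro: continuous_on_add)
next
  case (Suc k)
  have "(f has_derivative frechet_derivative f (at x)) (at x)" "(g has_derivative frechet_derivative g (at x)) (at x)" if "x \<in> S" for x
    using Suc.prems that S by (simp_all add: differentiable_on_eq_differentiable_at frechet_derivative_works)
  then have d: "((\<lambda>x. f x + g x) has_derivative (\<lambda>v. frechet_derivative f (at x) v + frechet_derivative g (at x) v)) (at x)" if "x \<in> S" for x
    using that by (intro has_derivative_add)
  have "Ck_on k S (\<lambda>x. frechet_derivative (\<lambda>x. f x + g x) (at x) v)" for v
    by (rule Ck_on_cong[OF S _ Suc.IH[of "\<lambda>x. frechet_derivative f (at x) v" "\<lambda>x. frechet_derivative g (at x) v"]])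
      (use Suc.prems frechet_derivative_eqI[OF d] in auto)
  then show ?case using d S by (auto simp: differentiable_on_eq_differentiable_at differentiable_def)
qed

lemma smooth_on_add: "open S \<Longrightarrow> smooth_on S f \<Longrightarrow> smooth_on S g \<Longrightarrow> smooth_on S (\<lambda>x. f x + g x)"
  unfolding smooth_on_def by (blast intro: Ck_on_add)

lemma smooth_on_bounded_linear:
  "bounded_linear L \<Longrightarrow> open S \<Longrightarrow> smooth_on S f \<Longrightarrow> smooth_on S (\<lambda>x. L (f x))"
  unfolding smooth_on_def by (blast intro: Ck_on_bounded_linear)

lemma smooth_on_const:
  fixes a :: "'b::real_normed_vector"
  assumes "open S" shows "smooth_on S (\<lambda>x. a)"
proof -
  have "Ck_on k S (\<lambda>x. a)" for k and a :: 'b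
    by (induction k arbitrary: a) (auto simp: frechet_derivative_const)
  then show ?thesis by (simp add: smooth_on_def)
qed

lemma smooth_on_bounded_bilinear:
  assumes B: "bounded_bilinear B" and S: "open S" and "smooth_on S f" "smooth_on S g"
  shows "smooth_on S (\<lambda>x. B (f x) (g x))"
proof -
  have "Ck_on k S (\<lambda>x. B (f x) (g x))" for k
    using assms(3,4)
  proof (induction k arbitrary: f g)
    case 0
    then show ?case by (simp add: bounded_bilinear.continuous_on[OF B] smooth_on_continuous)
  next
    case (Suc k)
    have d: "((\<lambda>x. B (f x) (g x)) has_derivative
        (\<lambda>v. B (f x) (frechet_derivative g (at x) v) + B (frechet_derivative f (at x) v) (g x))) (at x)" if "x \<in> S" for x
      by (rule bounded_bilinear.FDERIV[OF B smooth_on_has_derivative[OF Suc.prems(1) S that]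
          smooth_on_has_derivative[OF Suc.prems(2) S that]])
    have "Ck_on k S (\<lambda>x. frechet_derivative (\<lambda>x. B (f x) (g x)) (at x) v)" for v
      by (rule Ck_on_cong[OF S _ Ck_on_add[OF S Suc.IH[OF Suc.prems(1) smooth_on_derivative[OF Suc.prems(2), of v]]
          Suc.IH[OF smooth_on_derivative[OF Suc.prems(1), of v] Suc.prems(2)]]])
        (simp add: frechet_derivative_eqI[OF d])
    then show ?case using d S by (auto simp: differentiable_on_eq_differentiable_at differentiable_def)
  qed
  then show ?thesis by (simp add: smooth_on_def)
qed

lemmas smooth_on_mult = smooth_on_bounded_bilinear[OF bounded_bilinear_mult]

lemma smooth_on_sum:
  assumes "open S" "finite I" "\<And>i. i \<in> I \<Longrightarrow> smooth_on S (f i)"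
  shows "smooth_on S (\<lambda>x. \<Sum>i\<in>I. f i x)"
  using assms(2,3) by (induction I rule: finite_induct) (auto intro: smooth_on_const smooth_on_add assms(1))

lemma smooth_on_prod:
  fixes f :: "'i \<Rightarrow> 'a::real_normed_vector \<Rightarrow> real"
  assumes "open S" "finite I" "\<And>i. i \<in> I \<Longrightarrow> smooth_on S (f i)"
  shows "smooth_on S (\<lambda>x. \<Prod>i\<in>I. f i x)"
  using assms(2,3) by (induction I rule: finite_induct) (auto intro: smooth_on_const smooth_on_mult assms(1))

text \<open>The derivative of \<open>h / f\<^sup>n\<close> is a sum of two functions of the same form, which makes the induction on the
  order of differentiability work.\<close>
lemma smooth_on_inverse:
  fixes f :: "'a::real_normed_vector \<Rightarrow> real"
  assumes S: "open S" and f: "smooth_on S f" and nz: "\<And>x. x \<in> S \<Longrightarrow> f x \<noteq> 0"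
  shows "smooth_on S (\<lambda>x. inverse (f x))"
proof -
  have d: "((\<lambda>x. inverse (f x)) has_derivative
      (\<lambda>v. - (inverse (f x) * frechet_derivative f (at x) v * inverse (f x)))) (at x)" if "x \<in> S" for x
    by (rule Deriv.has_derivative_inverse[OF nz[OF that] smooth_on_has_derivative[OF f S that]])
  have "\<forall>h n. smooth_on S h \<longrightarrow> Ck_on k S (\<lambda>x. h x * inverse (f x) ^ n)" for k
  proof (induction k)
    case 0
    show ?case using smooth_on_continuous[OF f] smooth_on_continuous nz by (auto intro!: continuous_intros)
  next
    case (Suc k)
    show ?case
    proof (intro allI impI)
      fix h :: "'a \<Rightarrow> real" and n assume h: "smooth_on S h"
      have dh: "((\<lambda>x. h x * inverse (f x) ^ n) has_derivative
          (\<lambda>v. frechet_derivative h (at x) v * inverse (f x) ^ n +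
             (- of_nat n * h x * frechet_derivative f (at x) v) * inverse (f x) ^ Suc n)) (at x)" if "x \<in> S" for x
      proof -
        have "h x * (of_nat n * - (inverse (f x) * frechet_derivative f (at x) v * inverse (f x)) * inverse (f x) ^ (n - 1)) +
              frechet_derivative h (at x) v * inverse (f x) ^ n =
            frechet_derivative h (at x) v * inverse (f x) ^ n +
             (- of_nat n * h x * frechet_derivative f (at x) v) * inverse (f x) ^ Suc n" for v
          by (cases n) (simp_all add: algebra_simps)
        then show ?thesis
          by (intro has_derivative_eq_rhs[OF has_derivative_mult[OF smooth_on_has_derivative[OF h S that]
                has_derivative_power[OF d[OF that], of n]]] ext)
      qed
      have "Ck_on k S (\<lambda>x. frechet_derivative (\<lambda>x. h x * inverse (f x) ^ n) (at x) v)" for v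
      proof (rule Ck_on_cong[OF S _ Ck_on_add[OF S Suc.IH[rule_format, of "\<lambda>x. frechet_derivative h (at x) v" n]
            Suc.IH[rule_format, of "\<lambda>x. - of_nat n * h x * frechet_derivative f (at x) v" "Suc n"]]])
        show "smooth_on S (\<lambda>x. frechet_derivative h (at x) v)" by (rule smooth_on_derivative[OF h])
        show "smooth_on S (\<lambda>x. - of_nat n * h x * frechet_derivative f (at x) v)"
          by (intro smooth_on_mult smooth_on_const S h smooth_on_derivative[OF f])
      qed (simp only: frechet_derivative_eqI[OF dh])
      then show "Ck_on (Suc k) S (\<lambda>x. h x * inverse (f x) ^ n)"
        using dh S by (auto simp: differentiable_on_eq_differentiable_at differentiable_def)
    qed
  qed
  then have "Ck_on k S (\<lambda>x. 1 * inverse (f x) ^ 1)" for k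
    using smooth_on_const[OF S] by blast
  then show ?thesis by (simp add: smooth_on_def)
qed

text \<open>Two applications of the mean value theorem express the second difference over a square of side \<open>s\<close>
  by the mixed derivative at some point of the square.\<close>
lemma second_derivative_box:
  fixes f :: "'a::real_normed_vector \<Rightarrow> real"
  assumes S: "open S" and f: "smooth_on S f" and s: "0 < s"
    and box: "\<And>a b. 0 \<le> a \<Longrightarrow> a \<le> s \<Longrightarrow> 0 \<le> b \<Longrightarrow> b \<le> s \<Longrightarrow> x + a *\<^sub>R u + b *\<^sub>R v \<in> S"
  shows "\<exists>a b. 0 \<le> a \<and> a \<le> s \<and> 0 \<le> b \<and> b \<le> s \<and>
    f (x + s *\<^sub>R u + s *\<^sub>R v) - f (x + s *\<^sub>R u) - f (x + s *\<^sub>R v) + f x =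
    s * s * frechet_derivative (\<lambda>y. frechet_derivative f (at y) u) (at (x + a *\<^sub>R u + b *\<^sub>R v)) v"
proof -
  have line: "((\<lambda>t. F (y + t *\<^sub>R w)) has_real_derivative frechet_derivative F (at (y + t *\<^sub>R w)) w) (at t)"
    if "smooth_on S F" "y + t *\<^sub>R w \<in> S" for F :: "'a \<Rightarrow> real" and y t w
  proof -
    have "((\<lambda>t. y + t *\<^sub>R w) has_derivative (\<lambda>h. h *\<^sub>R w)) (at t)"
      by (auto intro!: derivative_eq_intros)
    from has_derivative_compose[OF this smooth_on_has_derivative[OF that(1) S that(2)]]
    show ?thesis
      using linear_scale[OF has_derivative_linear[OF smooth_on_has_derivative[OF that(1) S that(2)]]]
      by (simp add: has_field_derivative_def mult.commute[of _ "frechet_derivative F (at (y + t *\<^sub>R w)) w"])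
  qed
  define h where "h t = f (x + s *\<^sub>R v + t *\<^sub>R u) - f (x + t *\<^sub>R u)" for t
  define G where "G y = frechet_derivative f (at y) u" for y
  have G: "smooth_on S G" unfolding G_def by (rule smooth_on_derivative[OF f])
  have inS: "x + s *\<^sub>R v + t *\<^sub>R u \<in> S" "x + t *\<^sub>R u \<in> S" if "0 \<le> t" "t \<le> s" for t
    using box[of t s] box[of t 0] that s by (simp_all add: algebra_simps)
  have "(h has_real_derivative (G (x + s *\<^sub>R v + t *\<^sub>R u) - G (x + t *\<^sub>R u))) (at t)" if "0 \<le> t" "t \<le> s" for t
    unfolding h_def G_def using line[OF f inS(1)[OF that]] line[OF f inS(2)[OF that]] by (rule DERIV_diff)
  from MVT2[OF s, of h, OF this] obtain a where a: "0 < a" "a < s"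
    "h s - h 0 = (s - 0) * (G (x + s *\<^sub>R v + a *\<^sub>R u) - G (x + a *\<^sub>R u))" by blast
  have "((\<lambda>t. G (x + a *\<^sub>R u + t *\<^sub>R v)) has_real_derivative frechet_derivative G (at (x + a *\<^sub>R u + t *\<^sub>R v)) v) (at t)"
    if "0 \<le> t" "t \<le> s" for t
    using line[OF G, of "x + a *\<^sub>R u" t v] box[of a t] a that by simp
  from MVT2[OF s, of "\<lambda>t. G (x + a *\<^sub>R u + t *\<^sub>R v)", OF this] obtain b where b: "0 < b" "b < s"
    "G (x + a *\<^sub>R u + s *\<^sub>R v) - G (x + a *\<^sub>R u + 0 *\<^sub>R v) =
      (s - 0) * frechet_derivative G (at (x + a *\<^sub>R u + b *\<^sub>R v)) v" by blast
  have "f (x + s *\<^sub>R u + s *\<^sub>R v) - f (x + s *\<^sub>R u) - f (x + s *\<^sub>R v) + f x = h s - h 0"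
    by (simp add: h_def algebra_simps)
  also have "\<dots> = s * s * frechet_derivative G (at (x + a *\<^sub>R u + b *\<^sub>R v)) v"
    using a(3) b(3) by (simp add: algebra_simps)
  finally show ?thesis using a b unfolding G_def by (intro exI[of _ a] exI[of _ b]) auto
qed

text \<open>The second difference is symmetric in the two directions, so the two mixed derivatives take the
  same value at two points arbitrarily close to \<open>x\<close>; continuity does the rest.\<close>
lemma second_derivative_symmetric_real:
  fixes f :: "'a::real_normed_vector \<Rightarrow> real"
  assumes S: "open S" and f: "smooth_on S f" and x: "x \<in> S"
  shows "frechet_derivative (\<lambda>y. frechet_derivative f (at y) u) (at x) v =
    frechet_derivative (\<lambda>y. frechet_derivative f (at y) v) (at x) u"
proof -
  define F G where "F y = frechet_derivative (\<lambda>y. frechet_derivative f (at y) u) (at y) v"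
    and "G y = frechet_derivative (\<lambda>y. frechet_derivative f (at y) v) (at y) u" for y
  have "isCont F x" "isCont G x"
    using smooth_on_continuous[OF smooth_on_derivative[OF smooth_on_derivative[OF f]]] S x
    unfolding F_def G_def by (simp_all add: continuous_on_eq_continuous_at)
  have "dist (F x) (G x) \<le> \<epsilon>" if eps: "\<epsilon> > 0" for \<epsilon>
  proof -
    obtain r1 where r1: "r1 > 0" "\<And>y. dist y x < r1 \<Longrightarrow> dist (F y) (F x) < \<epsilon> / 2"
      using \<open>isCont F x\<close> half_gt_zero[OF eps] unfolding continuous_at_eps_delta by meson
    obtain r2 where r2: "r2 > 0" "\<And>y. dist y x < r2 \<Longrightarrow> dist (G y) (G x) < \<epsilon> / 2"
      using \<open>isCont G x\<close> half_gt_zero[OF eps] unfolding continuous_at_eps_delta by meson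
    obtain r3 where r3: "r3 > 0" "\<And>y. dist y x < r3 \<Longrightarrow> y \<in> S"
      using S x unfolding open_dist by blast
    define r where "r = Min {r1, r2, r3}"
    have r: "r > 0" "r \<le> r1" "r \<le> r2" "r \<le> r3" using r1 r2 r3 by (auto simp: r_def)
    define s where "s = r / (2 * (norm u + norm v + 1))"
    have n: "0 < norm u + norm v + 1" by (simp add: add_nonneg_pos)
    then have s: "s > 0" using r by (simp add: s_def)
    have near: "dist (x + a *\<^sub>R u + b *\<^sub>R v) x < r" if "0 \<le> a" "a \<le> s" "0 \<le> b" "b \<le> s" for a b
    proof -
      have "dist (x + a *\<^sub>R u + b *\<^sub>R v) x = norm (a *\<^sub>R u + b *\<^sub>R v)" by (simp add: dist_norm)
      also have "\<dots> \<le> a * norm u + b * norm v" using norm_triangle_ineq[of "a *\<^sub>R u" "b *\<^sub>R v"] that by simp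
      also have "\<dots> \<le> s * norm u + s * norm v" using that by (intro add_mono mult_right_mono) auto
      also have "\<dots> \<le> s * (norm u + norm v + 1)" using s by (simp add: algebra_simps)
      also have "\<dots> = r / 2"
      proof -
        have "r / (2 * m) * m = r / 2" if "m > 0" for m using that by simp
        from this[OF n] show ?thesis by (simp only: s_def)
      qed
      finally show ?thesis using r by simp
    qed
    obtain a b where ab: "0 \<le> a" "a \<le> s" "0 \<le> b" "b \<le> s"
      "f (x + s *\<^sub>R u + s *\<^sub>R v) - f (x + s *\<^sub>R u) - f (x + s *\<^sub>R v) + f x = s * s * F (x + a *\<^sub>R u + b *\<^sub>R v)"
      using second_derivative_box[OF S f s, of x u v] near r r3(2) unfolding F_def by (meson less_le_trans)
    have box': "x + a *\<^sub>R v + b *\<^sub>R u \<in> S" if "0 \<le> a" "a \<le> s" "0 \<le> b" "b \<le> s" for a b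
      using near[of b a] that r r3(2)[of "x + b *\<^sub>R u + a *\<^sub>R v"] by (simp add: algebra_simps)
    obtain c d where cd: "0 \<le> c" "c \<le> s" "0 \<le> d" "d \<le> s"
      "f (x + s *\<^sub>R v + s *\<^sub>R u) - f (x + s *\<^sub>R v) - f (x + s *\<^sub>R u) + f x = s * s * G (x + c *\<^sub>R v + d *\<^sub>R u)"
      using second_derivative_box[OF S f s, of x v u] box' unfolding G_def by blast
    have "s * s * F (x + a *\<^sub>R u + b *\<^sub>R v) = s * s * G (x + c *\<^sub>R v + d *\<^sub>R u)"
      using ab(5) cd(5) by (simp add: algebra_simps)
    then have "F (x + a *\<^sub>R u + b *\<^sub>R v) = G (x + d *\<^sub>R u + c *\<^sub>R v)"
      using s by (simp add: algebra_simps)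
    moreover have "dist (F (x + a *\<^sub>R u + b *\<^sub>R v)) (F x) < \<epsilon> / 2"
      using near[OF ab(1-4)] r by (intro r1) simp
    moreover have "dist (G (x + d *\<^sub>R u + c *\<^sub>R v)) (G x) < \<epsilon> / 2"
      using near[OF cd(3,4,1,2)] r by (intro r2) simp
    ultimately show ?thesis unfolding dist_real_def by linarith
  qed
  then have "dist (F x) (G x) \<le> 0 + \<epsilon>" if "\<epsilon> > 0" for \<epsilon> using that by simp
  then have "dist (F x) (G x) \<le> 0" by (rule field_le_epsilon)
  then show ?thesis by (simp add: F_def G_def)
qed

lemma second_derivative_symmetric:
  fixes f :: "'a::real_normed_vector \<Rightarrow> 'b::euclidean_space"
  assumes S: "open S" and f: "smooth_on S f" and x: "x \<in> S"
  shows "frechet_derivative (\<lambda>y. frechet_derivative f (at y) u) (at x) v =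
    frechet_derivative (\<lambda>y. frechet_derivative f (at y) v) (at x) u"
proof (rule euclidean_eqI)
  fix b :: 'b
  have L: "bounded_linear (\<lambda>z. z \<bullet> b)" by (rule bounded_linear_inner_left)
  have d: "frechet_derivative (\<lambda>y. h y \<bullet> b) (at y) w = frechet_derivative h (at y) w \<bullet> b"
    if "smooth_on S h" "y \<in> S" for h :: "'a \<Rightarrow> 'b" and y w
    by (rule frechet_derivative_eqI[OF bounded_linear.has_derivative[OF L smooth_on_has_derivative[OF that(1) S that(2)]]])
  have dd: "frechet_derivative (\<lambda>y. frechet_derivative (\<lambda>y. f y \<bullet> b) (at y) w) (at x) w' =
    frechet_derivative (\<lambda>y. frechet_derivative f (at y) w) (at x) w' \<bullet> b" for w w'
    using frechet_derivative_cong_open[OF S x, of "\<lambda>y. frechet_derivative (\<lambda>y. f y \<bullet> b) (at y) w" "\<lambda>y. frechet_derivative f (at y) w \<bullet> b"]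
      d[OF f] d[OF smooth_on_derivative[OF f] x] by simp
  show "frechet_derivative (\<lambda>y. frechet_derivative f (at y) u) (at x) v \<bullet> b =
    frechet_derivative (\<lambda>y. frechet_derivative f (at y) v) (at x) u \<bullet> b"
    using second_derivative_symmetric_real[OF S smooth_on_bounded_linear[OF L S f] x, of u v] by (simp only: dd)
qed

section \<open>Functions on a manifold read in charts\<close>

definition chart_smooth ::
    "('a, 'n::finite) chart \<Rightarrow> 'a set \<Rightarrow> ('a \<Rightarrow> 'b::real_normed_vector) \<Rightarrow> bool" where
  "chart_smooth c W F \<longleftrightarrow> smooth_on (snd c ` (W \<inter> fst c)) (F \<circ> chart_inv c)"

definition chart_differentiable ::
    "('a, 'n::finite) chart \<Rightarrow> ('a \<Rightarrow> 'b::real_normed_vector) \<Rightarrow> 'a \<Rightarrow> bool" where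
  "chart_differentiable c F p \<longleftrightarrow> (F \<circ> chart_inv c) differentiable at (snd c p)"

lemma chart_deriv_eqI:
  "(F \<circ> chart_inv c has_derivative D) (at (snd c p)) \<Longrightarrow> chart_deriv c F p u = D u"
  unfolding chart_deriv_def by (rule frechet_derivative_eqI)

lemma chart_has_derivative:
  "chart_differentiable c F p \<Longrightarrow> (F \<circ> chart_inv c has_derivative chart_deriv c F p) (at (snd c p))"
  unfolding chart_differentiable_def chart_deriv_def[abs_def] by (simp add: frechet_derivative_works)

lemma chart_differentiableI:
  "(F \<circ> chart_inv c has_derivative D) (at (snd c p)) \<Longrightarrow> chart_differentiable c F p"
  unfolding chart_differentiable_def differentiable_def by blast

lemma linear_chart_deriv: "chart_differentiable c F p \<Longrightarrow> linear (chart_deriv c F p)"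
  by (rule has_derivative_linear[OF chart_has_derivative])

lemma chart_deriv_const [simp]: "chart_deriv c (\<lambda>q. a) p u = 0"
  by (rule chart_deriv_eqI[where D = "\<lambda>_. 0"]) (simp add: comp_def)

lemma chart_deriv_bilinear:
  assumes "bounded_bilinear B" "chart_differentiable c F p" "chart_differentiable c G p" "chart_inv c (snd c p) = p"
  shows "chart_deriv c (\<lambda>q. B (F q) (G q)) p u = B (F p) (chart_deriv c G p u) + B (chart_deriv c F p u) (G p)"
    "chart_differentiable c (\<lambda>q. B (F q) (G q)) p"
proof -
  have "((\<lambda>q. B (F q) (G q)) \<circ> chart_inv c has_derivative
      (\<lambda>u. B (F p) (chart_deriv c G p u) + B (chart_deriv c F p u) (G p))) (at (snd c p))"
    using bounded_bilinear.FDERIV[OF assms(1) chart_has_derivative[OF assms(2)] chart_has_derivative[OF assms(3)]]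
      assms(4) by (simp add: comp_def)
  from chart_deriv_eqI[OF this] chart_differentiableI[OF this]
  show "chart_deriv c (\<lambda>q. B (F q) (G q)) p u = B (F p) (chart_deriv c G p u) + B (chart_deriv c F p u) (G p)"
    "chart_differentiable c (\<lambda>q. B (F q) (G q)) p" by auto
qed

lemma chart_deriv_sum:
  assumes "\<And>i. i \<in> I \<Longrightarrow> chart_differentiable c (F i) p"
  shows "chart_deriv c (\<lambda>q. \<Sum>i\<in>I. F i q) p u = (\<Sum>i\<in>I. chart_deriv c (F i) p u)"
    "chart_differentiable c (\<lambda>q. \<Sum>i\<in>I. F i q) p"
proof -
  have "((\<lambda>q. \<Sum>i\<in>I. F i q) \<circ> chart_inv c has_derivative (\<lambda>u. \<Sum>i\<in>I. chart_deriv c (F i) p u)) (at (snd c p))"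
    using has_derivative_sum[of I "\<lambda>i. F i \<circ> chart_inv c", OF chart_has_derivative[OF assms]] by (simp add: comp_def)
  from chart_deriv_eqI[OF this] chart_differentiableI[OF this]
  show "chart_deriv c (\<lambda>q. \<Sum>i\<in>I. F i q) p u = (\<Sum>i\<in>I. chart_deriv c (F i) p u)"
    "chart_differentiable c (\<lambda>q. \<Sum>i\<in>I. F i q) p" by auto
qed

lemma chart_deriv_linear:
  assumes "bounded_linear L" "chart_differentiable c F p"
  shows "chart_deriv c (\<lambda>q. L (F q)) p u = L (chart_deriv c F p u)"
    "chart_differentiable c (\<lambda>q. L (F q)) p"
proof -
  have "((\<lambda>q. L (F q)) \<circ> chart_inv c has_derivative (\<lambda>u. L (chart_deriv c F p u))) (at (snd c p))"
    using bounded_linear.has_derivative[OF assms(1) chart_has_derivative[OF assms(2)]] by (simp add: comp_def)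
  from chart_deriv_eqI[OF this] chart_differentiableI[OF this]
  show "chart_deriv c (\<lambda>q. L (F q)) p u = L (chart_deriv c F p u)"
    "chart_differentiable c (\<lambda>q. L (F q)) p" by auto
qed

lemma chart_smooth_subset: "chart_smooth c W F \<Longrightarrow> W' \<subseteq> W \<Longrightarrow> chart_smooth c W' F"
  unfolding chart_smooth_def by (rule smooth_on_subset) auto

locale smooth_manifold =
  fixes A :: "('a::topological_space, 'n::finite) chart set"
  assumes atlas: "smooth_atlas A"
begin

lemma chart_inv_chart: "c \<in> A \<Longrightarrow> p \<in> fst c \<Longrightarrow> chart_inv c (snd c p) = p"
  using atlas unfolding smooth_atlas_def by (meson homeomorphism_apply1)

lemma open_chart: "c \<in> A \<Longrightarrow> open (fst c)"
  using atlas unfolding smooth_atlas_def by blast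

lemma open_chart_image:
  assumes "c \<in> A" "open W" shows "open (snd c ` (W \<inter> fst c))"
proof -
  have h: "homeomorphism (fst c) (snd c ` fst c) (snd c) (chart_inv c)" and o: "open (snd c ` fst c)"
    using atlas assms(1) unfolding smooth_atlas_def by blast+
  have "openin (top_of_set (fst c)) (W \<inter> fst c)" using assms(2) unfolding openin_open by blast
  then have "openin (top_of_set (snd c ` fst c)) (snd c ` (W \<inter> fst c))"
    by (rule homeomorphism_imp_open_map[OF h])
  then show ?thesis using o openin_open_eq by blast
qed

context
  fixes c and W :: "'a set" assumes c: "c \<in> A" and W: "open W"
begin

lemma chart_smooth_cong:
  assumes "\<And>q. q \<in> W \<inter> fst c \<Longrightarrow> F q = G q" "chart_smooth c W F" shows "chart_smooth c W G"
  using assms(2) unfolding chart_smooth_def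
  by (rule smooth_on_cong[OF open_chart_image[OF c W], rotated]) (use assms(1) chart_inv_chart[OF c] in auto)

lemma chart_smooth_differentiable:
  "chart_smooth c W F \<Longrightarrow> p \<in> W \<inter> fst c \<Longrightarrow> chart_differentiable c F p"
  unfolding chart_smooth_def chart_differentiable_def differentiable_def
  using smooth_on_has_derivative[OF _ open_chart_image[OF c W]] by blast

lemma chart_deriv_cong:
  assumes "p \<in> W \<inter> fst c" "\<And>q. q \<in> W \<inter> fst c \<Longrightarrow> F q = G q"
  shows "chart_deriv c F p u = chart_deriv c G p u"
proof -
  have "frechet_derivative (F \<circ> chart_inv c) (at (snd c p)) = frechet_derivative (G \<circ> chart_inv c) (at (snd c p))"
    by (rule frechet_derivative_cong_open[OF open_chart_image[OF c W]]) (use assms chart_inv_chart[OF c] in auto)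
  then show ?thesis by (simp add: chart_deriv_def)
qed

lemma chart_smooth_const: "chart_smooth c W (\<lambda>q. a)"
  unfolding chart_smooth_def comp_def by (rule smooth_on_const[OF open_chart_image[OF c W]])

lemma chart_smooth_add: "chart_smooth c W F \<Longrightarrow> chart_smooth c W G \<Longrightarrow> chart_smooth c W (\<lambda>q. F q + G q)"
  unfolding chart_smooth_def comp_def by (rule smooth_on_add[OF open_chart_image[OF c W]])

lemma chart_smooth_bilinear:
  "bounded_bilinear B \<Longrightarrow> chart_smooth c W F \<Longrightarrow> chart_smooth c W G \<Longrightarrow> chart_smooth c W (\<lambda>q. B (F q) (G q))"
  unfolding chart_smooth_def comp_def by (rule smooth_on_bounded_bilinear[OF _ open_chart_image[OF c W]])

lemmas chart_smooth_mult = chart_smooth_bilinear[OF bounded_bilinear_mult]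
  and chart_smooth_scaleR = chart_smooth_bilinear[OF bounded_bilinear_scaleR]
  and chart_smooth_inner = chart_smooth_bilinear[OF bounded_bilinear_inner]

lemma chart_smooth_linear: "bounded_linear L \<Longrightarrow> chart_smooth c W F \<Longrightarrow> chart_smooth c W (\<lambda>q. L (F q))"
  unfolding chart_smooth_def comp_def by (rule smooth_on_bounded_linear[OF _ open_chart_image[OF c W]])

lemma chart_smooth_nth: "chart_smooth c W F \<Longrightarrow> chart_smooth c W (\<lambda>q. F q $ i)"
  by (rule chart_smooth_linear[OF bounded_linear_vec_nth])

lemma chart_smooth_diff: "chart_smooth c W F \<Longrightarrow> chart_smooth c W G \<Longrightarrow> chart_smooth c W (\<lambda>q. F q - G q)"
  using chart_smooth_add[of F "\<lambda>q. - G q"] chart_smooth_linear[OF bounded_linear_minus[OF bounded_linear_ident], of G]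
  by simp

lemma chart_smooth_sum:
  "finite I \<Longrightarrow> (\<And>i. i \<in> I \<Longrightarrow> chart_smooth c W (F i)) \<Longrightarrow> chart_smooth c W (\<lambda>q. \<Sum>i\<in>I. F i q)"
  unfolding chart_smooth_def comp_def by (rule smooth_on_sum[OF open_chart_image[OF c W]])

lemma chart_smooth_prod:
  fixes F :: "'i \<Rightarrow> 'a \<Rightarrow> real"
  shows "finite I \<Longrightarrow> (\<And>i. i \<in> I \<Longrightarrow> chart_smooth c W (F i)) \<Longrightarrow> chart_smooth c W (\<lambda>q. \<Prod>i\<in>I. F i q)"
  unfolding chart_smooth_def comp_def by (rule smooth_on_prod[OF open_chart_image[OF c W]])

lemma chart_smooth_divide:
  fixes F G :: "'a \<Rightarrow> real"
  assumes "chart_smooth c W F" "chart_smooth c W G" "\<And>q. q \<in> W \<inter> fst c \<Longrightarrow> G q \<noteq> 0"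
  shows "chart_smooth c W (\<lambda>q. F q / G q)"
proof -
  have "chart_smooth c W (\<lambda>q. inverse (G q))"
    using assms(2) unfolding chart_smooth_def comp_def
    by (rule smooth_on_inverse[OF open_chart_image[OF c W]]) (use assms(3) chart_inv_chart[OF c] in auto)
  then show ?thesis using chart_smooth_mult[OF assms(1)] by (simp add: divide_inverse)
qed

lemma chart_smooth_vec:
  fixes F :: "'a \<Rightarrow> 'b::euclidean_space ^ 'm"
  assumes "\<And>i. chart_smooth c W (\<lambda>q. F q $ i)"
  shows "chart_smooth c W F"
proof -
  have lin: "bounded_linear (\<lambda>x :: 'b. axis i x :: 'b ^ 'm)" for i
    by (rule linear_conv_bounded_linear[THEN iffD1], rule linearI) (simp_all add: axis_def vec_eq_iff)
  have "chart_smooth c W (\<lambda>q. \<Sum>i\<in>UNIV. axis i (F q $ i))"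
    by (intro chart_smooth_sum chart_smooth_linear[OF lin] assms) simp
  moreover have "(\<Sum>i\<in>UNIV. axis i (F q $ i)) = F q" for q
    by (simp add: vec_eq_iff axis_def)
  ultimately show ?thesis by simp
qed

lemma chart_smooth_det:
  fixes F :: "'a \<Rightarrow> real ^ 'm ^ 'm"
  assumes "\<And>i j. chart_smooth c W (\<lambda>q. F q $ i $ j)"
  shows "chart_smooth c W (\<lambda>q. det (F q))"
  unfolding det_def by (intro chart_smooth_sum chart_smooth_mult chart_smooth_prod chart_smooth_const assms) auto

lemma chart_smooth_deriv:
  assumes "chart_smooth c W F" shows "chart_smooth c W (\<lambda>q. chart_deriv c F q u)"
  unfolding chart_smooth_def
  by (rule smooth_on_cong[OF open_chart_image[OF c W] _ smooth_on_derivative[OF assms[unfolded chart_smooth_def], of u]])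
    (use chart_inv_chart[OF c] in \<open>auto simp: chart_deriv_def\<close>)

end

lemma chart_smooth_local:
  assumes c: "c \<in> A" and W: "open W" and "\<And>p. p \<in> W \<inter> fst c \<Longrightarrow> \<exists>V. open V \<and> p \<in> V \<and> chart_smooth c V F"
  shows "chart_smooth c W F"
  unfolding chart_smooth_def
proof (rule smooth_on_local[OF open_chart_image[OF c W]])
  fix x assume "x \<in> snd c ` (W \<inter> fst c)"
  then obtain p where p: "p \<in> W \<inter> fst c" "x = snd c p" by blast
  then obtain V where V: "open V" "p \<in> V" "chart_smooth c V F" using assms(3) by blast
  then show "\<exists>T. open T \<and> x \<in> T \<and> smooth_on T (F \<circ> chart_inv c)"
    using p open_chart_image[OF c V(1)] unfolding chart_smooth_def by blast
qed

lemma transition_smooth: "c \<in> A \<Longrightarrow> c' \<in> A \<Longrightarrow> chart_smooth c (fst c') (snd c')"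
  using atlas unfolding smooth_atlas_def chart_smooth_def by (simp add: Int_commute)

lemma chart_deriv_change:
  assumes c: "c \<in> A" "c' \<in> A" "p \<in> fst c" "p \<in> fst c'" and F: "chart_differentiable c' F p"
  shows "chart_deriv c F p u = chart_deriv c' F p (chart_deriv c (snd c') p u)"
    "chart_differentiable c F p"
proof -
  have t: "(snd c' \<circ> chart_inv c has_derivative chart_deriv c (snd c') p) (at (snd c p))"
    using chart_smooth_differentiable[OF c(1) open_chart[OF c(2)] transition_smooth[OF c(1,2)]] c(3,4)
    by (intro chart_has_derivative) blast
  have "(F \<circ> chart_inv c' has_derivative chart_deriv c' F p) (at ((snd c' \<circ> chart_inv c) (snd c p)))"
    using chart_has_derivative[OF F] chart_inv_chart[OF c(1,3)] by simp
  from has_derivative_compose[OF t this]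
  have d: "((\<lambda>x. (F \<circ> chart_inv c') ((snd c' \<circ> chart_inv c) x)) has_derivative
      (\<lambda>u. chart_deriv c' F p (chart_deriv c (snd c') p u))) (at (snd c p))" .
  have "(F \<circ> chart_inv c has_derivative (\<lambda>u. chart_deriv c' F p (chart_deriv c (snd c') p u))) (at (snd c p))"
    by (rule has_derivative_transform_within_open[OF d open_chart_image[OF c(1) open_chart[OF c(2)]]])
      (use c chart_inv_chart[OF c(1)] chart_inv_chart[OF c(2)] in auto)
  from chart_deriv_eqI[OF this] chart_differentiableI[OF this]
  show "chart_deriv c F p u = chart_deriv c' F p (chart_deriv c (snd c') p u)" "chart_differentiable c F p" by auto
qed

lemma transition_differentiable:
  "c \<in> A \<Longrightarrow> c' \<in> A \<Longrightarrow> p \<in> fst c \<Longrightarrow> p \<in> fst c' \<Longrightarrow> chart_differentiable c (snd c') p"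
  by (rule chart_smooth_differentiable[OF _ open_chart transition_smooth]) auto

lemma chart_deriv_self: assumes "c \<in> A" "p \<in> fst c" shows "chart_deriv c (snd c) p u = u"
proof (rule chart_deriv_eqI)
  have "open (snd c ` fst c)" using open_chart_image[OF assms(1) open_UNIV] by simp
  then show "(snd c \<circ> chart_inv c has_derivative (\<lambda>u. u)) (at (snd c p))"
    by (rule has_derivative_transform_within_open[OF has_derivative_ident])
      (use assms chart_inv_chart[OF assms(1)] in auto)
qed

lemma transition_inverse:
  assumes c: "c \<in> A" "c' \<in> A" "p \<in> fst c" "p \<in> fst c'"
  shows "chart_deriv c' (snd c) p (chart_deriv c (snd c') p u) = u"
  using chart_deriv_change(1)[OF c transition_differentiable[OF c(2,1,4,3)], of u] chart_deriv_self[OF c(1,3)] by simp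

text \<open>This symmetry is the reason why the torsion of a connection is a tensor.\<close>
lemma transition_second_derivative_symmetric:
  assumes c: "c \<in> A" "c' \<in> A" "p \<in> fst c" "p \<in> fst c'"
  shows "chart_deriv c (\<lambda>q. chart_deriv c (snd c') q v) p u = chart_deriv c (\<lambda>q. chart_deriv c (snd c') q u) p v"
proof -
  let ?S = "snd c ` (fst c' \<inter> fst c)" and ?f = "snd c' \<circ> chart_inv c"
  have S: "open ?S" by (rule open_chart_image[OF c(1) open_chart[OF c(2)]])
  have x: "snd c p \<in> ?S" using c by blast
  have "chart_deriv c (\<lambda>q. chart_deriv c (snd c') q v) p u = frechet_derivative (\<lambda>y. frechet_derivative ?f (at y) v) (at (snd c p)) u" for u v
  proof -
    have "frechet_derivative ((\<lambda>q. chart_deriv c (snd c') q v) \<circ> chart_inv c) (at (snd c p)) =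
       frechet_derivative (\<lambda>y. frechet_derivative ?f (at y) v) (at (snd c p))"
      by (rule frechet_derivative_cong_open[OF S x]) (use chart_inv_chart[OF c(1)] in \<open>auto simp: chart_deriv_def\<close>)
    then show ?thesis by (simp add: chart_deriv_def)
  qed
  then show ?thesis
    using second_derivative_symmetric[OF S _ x] transition_smooth[OF c(1,2)] unfolding chart_smooth_def by simp
qed

end

section \<open>Coframes and connection forms\<close>

lemma linear_expand_axis:
  fixes f :: "real ^ 'n \<Rightarrow> 'b::real_vector"
  assumes "linear f" shows "f v = (\<Sum>k\<in>UNIV. v $ k *\<^sub>R f (axis k 1))"
  by (subst basis_expansion[of v, symmetric])
    (simp add: linear_sum[OF assms] linear_scale[OF assms] scalar_mult_eq_scaleR)

context smooth_manifold
begin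

context
  fixes c W p and \<Theta> :: "'a \<Rightarrow> real ^ 'm \<Rightarrow> 'b::real_normed_vector"
  assumes c: "c \<in> A" and W: "open W" and p: "p \<in> W \<inter> fst c"
    and lin: "\<And>q. q \<in> W \<inter> fst c \<Longrightarrow> linear (\<Theta> q)"
    and diff: "\<And>v. chart_differentiable c (\<lambda>q. \<Theta> q v) p"
begin

text \<open>The Leibniz rule for a field of linear maps of which only the smoothness of each value is known; the
  expansion in the standard basis reduces it to products.\<close>
lemma chart_deriv_apply:
  assumes Y: "chart_differentiable c Y p"
  shows "chart_deriv c (\<lambda>q. \<Theta> q (Y q)) p u = (\<Sum>k\<in>UNIV. Y p $ k *\<^sub>R chart_deriv c (\<lambda>q. \<Theta> q (axis k 1)) p u) + \<Theta> p (chart_deriv c Y p u)"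
proof -
  note Yk = chart_deriv_linear[OF bounded_linear_vec_nth Y]
  have inv: "chart_inv c (snd c p) = p" using chart_inv_chart[OF c] p by blast
  have "chart_deriv c (\<lambda>q. \<Theta> q (Y q)) p u = chart_deriv c (\<lambda>q. \<Sum>k\<in>UNIV. Y q $ k *\<^sub>R \<Theta> q (axis k 1)) p u"
    by (rule chart_deriv_cong[OF c W p linear_expand_axis[OF lin]])
  also have "\<dots> = (\<Sum>k\<in>UNIV. chart_deriv c (\<lambda>q. Y q $ k *\<^sub>R \<Theta> q (axis k 1)) p u)"
    by (rule chart_deriv_sum(1)[OF chart_deriv_bilinear(2)[OF bounded_bilinear_scaleR Yk(2) diff inv]])
  also have "\<dots> = (\<Sum>k\<in>UNIV. Y p $ k *\<^sub>R chart_deriv c (\<lambda>q. \<Theta> q (axis k 1)) p u + chart_deriv c Y p u $ k *\<^sub>R \<Theta> p (axis k 1))"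
    by (simp only: chart_deriv_bilinear(1)[OF bounded_bilinear_scaleR Yk(2) diff inv] Yk(1))
  also have "\<dots> = (\<Sum>k\<in>UNIV. Y p $ k *\<^sub>R chart_deriv c (\<lambda>q. \<Theta> q (axis k 1)) p u) + \<Theta> p (chart_deriv c Y p u)"
    by (simp add: sum.distrib flip: linear_expand_axis[OF lin[OF p]])
  finally show ?thesis .
qed

lemma chart_differentiable_const: "chart_differentiable c (\<lambda>q. y) p"
  by (rule chart_differentiableI[where D = "\<lambda>_. 0"]) (simp add: comp_def)

lemma chart_deriv_apply_const:
  "chart_deriv c (\<lambda>q. \<Theta> q y) p u = (\<Sum>k\<in>UNIV. y $ k *\<^sub>R chart_deriv c (\<lambda>q. \<Theta> q (axis k 1)) p u)"
  using chart_deriv_apply[OF chart_differentiable_const, of y u] linear_0[OF lin[OF p]] by simp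

lemma linear_chart_deriv_apply: "linear (\<lambda>y. chart_deriv c (\<lambda>q. \<Theta> q y) p u)"
proof -
  have eq: "(\<lambda>y. chart_deriv c (\<lambda>q. \<Theta> q y) p u) =
      (\<lambda>y. \<Sum>k\<in>UNIV. y $ k *\<^sub>R chart_deriv c (\<lambda>q. \<Theta> q (axis k 1)) p u)"
    by (rule ext, rule chart_deriv_apply_const)
  show ?thesis
    by (subst eq, rule linearI) (simp_all add: algebra_simps sum.distrib scaleR_sum_right)
qed

lemma chart_deriv_leibniz:
  "chart_differentiable c Y p \<Longrightarrow>
   chart_deriv c (\<lambda>q. \<Theta> q (Y q)) p u = chart_deriv c (\<lambda>q. \<Theta> q (Y p)) p u + \<Theta> p (chart_deriv c Y p u)"
  by (simp only: chart_deriv_apply chart_deriv_apply_const[of "Y p"])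

end

context
  fixes U \<theta> c assumes \<theta>: "coframe_on A U \<theta>" and c: "c \<in> A"
begin

lemma open_coframe: "open U"
  using \<theta> unfolding coframe_on_def by blast

lemma linear_coframe: "p \<in> U \<inter> fst c \<Longrightarrow> linear (\<theta> c p)" and bij_coframe: "p \<in> U \<inter> fst c \<Longrightarrow> bij (\<theta> c p)"
  using \<theta> c unfolding coframe_on_def by blast+

lemma coframe_smooth: "chart_smooth c U (\<lambda>q. \<theta> c q v)"
  using \<theta> c unfolding coframe_on_def chart_smooth_def by blast

lemma coframe_differentiable: "p \<in> U \<inter> fst c \<Longrightarrow> chart_differentiable c (\<lambda>q. \<theta> c q v) p"
  by (rule chart_smooth_differentiable[OF c open_coframe coframe_smooth])

lemma coframe_dual: "p \<in> U \<inter> fst c \<Longrightarrow> \<theta> c p (dual_frame \<theta> c p j) = axis j 1"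
  unfolding dual_frame_def using bij_coframe bij_is_surj surj_f_inv_f by metis

lemma coframe_inject: "p \<in> U \<inter> fst c \<Longrightarrow> \<theta> c p u = \<theta> c p v \<longleftrightarrow> u = v"
  using bij_coframe bij_is_inj inj_eq by metis

lemma coframe_surj: "p \<in> U \<inter> fst c \<Longrightarrow> \<exists>u. \<theta> c p u = x"
  using bij_coframe bij_is_surj by (metis surjE)

lemma dual_expand:
  assumes p: "p \<in> U \<inter> fst c"
  shows "v = (\<Sum>j\<in>UNIV. \<theta> c p v $ j *\<^sub>R dual_frame \<theta> c p j)"
proof -
  have "\<theta> c p (\<Sum>j\<in>UNIV. \<theta> c p v $ j *\<^sub>R dual_frame \<theta> c p j) = (\<Sum>j\<in>UNIV. \<theta> c p v $ j *\<^sub>R axis j 1)"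
    by (simp only: linear_sum[OF linear_coframe[OF p]] linear_scale[OF linear_coframe[OF p]] coframe_dual[OF p])
  also have "\<dots> = \<theta> c p v"
    using basis_expansion[of "\<theta> c p v"] by (simp add: scalar_mult_eq_scaleR)
  finally show ?thesis using coframe_inject[OF p] by metis
qed

text \<open>Cramer's rule writes the dual frame as a quotient of polynomials in the coframe.\<close>
lemma dual_frame_smooth: "chart_smooth c U (\<lambda>q. dual_frame \<theta> c q j)"
proof -
  define M where "M q = matrix (\<theta> c q)" for q
  have M: "chart_smooth c U (\<lambda>q. M q $ i $ l)" for i l
    unfolding M_def matrix_def by (simp add: chart_smooth_nth[OF c open_coframe coframe_smooth])
  have det: "det (M q) \<noteq> 0" if "q \<in> U \<inter> fst c" for q
    unfolding M_def using det_nz_iff_inj[OF linear_coframe[OF that]] bij_is_inj[OF bij_coframe[OF that]] by simp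
  have smooth: "chart_smooth c U (\<lambda>q. \<chi> k. det (\<chi> i l. if l = k then axis j 1 $ i else M q $ i $ l) / det (M q))"
  proof (rule chart_smooth_vec[OF c open_coframe], simp only: vec_lambda_beta)
    fix k
    show "chart_smooth c U (\<lambda>q. det (\<chi> i l. if l = k then axis j 1 $ i else M q $ i $ l) / det (M q))"
    proof (rule chart_smooth_divide[OF c open_coframe _ chart_smooth_det[OF c open_coframe M] det])
      show "chart_smooth c U (\<lambda>q. det (\<chi> i l. if l = k then axis j 1 $ i else M q $ i $ l))"
      proof (rule chart_smooth_det[OF c open_coframe], simp only: vec_lambda_beta)
        fix i l
        show "chart_smooth c U (\<lambda>q. if l = k then axis j 1 $ i else M q $ i $ l)"
          using M chart_smooth_const[OF c open_coframe] by (cases "l = k") simp_all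
      qed
    qed
  qed
  have solution: "(\<chi> k. det (\<chi> i l. if l = k then axis j 1 $ i else M q $ i $ l) / det (M q)) = dual_frame \<theta> c q j"
    if "q \<in> U \<inter> fst c" for q
  proof -
    have "M q *v dual_frame \<theta> c q j = axis j 1"
      unfolding M_def using linear_coframe[OF that] coframe_dual[OF that] by (simp add: matrix_works)
    then show ?thesis using cramer[OF det[OF that]] by simp
  qed
  show ?thesis by (rule chart_smooth_cong[OF c open_coframe solution smooth])
qed

lemma linear_coframe_deriv: "p \<in> U \<inter> fst c \<Longrightarrow> linear (\<lambda>v. chart_deriv c (\<lambda>q. \<theta> c q v) p u)"
  by (rule linear_chart_deriv_apply[OF c open_coframe _ linear_coframe coframe_differentiable])

context
  fixes p and N :: "('a, 'n) connection" assumes p: "p \<in> U \<inter> fst c" and N: "bilinear (N c p)"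
begin

text \<open>Differentiating \<open>\<theta>\<^sup>i(e\<^sub>j) = \<delta>\<^sup>i\<^sub>j\<close> trades the derivative of the dual frame for that of the
  coframe. All conditions on connections below are read through this formula.\<close>
lemma connection_form_coframe:
  "connection_form N \<theta> c p u *v \<theta> c p v = \<theta> c p (N c p u v) - chart_deriv c (\<lambda>q. \<theta> c q v) p u"
proof -
  let ?E = "\<lambda>q j. dual_frame \<theta> c q j"
  have E: "chart_differentiable c (\<lambda>q. ?E q j) p" for j
    by (rule chart_smooth_differentiable[OF c open_coframe dual_frame_smooth p])
  have "chart_deriv c (\<lambda>q. \<theta> c q (?E q j)) p u = chart_deriv c (\<lambda>q. axis j 1 :: real ^ 'n) p u" for j
    by (rule chart_deriv_cong[OF c open_coframe p coframe_dual])
  then have "chart_deriv c (\<lambda>q. \<theta> c q (?E p j)) p u + \<theta> c p (chart_deriv c (\<lambda>q. ?E q j) p u) = 0" for j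
    using chart_deriv_leibniz[OF c open_coframe p linear_coframe coframe_differentiable[OF p] E, of j u] by simp
  then have E': "\<theta> c p (chart_deriv c (\<lambda>q. ?E q j) p u) = - chart_deriv c (\<lambda>q. \<theta> c q (?E p j)) p u" for j
    by (simp add: eq_neg_iff_add_eq_0 add.commute)
  define F where "F v = \<theta> c p (N c p u v) - chart_deriv c (\<lambda>q. \<theta> c q v) p u" for v
  have "linear (N c p u)" using N unfolding bilinear_def by blast
  from linear_compose[OF this linear_coframe[OF p]] linear_coframe_deriv[OF p, of u]
  have F: "linear F" unfolding F_def by (simp add: linear_compose_sub comp_def)
  have "(\<chi> i j. \<theta> c p (cov_deriv_vector N c (\<lambda>q. ?E q j) p u) $ i) *v x = (\<Sum>j\<in>UNIV. x $ j *\<^sub>R F (?E p j))" for x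
    by (simp add: vec_eq_iff matrix_vector_mult_def cov_deriv_vector_def linear_add[OF linear_coframe[OF p]] E' F_def mult.commute)
  then have "connection_form N \<theta> c p u *v \<theta> c p v = (\<Sum>j\<in>UNIV. \<theta> c p v $ j *\<^sub>R F (?E p j))"
    unfolding connection_form_def by simp
  also have "\<dots> = F (\<Sum>j\<in>UNIV. \<theta> c p v $ j *\<^sub>R ?E p j)"
    by (simp add: linear_sum[OF F] linear_scale[OF F])
  also have "\<dots> = F v" using dual_expand[OF p, of v] by simp
  finally show ?thesis by (simp add: F_def)
qed

lemma torsion_form_coframe: "torsion_form N \<theta> c p u v = \<theta> c p (N c p u v - N c p v u)"
  unfolding torsion_form_def connection_form_coframe by (simp add: linear_diff[OF linear_coframe[OF p]])

lemma connection_form_eqI: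
  assumes "\<And>v. M *v \<theta> c p v = \<theta> c p (N c p u v) - chart_deriv c (\<lambda>q. \<theta> c q v) p u"
  shows "connection_form N \<theta> c p u = M"
  unfolding matrix_eq using coframe_surj[OF p] assms connection_form_coframe by metis

lemma linear_connection_form: "linear (connection_form N \<theta> c p)"
proof (rule linearI)
  note D = linear_chart_deriv[OF coframe_differentiable[OF p]]
  fix u u' s
  show "connection_form N \<theta> c p (u + u') = connection_form N \<theta> c p u + connection_form N \<theta> c p u'"
    by (rule connection_form_eqI) (simp add: matrix_vector_mult_add_rdistrib connection_form_coframe
      bilinear_rules[OF N] linear_add[OF linear_coframe[OF p]] linear_add[OF D])
  show "connection_form N \<theta> c p (s *\<^sub>R u) = s *\<^sub>R connection_form N \<theta> c p u"
    by (rule connection_form_eqI) (simp add: connection_form_coframe bilinear_rules[OF N]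
      linear_scale[OF linear_coframe[OF p]] linear_scale[OF D] scaleR_diff_right flip: scaleR_matrix_vector_assoc)
qed

end
end
end

section \<open>Connections from pointwise conditions\<close>

text \<open>The Christoffel symbols in the chart \<open>c\<close> which the transformation law assigns to the symbols \<open>n\<close> in the
  chart \<open>c'\<close>.\<close>
definition pullback ::
    "('a, 'n::finite) chart \<Rightarrow> ('a, 'n) chart \<Rightarrow> 'a \<Rightarrow> (real ^ 'n \<Rightarrow> real ^ 'n \<Rightarrow> real ^ 'n) \<Rightarrow>
      real ^ 'n \<Rightarrow> real ^ 'n \<Rightarrow> real ^ 'n" where
  "pullback c c' p n u v = chart_deriv c' (snd c) p
     (chart_deriv c (\<lambda>q. chart_deriv c (snd c') q v) p u +
      n (chart_deriv c (snd c') p u) (chart_deriv c (snd c') p v))"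

context smooth_manifold
begin

text \<open>A connection can be prescribed by a condition at every point that has a unique solution there.
  Uniqueness glues the local smooth solutions, and together with invariance under change of charts
  it yields the transformation law.\<close>
theorem affine_connection_of_pointwise:
  fixes R :: "('a, 'n) chart \<Rightarrow> 'a \<Rightarrow> (real ^ 'n \<Rightarrow> real ^ 'n \<Rightarrow> real ^ 'n) \<Rightarrow> bool"
  assumes bilinear: "\<And>c p n. c \<in> A \<Longrightarrow> p \<in> fst c \<Longrightarrow> R c p n \<Longrightarrow> bilinear n"
    and unique: "\<And>c p n n'. c \<in> A \<Longrightarrow> p \<in> fst c \<Longrightarrow> R c p n \<Longrightarrow> R c p n' \<Longrightarrow> n = n'"
    and local: "\<And>c p. c \<in> A \<Longrightarrow> p \<in> fst c \<Longrightarrow> \<exists>W m. open W \<and> p \<in> W \<and>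
        (\<forall>q\<in>W \<inter> fst c. R c q (m q)) \<and> (\<forall>u v. chart_smooth c W (\<lambda>q. m q u v))"
    and pullback: "\<And>c c' p n. c \<in> A \<Longrightarrow> c' \<in> A \<Longrightarrow> p \<in> fst c \<Longrightarrow> p \<in> fst c' \<Longrightarrow> R c' p n \<Longrightarrow>
        R c p (pullback c c' p n)"
  shows "\<exists>!N. affine_connection A N \<and> (\<forall>c\<in>A. \<forall>p\<in>fst c. R c p (N c p))"
proof (rule ex1I)
  define N where "N c p = (if c \<in> A \<and> p \<in> fst c then (THE n. R c p n) else (\<lambda>u v. 0))" for c p
  have N_eq: "N c p = n" if "c \<in> A" "p \<in> fst c" "R c p n" for c p n
  proof -
    have "(THE n. R c p n) = n"
      by (rule the_equality, rule that(3), rule unique[OF that(1,2) _ that(3)])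
    then show ?thesis using that by (simp add: N_def)
  qed
  have R_N: "R c p (N c p)" if cp: "c \<in> A" "p \<in> fst c" for c p
  proof -
    obtain n where "R c p n" using local[OF cp] cp(2) by blast
    then show ?thesis using N_eq[OF cp] by simp
  qed
  have smooth: "chart_smooth c UNIV (\<lambda>q. N c q u v)" if c: "c \<in> A" for c u v
  proof (rule chart_smooth_local[OF c open_UNIV])
    fix p assume "p \<in> UNIV \<inter> fst c"
    then have "p \<in> fst c" by simp
    from local[OF c this] obtain W m where W: "open W" "p \<in> W"
      and Rm: "\<forall>q\<in>W \<inter> fst c. R c q (m q)" and ms: "\<forall>u v. chart_smooth c W (\<lambda>q. m q u v)" by blast
    note R = Rm[rule_format] and m = ms[rule_format, of u v]
    have "m q u v = N c q u v" if "q \<in> W \<inter> fst c" for q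
      using N_eq[OF c _ R[OF that]] that by simp
    from chart_smooth_cong[OF c W(1) this m] show "\<exists>V. open V \<and> p \<in> V \<and> chart_smooth c V (\<lambda>q. N c q u v)"
      using W by blast
  qed
  have transformation: "chart_deriv c (snd c') p (N c p u v) =
      chart_deriv c (\<lambda>q. chart_deriv c (snd c') q v) p u +
      N c' p (chart_deriv c (snd c') p u) (chart_deriv c (snd c') p v)"
    if "c \<in> A" "c' \<in> A" "p \<in> fst c" "p \<in> fst c'" for c c' p u v
  proof -
    have "N c p = pullback c c' p (N c' p)"
      by (rule N_eq[OF that(1,3) pullback[OF that R_N[OF that(2,4)]]])
    then show ?thesis by (simp add: pullback_def transition_inverse[OF that(2,1,4,3)])
  qed
  show "affine_connection A N \<and> (\<forall>c\<in>A. \<forall>p\<in>fst c. R c p (N c p))"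
    unfolding affine_connection_def
    using R_N bilinear smooth[unfolded chart_smooth_def] transformation by (auto simp: N_def)
  fix N' assume N': "affine_connection A N' \<and> (\<forall>c\<in>A. \<forall>p\<in>fst c. R c p (N' c p))"
  show "N' = N"
  proof (intro ext)
    fix c p u v
    show "N' c p u v = N c p u v"
    proof (cases "c \<in> A \<and> p \<in> fst c")
      case True
      then show ?thesis using N' N_eq[of c p "N' c p"] by simp
    next
      case False
      then have "N' c p = (\<lambda>u v. 0)" using N' unfolding affine_connection_def by blast
      then show ?thesis using False by (auto simp: N_def)
    qed
  qed
qed

context
  fixes c c' p
  assumes c: "c \<in> A" "c' \<in> A" "p \<in> fst c" "p \<in> fst c'"
begin

lemma pullback_torsion:
  "pullback c c' p n u v - pullback c c' p n v u = chart_deriv c' (snd c) p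
     (n (chart_deriv c (snd c') p u) (chart_deriv c (snd c') p v) - n (chart_deriv c (snd c') p v) (chart_deriv c (snd c') p u))"
  unfolding pullback_def transition_second_derivative_symmetric[OF c, of u v]
  by (simp flip: linear_diff[OF linear_chart_deriv[OF transition_differentiable[OF c(2,1,4,3)]]])

lemma coframe_transition:
  assumes "coframe_on A U \<theta>" "p \<in> U"
  shows "\<theta> c p v = \<theta> c' p (chart_deriv c (snd c') p v)"
  using assms c unfolding coframe_on_def by blast

context
  fixes n :: "real ^ 'n \<Rightarrow> real ^ 'n \<Rightarrow> real ^ 'n" assumes n: "bilinear n"
begin

lemma bilinear_pullback: "bilinear (pullback c c' p n)"
proof -
  note J = linear_chart_deriv[OF transition_differentiable[OF c]]
  note J' = linear_chart_deriv[OF transition_differentiable[OF c(2,1,4,3)]]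
  have D: "chart_differentiable c (\<lambda>q. chart_deriv c (snd c') q v) p" for v
    using chart_smooth_differentiable[OF c(1) open_chart[OF c(2)]
        chart_smooth_deriv[OF c(1) open_chart[OF c(2)] transition_smooth[OF c(1,2)]]] c by blast
  have l1: "linear (\<lambda>v. chart_deriv c (\<lambda>q. chart_deriv c (snd c') q v) p u)" for u
    by (rule linear_chart_deriv_apply[OF c(1) open_chart[OF c(2)] _ linear_chart_deriv[OF transition_differentiable[OF c(1,2)]] D])
      (use c in auto)
  note l2 = linear_chart_deriv[OF D]
  show ?thesis
    unfolding pullback_def bilinear_def
    by (auto intro!: linearI simp: linear_add[OF J] linear_scale[OF J] linear_add[OF J'] linear_scale[OF J']
        linear_add[OF l1] linear_scale[OF l1] linear_add[OF l2] linear_scale[OF l2] bilinear_rules[OF n] algebra_simps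
        simp flip: scaleR_add_right)
qed

text \<open>The transformation law of Christoffel symbols expresses that the matrix of connection forms in a coframe
  does not depend on the chart. Conditions on this matrix are therefore invariant under \<open>pullback\<close>.\<close>
lemma connection_form_pullback:
  assumes \<theta>: "coframe_on A U \<theta>" and p: "p \<in> U"
  shows "connection_form (\<lambda>_ _. pullback c c' p n) \<theta> c p u =
    connection_form (\<lambda>_ _. n) \<theta> c' p (chart_deriv c (snd c') p u)"
proof (rule connection_form_eqI[OF \<theta> c(1)])
  show "p \<in> U \<inter> fst c" using p c by blast
  show "bilinear (pullback c c' p n)" by (rule bilinear_pullback)
  fix v
  let ?J = "chart_deriv c (snd c') p"
  define D where "D = chart_deriv c (\<lambda>q. chart_deriv c (snd c') q v) p u"
  have pU': "p \<in> U \<inter> fst c'" using p c by blast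
  note lin = linear_coframe[OF \<theta> c(2) pU']
  have open_W: "open (U \<inter> fst c')" using open_coframe[OF \<theta> c(1)] open_chart[OF c(2)] by blast
  have pW: "p \<in> (U \<inter> fst c') \<inter> fst c" using p c by blast
  have diff: "chart_differentiable c (\<lambda>q. \<theta> c' q y) p" for y
    by (rule chart_deriv_change(2)[OF c coframe_differentiable[OF \<theta> c(2) pU']])
  have J_diff: "chart_differentiable c (\<lambda>q. chart_deriv c (snd c') q v) p"
    using chart_smooth_differentiable[OF c(1) open_chart[OF c(2)]
        chart_smooth_deriv[OF c(1) open_chart[OF c(2)] transition_smooth[OF c(1,2)]]] c by blast
  have "chart_deriv c (\<lambda>q. \<theta> c q v) p u = chart_deriv c (\<lambda>q. \<theta> c' q (chart_deriv c (snd c') q v)) p u"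
  proof (rule chart_deriv_cong[OF c(1) open_W pW])
    show "\<theta> c q v = \<theta> c' q (chart_deriv c (snd c') q v)" if "q \<in> (U \<inter> fst c') \<inter> fst c" for q
      using \<theta> c(1,2) that unfolding coframe_on_def by blast
  qed
  also have "\<dots> = chart_deriv c (\<lambda>q. \<theta> c' q (?J v)) p u + \<theta> c' p D"
    unfolding D_def by (rule chart_deriv_leibniz[OF c(1) open_W pW _ diff J_diff])
      (use linear_coframe[OF \<theta> c(2)] in blast)
  also have "chart_deriv c (\<lambda>q. \<theta> c' q (?J v)) p u = chart_deriv c' (\<lambda>q. \<theta> c' q (?J v)) p (?J u)"
    by (rule chart_deriv_change(1)[OF c coframe_differentiable[OF \<theta> c(2) pU']])
  finally have deriv: "chart_deriv c (\<lambda>q. \<theta> c q v) p u = chart_deriv c' (\<lambda>q. \<theta> c' q (?J v)) p (?J u) + \<theta> c' p D" .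
  have "\<theta> c p (pullback c c' p n u v) = \<theta> c' p (D + n (?J u) (?J v))"
    unfolding coframe_transition[OF \<theta> p] pullback_def transition_inverse[OF c(2,1,4,3)] D_def ..
  then show "connection_form (\<lambda>_ _. n) \<theta> c' p (?J u) *v \<theta> c p v =
      \<theta> c p (pullback c c' p n u v) - chart_deriv c (\<lambda>q. \<theta> c q v) p u"
    unfolding deriv coframe_transition[OF \<theta> p, of v] connection_form_coframe[OF \<theta> c(2) pU', of "\<lambda>_ _. n", OF n]
    by (simp add: linear_add[OF lin])
qed

end

end

lemma chart_smooth_apply:
  fixes \<Theta> :: "'a \<Rightarrow> real ^ 'm \<Rightarrow> 'b::real_normed_vector"
  assumes c: "c \<in> A" and W: "open W" and lin: "\<And>q. q \<in> W \<inter> fst c \<Longrightarrow> linear (\<Theta> q)"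
    and \<Theta>: "\<And>v. chart_smooth c W (\<lambda>q. \<Theta> q v)" and Y: "chart_smooth c W Y"
  shows "chart_smooth c W (\<lambda>q. \<Theta> q (Y q))"
proof (rule chart_smooth_cong[OF c W linear_expand_axis[OF lin, symmetric]])
  show "chart_smooth c W (\<lambda>q. \<Sum>k\<in>UNIV. Y q $ k *\<^sub>R \<Theta> q (axis k 1))"
    by (intro chart_smooth_sum[OF c W] chart_smooth_scaleR[OF c W] chart_smooth_nth[OF c W] \<Theta> Y) simp
qed

lemma connection_smooth:
  assumes N: "affine_connection A N" and c: "c \<in> A"
  shows "chart_smooth c W (\<lambda>q. N c q u v)" "p \<in> fst c \<Longrightarrow> bilinear (N c p)"
proof -
  have "chart_smooth c UNIV (\<lambda>q. N c q u v)"
    using N c unfolding affine_connection_def chart_smooth_def by simp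
  then show "chart_smooth c W (\<lambda>q. N c q u v)" by (rule chart_smooth_subset) simp
  show "p \<in> fst c \<Longrightarrow> bilinear (N c p)" using N c unfolding affine_connection_def by blast
qed

lemma connection_coeff_smooth:
  assumes N: "affine_connection A N" and \<theta>: "coframe_on A U \<theta>" and c: "c \<in> A"
  shows "chart_smooth c U (\<lambda>q. connection_coeff N \<theta> c q i j k)"
proof -
  note U = open_coframe[OF \<theta> c] and E = dual_frame_smooth[OF \<theta> c]
  have "chart_smooth c U (\<lambda>q. N c q u (dual_frame \<theta> c q j))" for u
  proof (rule chart_smooth_apply[OF c U _ _ E])
    show "linear (N c q u)" if "q \<in> U \<inter> fst c" for q
      using connection_smooth(2)[OF N c] that unfolding bilinear_def by blast
  qed (rule connection_smooth(1)[OF N c])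
  then have nabla: "chart_smooth c U (\<lambda>q. cov_deriv_vector N c (\<lambda>q. dual_frame \<theta> c q j) q u)" for u
    unfolding cov_deriv_vector_def by (intro chart_smooth_add[OF c U] chart_smooth_deriv[OF c U E])
  have "chart_smooth c U (\<lambda>q. \<theta> c q (cov_deriv_vector N c (\<lambda>q. dual_frame \<theta> c q j) q u))" for u
    by (rule chart_smooth_apply[OF c U linear_coframe[OF \<theta> c] coframe_smooth[OF \<theta> c] nabla])
  then have form: "chart_smooth c U (\<lambda>q. connection_form N \<theta> c q u $ i $ j)" for u
    unfolding connection_form_def by (simp add: chart_smooth_nth[OF c U])
  show ?thesis
    unfolding connection_coeff_def
  proof (rule chart_smooth_apply[OF c U _ form E])
    fix q assume q: "q \<in> U \<inter> fst c"
    then have "bilinear (N c q)" using connection_smooth(2)[OF N c] by blast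
    from linear_connection_form[where N = N, OF \<theta> c q this] show "linear (\<lambda>u. connection_form N \<theta> c q u $ i $ j)"
      by (auto intro!: linearI simp: linear_add linear_scale)
  qed
qed

lemma frame_bilinear:
  assumes \<theta>: "coframe_on A U \<theta>" and c: "c \<in> A" and p: "p \<in> U \<inter> fst c" and b: "bilinear b"
  shows "\<theta> c p (b u v) = (\<Sum>j\<in>UNIV. \<Sum>k\<in>UNIV. (\<theta> c p u $ j * \<theta> c p v $ k) *\<^sub>R \<theta> c p (b (dual_frame \<theta> c p j) (dual_frame \<theta> c p k)))"
proof -
  have "b u v = (\<Sum>j\<in>UNIV. \<Sum>k\<in>UNIV. (\<theta> c p u $ j * \<theta> c p v $ k) *\<^sub>R b (dual_frame \<theta> c p j) (dual_frame \<theta> c p k))"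
  proof -
    have l: "linear (b x)" "linear (\<lambda>x. b x y)" for x y using b unfolding bilinear_def by blast+
    have "b x v = (\<Sum>k\<in>UNIV. \<theta> c p v $ k *\<^sub>R b x (dual_frame \<theta> c p k))" for x
      by (subst dual_expand[OF \<theta> c p, of v]) (simp only: linear_sum[OF l(1)] linear_scale[OF l(1)])
    moreover have "b u v = (\<Sum>j\<in>UNIV. \<theta> c p u $ j *\<^sub>R b (dual_frame \<theta> c p j) v)"
      by (subst dual_expand[OF \<theta> c p, of u]) (simp only: linear_sum[OF l(2)] linear_scale[OF l(2)])
    ultimately show ?thesis by (simp add: scaleR_sum_right)
  qed
  then show ?thesis
    by (simp add: linear_sum[OF linear_coframe[OF \<theta> c p]] linear_scale[OF linear_coframe[OF \<theta> c p]])
qed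

end

section \<open>The Levi-Civita connection\<close>

definition orthonormal_coframe ::
    "('a::topological_space, 'n::finite) chart set \<Rightarrow> ('a, 'n) tensor2 \<Rightarrow> 'a set \<Rightarrow> ('a, 'n) coframe \<Rightarrow> bool" where
  "orthonormal_coframe A g U \<theta> \<longleftrightarrow> coframe_on A U \<theta> \<and>
     (\<forall>c\<in>A. \<forall>p\<in>U \<inter> fst c. \<forall>u v. g c p u v = \<theta> c p u \<bullet> \<theta> c p v)"

definition levi_civita_at ::
    "('a, 'n::finite) tensor2 \<Rightarrow> ('a, 'n) chart \<Rightarrow> 'a \<Rightarrow> (real ^ 'n \<Rightarrow> real ^ 'n \<Rightarrow> real ^ 'n) \<Rightarrow> bool" where
  "levi_civita_at g c p n \<longleftrightarrow> bilinear n \<and> (\<forall>u v. n u v = n v u) \<and>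
     (\<forall>x u v. cov_deriv2 (\<lambda>_ _. n) g c p x u v = 0)"

text \<open>The right-hand side of the Koszul formula for constant vector fields.\<close>
definition koszul :: "('a, 'n::finite) tensor2 \<Rightarrow> ('a, 'n) chart \<Rightarrow> 'a \<Rightarrow> real ^ 'n \<Rightarrow> real ^ 'n \<Rightarrow> real ^ 'n \<Rightarrow> real"
  where
  "koszul g c p u v w =
     chart_deriv c (\<lambda>q. g c q v w) p u + chart_deriv c (\<lambda>q. g c q u w) p v - chart_deriv c (\<lambda>q. g c q u v) p w"

lemma connection_at: "connection_form (\<lambda>_ _. N c p) \<theta> c p = connection_form N \<theta> c p"
    "cov_deriv2 (\<lambda>_ _. N c p) g c p = cov_deriv2 N g c p"
    "cov_deriv3 (\<lambda>_ _. N c p) \<Upsilon> c p = cov_deriv3 N \<Upsilon> c p"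
  by (simp_all add: fun_eq_iff connection_form_def cov_deriv_vector_def cov_deriv2_def cov_deriv3_def)

lemma orthonormal_coframeD: "orthonormal_coframe A g U \<theta> \<Longrightarrow> coframe_on A U \<theta>"
  unfolding orthonormal_coframe_def by blast

context smooth_manifold
begin

context
  fixes g U \<theta> c
  assumes og: "orthonormal_coframe A g U \<theta>" and c: "c \<in> A"
begin

lemma metric_coframe: "p \<in> U \<inter> fst c \<Longrightarrow> g c p u v = \<theta> c p u \<bullet> \<theta> c p v"
  using og c unfolding orthonormal_coframe_def by blast

lemmas coframe_facts = open_coframe[OF orthonormal_coframeD[OF og] c] linear_coframe[OF orthonormal_coframeD[OF og] c]
  coframe_smooth[OF orthonormal_coframeD[OF og] c] coframe_differentiable[OF orthonormal_coframeD[OF og] c]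

lemma metric_smooth: "chart_smooth c U (\<lambda>q. g c q u v)"
  by (rule chart_smooth_cong[OF c coframe_facts(1) metric_coframe[symmetric]
        chart_smooth_inner[OF c coframe_facts(1) coframe_facts(3) coframe_facts(3)]])

lemma metric_differentiable: "p \<in> U \<inter> fst c \<Longrightarrow> chart_differentiable c (\<lambda>q. g c q u v) p"
  by (rule chart_smooth_differentiable[OF c coframe_facts(1) metric_smooth])

lemma metric_deriv:
  assumes p: "p \<in> U \<inter> fst c"
  shows "chart_deriv c (\<lambda>q. g c q u v) p x =
    chart_deriv c (\<lambda>q. \<theta> c q u) p x \<bullet> \<theta> c p v + \<theta> c p u \<bullet> chart_deriv c (\<lambda>q. \<theta> c q v) p x"
proof -
  have "chart_deriv c (\<lambda>q. g c q u v) p x = chart_deriv c (\<lambda>q. \<theta> c q u \<bullet> \<theta> c q v) p x"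
    by (rule chart_deriv_cong[OF c coframe_facts(1) p metric_coframe])
  then show ?thesis
    using chart_deriv_bilinear(1)[OF bounded_bilinear_inner coframe_facts(4)[OF p] coframe_facts(4)[OF p], of u v x]
      chart_inv_chart[OF c] p by simp
qed

lemma cov_deriv2_coframe:
  assumes p: "p \<in> U \<inter> fst c" and N: "bilinear (N c p)"
  shows "cov_deriv2 N g c p x u v =
    - ((connection_form N \<theta> c p x *v \<theta> c p u) \<bullet> \<theta> c p v + \<theta> c p u \<bullet> (connection_form N \<theta> c p x *v \<theta> c p v))"
  unfolding cov_deriv2_def metric_deriv[OF p] metric_coframe[OF p]
    connection_form_coframe[where N = N, OF orthonormal_coframeD[OF og] c p N]
  by (simp add: inner_diff_left inner_diff_right)

lemma koszul_linear: assumes p: "p \<in> U \<inter> fst c" shows "linear (koszul g c p u v)"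
proof -
  note l = linear_coframe_deriv[OF orthonormal_coframeD[OF og] c p] and m = linear_chart_deriv[OF metric_differentiable[OF p]]
    and \<theta> = linear_coframe[OF orthonormal_coframeD[OF og] c p]
  have "linear (\<lambda>w. chart_deriv c (\<lambda>q. g c q v w) p u)" for u v
    unfolding metric_deriv[OF p]
    by (rule linearI) (simp_all add: linear_add[OF l] linear_scale[OF l] linear_add[OF \<theta>] linear_scale[OF \<theta>]
        inner_add_right algebra_simps)
  then show ?thesis
    unfolding koszul_def using m by (intro linear_compose_sub linear_compose_add) auto
qed

lemma metric_deriv_commute:
  assumes p: "p \<in> U \<inter> fst c"
  shows "chart_deriv c (\<lambda>q. g c q u v) p x = chart_deriv c (\<lambda>q. g c q v u) p x"
  unfolding metric_deriv[OF p] by (simp add: inner_commute)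

lemma koszul_bilinear:
  assumes p: "p \<in> U \<inter> fst c"
  shows "koszul g c p u v w = koszul g c p v u w"
    "koszul g c p (u + u') v w = koszul g c p u v w + koszul g c p u' v w"
    "koszul g c p (s *\<^sub>R u) v w = s * koszul g c p u v w"
proof -
  note l = linear_coframe_deriv[OF orthonormal_coframeD[OF og] c p] and m = linear_chart_deriv[OF metric_differentiable[OF p]]
    and t = linear_chart_deriv[OF coframe_facts(4)[OF p]] and \<theta> = linear_coframe[OF orthonormal_coframeD[OF og] c p]
  show "koszul g c p u v w = koszul g c p v u w"
    unfolding koszul_def using metric_deriv_commute[OF p, of u v w] by simp
  show "koszul g c p (u + u') v w = koszul g c p u v w + koszul g c p u' v w"
    "koszul g c p (s *\<^sub>R u) v w = s * koszul g c p u v w"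
    unfolding koszul_def metric_deriv[OF p]
    by (simp_all add: linear_add[OF l] linear_scale[OF l] linear_add[OF t] linear_scale[OF t] linear_add[OF \<theta>] linear_scale[OF \<theta>]
        inner_add_left inner_add_right algebra_simps)
qed

lemma levi_civita_at_koszul:
  assumes p: "p \<in> U \<inter> fst c" and n: "levi_civita_at g c p n"
  shows "koszul g c p u v w = 2 * g c p (n u v) w"
proof -
  have D: "chart_deriv c (\<lambda>q. g c q u v) p x = g c p (n x u) v + g c p u (n x v)" for x u v
    using n unfolding levi_civita_at_def cov_deriv2_def by (simp add: algebra_simps)
  have sym: "n u v = n v u" for u v using n unfolding levi_civita_at_def by blast
  show ?thesis
    unfolding koszul_def D metric_coframe[OF p]
    using sym[of v u] sym[of w u] sym[of w v] by (simp add: inner_commute)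
qed

lemma coframe_inner_eqI:
  assumes p: "p \<in> U \<inter> fst c" and "\<And>w. \<theta> c p u \<bullet> \<theta> c p w = \<theta> c p v \<bullet> \<theta> c p w"
  shows "u = v"
proof -
  have "\<theta> c p u \<bullet> x = \<theta> c p v \<bullet> x" for x
    using coframe_surj[OF orthonormal_coframeD[OF og] c p, of x] assms(2) by metis
  then have "\<theta> c p u = \<theta> c p v" by (metis vector_eq_ldot inner_commute)
  then show ?thesis using coframe_inject[OF orthonormal_coframeD[OF og] c p] by blast
qed

lemma levi_civita_at_unique:
  assumes p: "p \<in> U \<inter> fst c" and "levi_civita_at g c p n" "levi_civita_at g c p n'"
  shows "n = n'"
proof (intro ext)
  fix u v
  show "n u v = n' u v"
  proof (rule coframe_inner_eqI[OF p])
    show "\<theta> c p (n u v) \<bullet> \<theta> c p w = \<theta> c p (n' u v) \<bullet> \<theta> c p w" for w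
      using levi_civita_at_koszul[OF p assms(2), of u v w] levi_civita_at_koszul[OF p assms(3), of u v w]
      by (simp add: metric_coframe[OF p])
  qed
qed

lemma levi_civita_at_local:
  "\<exists>m. (\<forall>q\<in>U \<inter> fst c. levi_civita_at g c q (m q)) \<and> (\<forall>u v. chart_smooth c U (\<lambda>q. m q u v))"
proof (intro exI conjI ballI allI)
  let ?E = "\<lambda>q j. dual_frame \<theta> c q j"
  define m where "m q u v = (\<Sum>j\<in>UNIV. (koszul g c q u v (?E q j) / 2) *\<^sub>R ?E q j)" for q u v
  note U = coframe_facts(1) and E = dual_frame_smooth[OF orthonormal_coframeD[OF og] c]
  show "chart_smooth c U (\<lambda>q. m q u v)" for u v
  proof -
    have k: "chart_smooth c U (\<lambda>q. koszul g c q u v w)" for w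
      unfolding koszul_def
      by (intro chart_smooth_diff[OF c U] chart_smooth_add[OF c U] chart_smooth_deriv[OF c U metric_smooth])
    have "chart_smooth c U (\<lambda>q. koszul g c q u v (?E q j))" for j
      by (rule chart_smooth_apply[OF c U koszul_linear k E])
    then show ?thesis
      unfolding m_def using E chart_smooth_const[OF c U, of 2]
      by (intro chart_smooth_sum[OF c U] chart_smooth_scaleR[OF c U] chart_smooth_divide[OF c U]) auto
  qed
  fix q assume q: "q \<in> U \<inter> fst c"
  note lin = linear_coframe[OF orthonormal_coframeD[OF og] c q]
  have m: "2 * (\<theta> c q (m q u v) \<bullet> \<theta> c q w) = koszul g c q u v w" for u v w
  proof -
    have "2 * (\<theta> c q (m q u v) \<bullet> \<theta> c q w) = (\<Sum>j\<in>UNIV. \<theta> c q w $ j * koszul g c q u v (?E q j))"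
      by (simp add: m_def linear_sum[OF lin] linear_scale[OF lin] coframe_dual[OF orthonormal_coframeD[OF og] c q]
          inner_sum_left inner_axis' sum_distrib_left mult.commute)
    also have "\<dots> = koszul g c q u v (\<Sum>j\<in>UNIV. \<theta> c q w $ j *\<^sub>R ?E q j)"
      by (simp add: linear_sum[OF koszul_linear[OF q]] linear_scale[OF koszul_linear[OF q]])
    finally show ?thesis using dual_expand[OF orthonormal_coframeD[OF og] c q, of w] by simp
  qed
  note kb = koszul_bilinear[OF q]
  have sym: "m q u v = m q v u" for u v
    unfolding m_def using kb(1)[of u v] by simp
  have lin1: "linear (\<lambda>u. m q u v)" for v
    unfolding m_def by (rule linearI) (simp_all add: kb(2,3) add_divide_distrib scaleR_add_left sum.distrib scaleR_sum_right)
  moreover have "linear (\<lambda>v. m q u v)" for u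
    using lin1[of u] by (simp add: sym[of u])
  ultimately have "bilinear (m q)" unfolding bilinear_def by blast
  moreover have "cov_deriv2 (\<lambda>_ _. m q) g c q x u v = 0" for x u v
  proof -
    have "2 * (\<theta> c q (m q x u) \<bullet> \<theta> c q v) + 2 * (\<theta> c q u \<bullet> \<theta> c q (m q x v)) = 2 * chart_deriv c (\<lambda>r. g c r u v) q x"
      unfolding inner_commute[of "\<theta> c q u"] m unfolding koszul_def using metric_deriv_commute[OF q] by simp
    then show ?thesis unfolding cov_deriv2_def metric_coframe[OF q] by simp
  qed
  ultimately show "levi_civita_at g c q (m q)" unfolding levi_civita_at_def using sym by blast
qed

end

lemma levi_civita_at_pullback:
  assumes og: "orthonormal_coframe A g U \<theta>" and c: "c \<in> A" "c' \<in> A" "p \<in> fst c" "p \<in> fst c'"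
    and p: "p \<in> U" and n: "levi_civita_at g c' p n"
  shows "levi_civita_at g c p (pullback c c' p n)"
proof -
  note \<theta> = orthonormal_coframeD[OF og]
  have pc: "p \<in> U \<inter> fst c" and pc': "p \<in> U \<inter> fst c'" using p c by auto
  have b: "bilinear n" and sym: "\<And>u v. n u v = n v u" and met: "\<And>x u v. cov_deriv2 (\<lambda>_ _. n) g c' p x u v = 0"
    using n unfolding levi_civita_at_def by auto
  have "pullback c c' p n u v = pullback c c' p n v u" for u v
    using pullback_torsion[OF c, of n u v] sym linear_0[OF linear_chart_deriv[OF transition_differentiable[OF c(2,1,4,3)]]]
    by simp
  moreover have "cov_deriv2 (\<lambda>_ _. pullback c c' p n) g c p x u v = 0" for x u v
    using met[of "chart_deriv c (snd c') p x" "chart_deriv c (snd c') p u" "chart_deriv c (snd c') p v"]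
    unfolding cov_deriv2_coframe[OF og c(1) pc, of "\<lambda>_ _. pullback c c' p n", OF bilinear_pullback[OF c b]]
      cov_deriv2_coframe[OF og c(2) pc', of "\<lambda>_ _. n", OF b]
      connection_form_pullback[OF c b \<theta> p] coframe_transition[OF c \<theta> p] .
  ultimately show ?thesis
    unfolding levi_civita_at_def using bilinear_pullback[OF c b] by blast
qed

lemma is_levi_civita_iff:
  "is_levi_civita A g N \<longleftrightarrow> affine_connection A N \<and> (\<forall>c\<in>A. \<forall>p\<in>fst c. levi_civita_at g c p (N c p))"
  unfolding is_levi_civita_def levi_civita_at_def connection_at using connection_smooth(2) by blast

theorem levi_civita_exists:
  assumes "\<And>p. \<exists>U \<theta>. p \<in> U \<and> orthonormal_coframe A g U \<theta>"
  shows "is_levi_civita A g (levi_civita A g)"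
proof -
  have "\<exists>!N. is_levi_civita A g N"
    unfolding is_levi_civita_iff
  proof (rule affine_connection_of_pointwise)
    fix c p assume cp: "c \<in> A" "p \<in> fst c"
    obtain U \<theta> where U: "p \<in> U" "orthonormal_coframe A g U \<theta>" using assms by blast
    show "n = n'" if "levi_civita_at g c p n" "levi_civita_at g c p n'" for n n'
      using levi_civita_at_unique[OF U(2) cp(1) _ that] U(1) cp(2) by blast
    show "\<exists>W m. open W \<and> p \<in> W \<and> (\<forall>q\<in>W \<inter> fst c. levi_civita_at g c q (m q)) \<and> (\<forall>u v. chart_smooth c W (\<lambda>q. m q u v))"
      using levi_civita_at_local[OF U(2) cp(1)] coframe_facts(1)[OF U(2) cp(1)] U(1) by blast
    show "bilinear n" if "levi_civita_at g c p n" for n using that unfolding levi_civita_at_def by blast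
    show "levi_civita_at g c p (pullback c c' p n)" if "c' \<in> A" "p \<in> fst c'" "levi_civita_at g c' p n" for c' n
      by (rule levi_civita_at_pullback[OF U(2) cp(1) that(1) cp(2) that(2) U(1) that(3)])
  qed
  then show ?thesis unfolding levi_civita_def by (rule theI')
qed

end

section \<open>Connections with totally antisymmetric torsion\<close>

lemma Upsilon0_cubic_derivative:
  "((\<lambda>x. Upsilon0 x x x) has_derivative (\<lambda>h. 3 * Upsilon0 h x x)) (at x)"
proof -
  have nth: "((\<lambda>x :: real ^ 9. x $ i) has_derivative (\<lambda>h. h $ i)) (at x)" for i
    by (rule bounded_linear_imp_has_derivative[OF bounded_linear_vec_nth])
  have "((\<lambda>x. det (\<sigma> x)) has_derivative (\<lambda>h. \<sigma> h \<bullet> cof (\<sigma> x))) (at x)"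
    unfolding det_3 sigma_nth
    by (rule has_derivative_eq_rhs, (rule derivative_intros nth)+)
      (simp add: fun_eq_iff inner_matrix3 algebra_simps)
  then show ?thesis by (simp add: Upsilon0_diagonal Upsilon0_cof)
qed

text \<open>Both requirements on the connection, stated without a coframe: the connection preserves the metric and
  the cubic form, and its torsion is totally antisymmetric. Diagonal values suffice for the
  symmetric form \<open>\<Upsilon>\<close>, and for the torsion because it is antisymmetric in its vector arguments.\<close>
definition skew_torsion_at ::
    "('a, 9) tensor2 \<Rightarrow> ('a, 9) tensor3 \<Rightarrow> ('a, 9) chart \<Rightarrow> 'a \<Rightarrow> (real ^ 9 \<Rightarrow> real ^ 9 \<Rightarrow> real ^ 9) \<Rightarrow> bool" where
  "skew_torsion_at g \<Upsilon> c p n \<longleftrightarrow> bilinear n \<and>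
     (\<forall>x u v. cov_deriv2 (\<lambda>_ _. n) g c p x u v = 0) \<and>
     (\<forall>x u. cov_deriv3 (\<lambda>_ _. n) \<Upsilon> c p x u u u = 0) \<and>
     (\<forall>u v. g c p u (n u v - n v u) = 0)"

text \<open>Rearranges components \<open>T\<^sup>i\<^sub>j\<^sub>k\<close> in the order expected by \<open>contract\<close>.\<close>
definition frame_tensor :: "(9 \<Rightarrow> 9 \<Rightarrow> 9 \<Rightarrow> real) \<Rightarrow> real ^ 9 ^ 9 ^ 9" where
  "frame_tensor T = (\<chi> k i j. T i j k)"

lemma frame_tensor_nth [simp]: "frame_tensor T $ k $ i $ j = T i j k"
  by (simp add: frame_tensor_def)

locale irreducible_so3_geometry = smooth_manifold A
  for A :: "('a::topological_space, 9) chart set" +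
  fixes g :: "('a, 9) tensor2" and \<Upsilon> :: "('a, 9) tensor3" and \<omega> :: "('a, 9) tensor4"
  assumes geometry: "irreducible_geometry A g \<Upsilon> \<omega>"
begin

lemma adapted_orthonormal: "adapted_coframe A g \<Upsilon> \<omega> U \<theta> \<Longrightarrow> orthonormal_coframe A g U \<theta>"
  unfolding adapted_coframe_def orthonormal_coframe_def inner_vec_def by simp

lemma adapted_coframeD: "adapted_coframe A g \<Upsilon> \<omega> U \<theta> \<Longrightarrow> coframe_on A U \<theta>"
  unfolding adapted_coframe_def by blast

context
  fixes U \<theta> c
  assumes ad: "adapted_coframe A g \<Upsilon> \<omega> U \<theta>" and c: "c \<in> A"
begin

lemmas coframe = adapted_coframeD[OF ad] and orthonormal = adapted_orthonormal[OF ad]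

lemma Upsilon_coframe: "p \<in> U \<inter> fst c \<Longrightarrow> \<Upsilon> c p u v w = Upsilon0 (\<theta> c p u) (\<theta> c p v) (\<theta> c p w)"
  using ad c unfolding adapted_coframe_def by blast

lemma lower_index_adapted:
  assumes p: "p \<in> U \<inter> fst c"
  shows "lower_index g \<theta> c p T = T"
proof -
  have "g c p (dual_frame \<theta> c p i) (dual_frame \<theta> c p l) = (if i = l then 1 else 0)" for i l
    by (simp add: metric_coframe[OF orthonormal c p] coframe_dual[OF coframe c p] inner_axis_axis)
  then show ?thesis
    by (simp add: fun_eq_iff lower_index_def if_distrib[of "\<lambda>x. x * _"] cong: if_cong)
qed

context
  fixes p and N :: "('a, 9) connection"
  assumes p: "p \<in> U \<inter> fst c" and N: "bilinear (N c p)"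
begin

lemma cov_deriv3_coframe:
  "cov_deriv3 N \<Upsilon> c p x u u u = - 3 * Upsilon0 (connection_form N \<theta> c p x *v \<theta> c p u) (\<theta> c p u) (\<theta> c p u)"
proof -
  note U = open_coframe[OF coframe c]
  have "chart_deriv c (\<lambda>q. \<Upsilon> c q u u u) p x = chart_deriv c (\<lambda>q. Upsilon0 (\<theta> c q u) (\<theta> c q u) (\<theta> c q u)) p x"
    by (rule chart_deriv_cong[OF c U p Upsilon_coframe])
  also have "\<dots> = 3 * Upsilon0 (chart_deriv c (\<lambda>q. \<theta> c q u) p x) (\<theta> c p u) (\<theta> c p u)"
  proof (rule chart_deriv_eqI)
    have inv: "chart_inv c (snd c p) = p" using chart_inv_chart[OF c] p by blast
    have cubic: "((\<lambda>y. Upsilon0 y y y) has_derivative (\<lambda>h. 3 * Upsilon0 h (\<theta> c p u) (\<theta> c p u)))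
        (at (((\<lambda>q. \<theta> c q u) \<circ> chart_inv c) (snd c p)))"
      using Upsilon0_cubic_derivative[of "\<theta> c p u"] inv by simp
    show "((\<lambda>q. Upsilon0 (\<theta> c q u) (\<theta> c q u) (\<theta> c q u)) \<circ> chart_inv c has_derivative
        (\<lambda>x. 3 * Upsilon0 (chart_deriv c (\<lambda>q. \<theta> c q u) p x) (\<theta> c p u) (\<theta> c p u))) (at (snd c p))"
      using has_derivative_compose[OF chart_has_derivative[OF coframe_differentiable[OF coframe c p]] cubic]
      by (simp add: comp_def)
  qed
  finally have D: "chart_deriv c (\<lambda>q. \<Upsilon> c q u u u) p x = 3 * Upsilon0 (chart_deriv c (\<lambda>q. \<theta> c q u) p x) (\<theta> c p u) (\<theta> c p u)" .
  have minus: "Upsilon0 (a - b) y y = Upsilon0 a y y - Upsilon0 b y y" for a b y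
    using trilinear_Upsilon0(1)[of "a - b" b y y] by simp
  have sym: "Upsilon0 (\<theta> c p u) a (\<theta> c p u) = Upsilon0 a (\<theta> c p u) (\<theta> c p u)"
    "Upsilon0 (\<theta> c p u) (\<theta> c p u) a = Upsilon0 a (\<theta> c p u) (\<theta> c p u)" for a
    using symmetric_Upsilon0 by metis+
  show ?thesis
    unfolding cov_deriv3_def D Upsilon_coframe[OF p] connection_form_coframe[where N = N, OF coframe c p N] minus
      sym[of "\<theta> c p (N c p x u)"] by simp
qed

lemma metric_compatible_iff:
  "(\<forall>x u v. cov_deriv2 N g c p x u v = 0) \<longleftrightarrow> (\<forall>x y. (connection_form N \<theta> c p x *v y) \<bullet> y = 0)"
  (is "?L \<longleftrightarrow> ?R")
proof
  note D = cov_deriv2_coframe[where N = N, OF orthonormal c p N]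
  show ?R if ?L
  proof (intro allI)
    fix x y
    obtain u where "\<theta> c p u = y" using coframe_surj[OF coframe c p] by blast
    then show "(connection_form N \<theta> c p x *v y) \<bullet> y = 0"
      using that D[of x u u] by (simp add: inner_commute)
  qed
  show ?L if R: ?R
  proof (intro allI)
    fix x u v
    show "cov_deriv2 N g c p x u v = 0"
      unfolding D using skew_polar[of "(*v) (connection_form N \<theta> c p x)" "\<theta> c p u" "\<theta> c p v"] R by simp
  qed
qed

text \<open>Parallelism of the metric and of the cubic form is the infinitesimal condition that cuts out the Lie
  algebra \<open>so3_LR\<close>.\<close>
lemma parallel_iff:
  "(\<forall>x u v. cov_deriv2 N g c p x u v = 0) \<and> (\<forall>x u. cov_deriv3 N \<Upsilon> c p x u u u = 0) \<longleftrightarrow>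
    (\<forall>u. connection_form N \<theta> c p u \<in> so3_LR)"
proof -
  have "(\<forall>x u. cov_deriv3 N \<Upsilon> c p x u u u = 0) \<longleftrightarrow> (\<forall>x y. Upsilon0 (connection_form N \<theta> c p x *v y) y y = 0)"
    unfolding cov_deriv3_coframe using coframe_surj[OF coframe c p]
    by (metis (no_types, lifting) mult_eq_0_iff neg_equal_0_iff_equal zero_neq_numeral)
  then show ?thesis unfolding so3_LR_iff metric_compatible_iff by blast
qed

lemma contract_connection:
  "contract (frame_tensor (connection_coeff N \<theta> c p)) (\<theta> c p u) = connection_form N \<theta> c p u"
proof -
  note lin = linear_connection_form[where N = N, OF coframe c p N]
  have "frame_tensor (connection_coeff N \<theta> c p) $ k = connection_form N \<theta> c p (dual_frame \<theta> c p k)" for k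
    by (simp add: vec_eq_iff connection_coeff_def)
  then have "contract (frame_tensor (connection_coeff N \<theta> c p)) (\<theta> c p u) =
      connection_form N \<theta> c p (\<Sum>k\<in>UNIV. \<theta> c p u $ k *\<^sub>R dual_frame \<theta> c p k)"
    by (simp add: contract_def linear_sum[OF lin] linear_scale[OF lin])
  then show ?thesis using dual_expand[OF coframe c p, of u] by simp
qed

lemma bilinear_torsion: "bilinear (\<lambda>u v. N c p u v - N c p v u)"
  unfolding bilinear_def by (auto intro!: linearI simp: bilinear_rules[OF N] algebra_simps)

lemma contract_torsion:
  "contract (frame_tensor (torsion_coeff N \<theta> c p)) (\<theta> c p v) *v \<theta> c p u = \<theta> c p (N c p u v - N c p v u)"
proof -
  have T: "torsion_coeff N \<theta> c p i j k =
      \<theta> c p (N c p (dual_frame \<theta> c p j) (dual_frame \<theta> c p k) - N c p (dual_frame \<theta> c p k) (dual_frame \<theta> c p j)) $ i" for i j k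
    unfolding torsion_coeff_def torsion_form_coframe[where N = N, OF coframe c p N] ..
  have "(contract (frame_tensor (torsion_coeff N \<theta> c p)) (\<theta> c p v) *v \<theta> c p u) $ i = \<theta> c p (N c p u v - N c p v u) $ i" for i
  proof -
    have "(contract (frame_tensor (torsion_coeff N \<theta> c p)) (\<theta> c p v) *v \<theta> c p u) $ i =
        (\<Sum>k\<in>UNIV. \<Sum>j\<in>UNIV. \<theta> c p v $ k * (torsion_coeff N \<theta> c p i j k * \<theta> c p u $ j))"
      unfolding contract_vector by (simp add: matrix_vector_mult_def sum_distrib_left)
    also have "\<dots> = (\<Sum>j\<in>UNIV. \<Sum>k\<in>UNIV. \<theta> c p v $ k * (torsion_coeff N \<theta> c p i j k * \<theta> c p u $ j))"
      by (rule sum.swap)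
    also have "\<dots> = \<theta> c p (N c p u v - N c p v u) $ i"
      unfolding frame_bilinear[OF coframe c p bilinear_torsion, of u v] sum_component vector_scaleR_component T
      by (intro sum.cong refl) simp
    finally show ?thesis .
  qed
  then show ?thesis by (simp add: vec_eq_iff)
qed

lemma antisymmetric_torsion_iff:
  "totally_antisymmetric (torsion_coeff N \<theta> c p) \<longleftrightarrow> (\<forall>u v. g c p u (N c p u v - N c p v u) = 0)"
proof -
  let ?T = "frame_tensor (torsion_coeff N \<theta> c p)"
  note surj = coframe_surj[OF coframe c p]
  have "contract ?T x *v y = - (contract ?T y *v x)" for x y
  proof -
    obtain u v where uv: "\<theta> c p u = y" "\<theta> c p v = x" using surj by metis
    have "\<theta> c p (N c p u v - N c p v u) = - \<theta> c p (N c p v u - N c p u v)"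
      using linear_neg[OF linear_coframe[OF coframe c p], of "N c p v u - N c p u v"] by simp
    then show ?thesis using contract_torsion[of v u] contract_torsion[of u v] uv by simp
  qed
  moreover have "(\<forall>x y. (contract ?T x *v y) \<bullet> y = 0) \<longleftrightarrow> (\<forall>u v. g c p u (N c p u v - N c p v u) = 0)"
    unfolding metric_coframe[OF orthonormal c p] contract_torsion[symmetric]
    using surj by (metis inner_commute)
  ultimately show ?thesis
    unfolding totally_antisymmetric_iff[of ?T, unfolded frame_tensor_nth] by blast
qed

text \<open>Subtracting half the torsion symmetrises the connection. As the torsion is totally antisymmetric, this does
  not affect compatibility with the metric.\<close>
lemma levi_civita_of_skew_torsion:
  assumes S: "skew_torsion_at g \<Upsilon> c p (N c p)"
  shows "levi_civita_at g c p (\<lambda>u v. (1/2) *\<^sub>R (N c p u v + N c p v u))"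
proof -
  let ?n = "\<lambda>u v. (1/2) *\<^sub>R (N c p u v + N c p v u)"
  note lin = linear_coframe[OF coframe c p] and met = metric_coframe[OF orthonormal c p]
  have n: "bilinear ?n"
    unfolding bilinear_def by (auto intro!: linearI simp: bilinear_rules[OF N] algebra_simps)
  define t where "t u v w = g c p u (N c p v w - N c p w v)" for u v w
  have t0: "t u u w = 0" for u w using S unfolding skew_torsion_at_def t_def by blast
  have add: "t (u + u') v w = t u v w + t u' v w" "t u (v + v') w = t u v w + t u v' w" for u u' v v' w
    unfolding t_def met by (simp_all add: bilinear_rules[OF N] linear_add[OF lin] linear_diff[OF lin] inner_add_left inner_add_right inner_diff_right algebra_simps)
  have t1: "t u v w = - t v u w" for u v w
    using t0[of "u + v" w, unfolded add] t0[of u w] t0[of v w] by linarith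
  have t2: "t u v w = - t u w v" for u v w
    unfolding t_def met by (simp add: linear_diff[OF lin] inner_diff_right)
  have "cov_deriv2 (\<lambda>_ _. ?n) g c p x u v = cov_deriv2 N g c p x u v + (t v x u + t u x v) / 2" for x u v
    unfolding cov_deriv2_def t_def met
    by (simp add: linear_add[OF lin] linear_diff[OF lin] linear_scale[OF lin] inner_add_left inner_add_right inner_diff_right
        inner_commute[of "\<theta> c p v"] field_simps)
  moreover have "t v x u + t u x v = 0" for x u v
    using t2[of v x u] t1[of v u x] t2[of u v x] by simp
  moreover have "cov_deriv2 N g c p x u v = 0" for x u v
    using S unfolding skew_torsion_at_def connection_at by blast
  ultimately have "cov_deriv2 (\<lambda>_ _. ?n) g c p x u v = 0" for x u v by simp
  then show ?thesis
    unfolding levi_civita_at_def using n by (simp add: add.commute)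
qed

lemma skew_torsion_at_coframe:
  "skew_torsion_at g \<Upsilon> c p (N c p) \<longleftrightarrow>
    (\<forall>u. connection_form N \<theta> c p u \<in> so3_LR) \<and> (\<forall>u v. g c p u (N c p u v - N c p v u) = 0)"
  unfolding skew_torsion_at_def connection_at parallel_iff[symmetric] using N by blast

lemma connection_coeff_coframe:
  "connection_coeff N \<theta> c p i j k = (\<theta> c p (N c p (dual_frame \<theta> c p k) (dual_frame \<theta> c p j))
    - chart_deriv c (\<lambda>q. \<theta> c q (dual_frame \<theta> c p j)) p (dual_frame \<theta> c p k)) $ i"
proof -
  have "connection_coeff N \<theta> c p i j k = (connection_form N \<theta> c p (dual_frame \<theta> c p k) *v axis j 1) $ i"
    by (simp add: connection_coeff_def matrix_vector_mult_basis column_def)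
  then show ?thesis
    unfolding connection_form_coframe[where N = N, OF coframe c p N, symmetric]
    by (simp add: coframe_dual[OF coframe c p])
qed

end
end

lemma adapted_coframe_exists:
  obtains U \<theta> where "p \<in> U" "adapted_coframe A g \<Upsilon> \<omega> U \<theta>"
  using geometry unfolding irreducible_geometry_def by blast

lemma levi_civita_works: "is_levi_civita A g (levi_civita A g)"
proof (rule levi_civita_exists)
  fix p
  obtain U \<theta> where "p \<in> U" "adapted_coframe A g \<Upsilon> \<omega> U \<theta>" by (rule adapted_coframe_exists)
  then show "\<exists>U \<theta>. p \<in> U \<and> orthonormal_coframe A g U \<theta>" using adapted_orthonormal by blast
qed

lemma levi_civita_affine: "affine_connection A (levi_civita A g)"
  using levi_civita_works unfolding is_levi_civita_def by blast

lemma levi_civita_at_point: "c \<in> A \<Longrightarrow> p \<in> fst c \<Longrightarrow> levi_civita_at g c p (levi_civita A g c p)"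
  using levi_civita_works unfolding is_levi_civita_iff by blast

lemma levi_civita_symmetric_part:
  assumes c: "c \<in> A" and p: "p \<in> fst c" and S: "skew_torsion_at g \<Upsilon> c p (N c p)"
  shows "levi_civita A g c p u v = (1/2) *\<^sub>R (N c p u v + N c p v u)"
proof -
  obtain U \<theta> where U: "p \<in> U" "adapted_coframe A g \<Upsilon> \<omega> U \<theta>" by (rule adapted_coframe_exists)
  then have pU: "p \<in> U \<inter> fst c" using p by blast
  have "bilinear (N c p)" using S unfolding skew_torsion_at_def by blast
  then have "levi_civita_at g c p (\<lambda>u v. (1/2) *\<^sub>R (N c p u v + N c p v u))"
    using levi_civita_of_skew_torsion[where N = N, OF U(2) c pU _ S] by blast
  then have "levi_civita A g c p = (\<lambda>u v. (1/2) *\<^sub>R (N c p u v + N c p v u))"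
    by (rule levi_civita_at_unique[OF adapted_orthonormal[OF U(2)] c pU levi_civita_at_point[OF c p]])
  then show ?thesis by simp
qed

lemma levi_civita_decomposition:
  assumes ad: "adapted_coframe A g \<Upsilon> \<omega> U \<theta>" and c: "c \<in> A" and p: "p \<in> U \<inter> fst c"
    and S: "skew_torsion_at g \<Upsilon> c p (N c p)"
  shows "connection_coeff (levi_civita A g) \<theta> c p i j k =
    connection_coeff N \<theta> c p i j k + 1 / 2 * torsion_coeff N \<theta> c p i j k"
proof -
  have p': "p \<in> fst c" using p by blast
  have N: "bilinear (N c p)" using S unfolding skew_torsion_at_def by blast
  have LC: "bilinear (levi_civita A g c p)" by (rule connection_smooth(2)[OF levi_civita_affine c p'])
  note lin = linear_coframe[OF adapted_coframeD[OF ad] c p]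
  show ?thesis
    unfolding torsion_coeff_def torsion_form_coframe[where N = N, OF adapted_coframeD[OF ad] c p N]
      connection_coeff_coframe[where N = N, OF ad c p N] connection_coeff_coframe[where N = "levi_civita A g", OF ad c p LC]
      levi_civita_symmetric_part[where N = N, OF c p' S]
    by (simp add: linear_add[OF lin] linear_diff[OF lin] linear_scale[OF lin] field_simps)
qed

text \<open>The symmetric parts of two solutions are both the Levi-Civita connection. Their difference is then
  antisymmetric, takes values in \<open>so3_LR\<close>, and vanishes by \<open>so3_LR_antisymmetric_zero\<close>.\<close>
lemma skew_torsion_at_unique:
  assumes c: "c \<in> A" and p: "p \<in> fst c"
    and S: "skew_torsion_at g \<Upsilon> c p n" "skew_torsion_at g \<Upsilon> c p n'"
  shows "n = n'"
proof -
  obtain U \<theta> where U: "p \<in> U" "adapted_coframe A g \<Upsilon> \<omega> U \<theta>" by (rule adapted_coframe_exists)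
  then have pU: "p \<in> U \<inter> fst c" using p by blast
  note \<theta> = adapted_coframeD[OF U(2)]
  note lin = linear_coframe[OF \<theta> c pU]
  \<comment> \<open>Both candidates as connections, to make the coframe formulas applicable.\<close>
  define N where "N b = (\<lambda>(_ :: ('a, 9) chart) (_ :: 'a). if b then n else n')" for b
  have SN: "skew_torsion_at g \<Upsilon> c p (N b c p)" for b using S by (simp add: N_def)
  then have bil: "bilinear (N b c p)" for b unfolding skew_torsion_at_def by blast
  have h: "connection_form (N b) \<theta> c p u \<in> so3_LR" for b u
    using SN skew_torsion_at_coframe[where N = "N b", OF U(2) c pU bil] by blast
  define K where "K = frame_tensor (connection_coeff (N True) \<theta> c p) - frame_tensor (connection_coeff (N False) \<theta> c p)"
  have contract_K: "contract K (\<theta> c p u) = connection_form (N True) \<theta> c p u - connection_form (N False) \<theta> c p u" for u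
    using contract_connection[where N = "N True", OF U(2) c pU bil] contract_connection[where N = "N False", OF U(2) c pU bil]
    by (simp add: K_def contract_linear_left)
  have K_apply: "contract K (\<theta> c p u) *v \<theta> c p v = \<theta> c p (n u v - n' u v)" for u v
    unfolding contract_K matrix_vector_mult_diff_rdistrib connection_form_coframe[where N = "N True", OF \<theta> c pU bil]
      connection_form_coframe[where N = "N False", OF \<theta> c pU bil] by (simp add: N_def linear_diff[OF lin])
  have "n u v + n v u = n' u v + n' v u" for u v
    using levi_civita_symmetric_part[where N = "N True", OF c p SN, of u v]
      levi_civita_symmetric_part[where N = "N False", OF c p SN, of u v] by (simp add: N_def)
  then have skew: "n u v - n' u v = - (n v u - n' v u)" for u v
    by (simp add: algebra_simps)
  have "K = 0"
  proof (rule so3_LR_antisymmetric_zero)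
    fix k
    obtain u where u: "\<theta> c p u = axis k 1" using coframe_surj[OF \<theta> c pU] by blast
    have "K $ k = contract K (\<theta> c p u)" unfolding u by simp
    then show "K $ k \<in> so3_LR" unfolding contract_K using subspace_diff[OF subspace_so3_LR h h] by simp
  next
    fix x y
    obtain u v where uv: "\<theta> c p u = x" "\<theta> c p v = y" using coframe_surj[OF \<theta> c pU] by metis
    have "\<theta> c p (n u v - n' u v) = - \<theta> c p (n v u - n' v u)"
      by (subst skew) (rule linear_neg[OF lin])
    then show "contract K x *v y = - (contract K y *v x)" using K_apply[of u v] K_apply[of v u] uv by simp
  qed
  then have "\<theta> c p (n u v - n' u v) = 0" for u v
    using K_apply[of u v] by (simp add: contract_def)
  then have "n u v - n' u v = 0" for u v
    using coframe_inject[OF \<theta> c pU, of "n u v - n' u v" 0] linear_0[OF lin] by simp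
  then show ?thesis by (simp add: fun_eq_iff)
qed

lemma skew_torsion_at_pullback:
  assumes c: "c \<in> A" "c' \<in> A" "p \<in> fst c" "p \<in> fst c'" and S: "skew_torsion_at g \<Upsilon> c' p n"
  shows "skew_torsion_at g \<Upsilon> c p (pullback c c' p n)"
proof -
  obtain U \<theta> where U: "p \<in> U" "adapted_coframe A g \<Upsilon> \<omega> U \<theta>" by (rule adapted_coframe_exists)
  then have pU: "p \<in> U \<inter> fst c" "p \<in> U \<inter> fst c'" using c by auto
  note \<theta> = adapted_coframeD[OF U(2)]
  have n: "bilinear n" using S unfolding skew_torsion_at_def by blast
  let ?J = "chart_deriv c (snd c') p"
  have S': "connection_form (\<lambda>_ _. n) \<theta> c' p u \<in> so3_LR" "g c' p u (n u v - n v u) = 0" for u v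
    using S skew_torsion_at_coframe[where N = "\<lambda>_ _. n", OF U(2) c(2) pU(2) n] by blast+
  have "connection_form (\<lambda>_ _. pullback c c' p n) \<theta> c p u \<in> so3_LR" for u
    unfolding connection_form_pullback[OF c n \<theta> U(1)] by (rule S'(1))
  moreover have "g c p u (pullback c c' p n u v - pullback c c' p n v u) = 0" for u v
    unfolding metric_coframe[OF adapted_orthonormal[OF U(2)] c(1) pU(1)] coframe_transition[OF c \<theta> U(1)] pullback_torsion[OF c]
      transition_inverse[OF c(2,1,4,3)]
    using S'(2)[of "?J u" "?J v"] by (simp add: metric_coframe[OF adapted_orthonormal[OF U(2)] c(2) pU(2)])
  ultimately show ?thesis
    using skew_torsion_at_coframe[where N = "\<lambda>_ _. pullback c c' p n", OF U(2) c(1) pU(1) bilinear_pullback[OF c n]] by blast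
qed

text \<open>Near integrability says that the tensor \<open>K\<close> of Levi-Civita coefficients satisfies the hypotheses
  of \<open>skew_torsion_projection\<close>. Its antisymmetric part \<open>P K\<close> is half the torsion; adding the corresponding
  vector-valued form to the Levi-Civita connection leaves the \<open>so3_LR\<close>-valued part \<open>K - P K\<close>.\<close>
lemma skew_torsion_at_local:
  assumes near: "nearly_integrable A g \<Upsilon>" and ad: "adapted_coframe A g \<Upsilon> \<omega> U \<theta>" and c: "c \<in> A"
  shows "\<exists>m. (\<forall>q\<in>U \<inter> fst c. skew_torsion_at g \<Upsilon> c q (m q)) \<and> (\<forall>u v. chart_smooth c U (\<lambda>q. m q u v))"
proof -
  let ?LC = "levi_civita A g" and ?E = "\<lambda>q j. dual_frame \<theta> c q j"
  note \<theta> = adapted_coframeD[OF ad]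
  note U = open_coframe[OF \<theta> c]
  obtain P where P: "linear P"
    "\<And>K. (\<forall>x y. (contract K x *v y) \<bullet> y = 0) \<and> (\<forall>x. Upsilon0 (contract K x *v x) x x = 0) \<Longrightarrow>
      totally_antisymmetric (\<lambda>i j k. P K $ k $ i $ j) \<and> (\<forall>k. (K - P K) $ k \<in> so3_LR)"
    using skew_torsion_projection by blast
  define K where "K q = frame_tensor (connection_coeff ?LC \<theta> c q)" for q
  define m where "m q u v = ?LC c q u v +
      (\<Sum>i\<in>UNIV. (\<Sum>k\<in>UNIV. \<Sum>j\<in>UNIV. \<theta> c q v $ k * (P (K q) $ k $ i $ j * \<theta> c q u $ j)) *\<^sub>R ?E q i)" for q u v
  have "chart_smooth c U K"
    by (intro chart_smooth_vec[OF c U]) (simp add: K_def connection_coeff_smooth[OF levi_civita_affine \<theta> c])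
  then have "chart_smooth c U (\<lambda>q. P (K q))"
    by (rule chart_smooth_linear[OF c U linear_conv_bounded_linear[THEN iffD1, OF P(1)]])
  then have PK: "chart_smooth c U (\<lambda>q. P (K q) $ k $ i $ j)" for i j k
    by (intro chart_smooth_nth[OF c U])
  have "chart_smooth c U (\<lambda>q. m q u v)" for u v
    unfolding m_def
    by (intro chart_smooth_add[OF c U] chart_smooth_sum[OF c U] chart_smooth_scaleR[OF c U] chart_smooth_mult[OF c U]
        chart_smooth_nth[OF c U coframe_smooth[OF \<theta> c]] PK dual_frame_smooth[OF \<theta> c] connection_smooth(1)[OF levi_civita_affine c]) auto
  moreover have "skew_torsion_at g \<Upsilon> c q (m q)" if q: "q \<in> U \<inter> fst c" for q
  proof -
    have q': "q \<in> fst c" using q by blast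
    note lin = linear_coframe[OF \<theta> c q] and surj = coframe_surj[OF \<theta> c q]
    note met = metric_coframe[OF adapted_orthonormal[OF ad] c q]
    have LC: "bilinear (?LC c q)" by (rule connection_smooth(2)[OF levi_civita_affine c q'])
    have LC_at: "levi_civita_at g c q (?LC c q)" by (rule levi_civita_at_point[OF c q'])
    have contract_K: "contract (K q) (\<theta> c q u) = connection_form ?LC \<theta> c q u" for u
      unfolding K_def by (rule contract_connection[where N = "levi_civita A g", OF ad c q LC])
    have "(\<forall>x y. (contract (K q) x *v y) \<bullet> y = 0)"
    proof -
      have "\<forall>x u v. cov_deriv2 ?LC g c q x u v = 0"
        using LC_at unfolding levi_civita_at_def connection_at by blast
      then show ?thesis unfolding metric_compatible_iff[where N = "levi_civita A g", OF ad c q LC] using surj contract_K by metis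
    qed
    moreover have "Upsilon0 (contract (K q) x *v x) x x = 0" for x
    proof -
      obtain u where u: "\<theta> c q u = x" using surj by blast
      have "cov_deriv3 ?LC \<Upsilon> c q u u u u = 0" using near c q' unfolding nearly_integrable_def by blast
      then show ?thesis using cov_deriv3_coframe[where N = "levi_civita A g", OF ad c q LC, of u u] contract_K[of u] u by simp
    qed
    ultimately have PKq: "totally_antisymmetric (\<lambda>i j k. P (K q) $ k $ i $ j)" "\<And>k. (K q - P (K q)) $ k \<in> so3_LR"
      using P(2) by blast+
    define A' where "A' x y = contract (P (K q)) y *v x" for x y
    have A': "A' x x = 0" "A' x y = - A' y x" "x \<bullet> A' x y = 0" for x y
    proof -
      show skew: "A' x y = - A' y x" for x y
        using PKq(1) unfolding totally_antisymmetric_iff A'_def by blast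
      then have "A' x x = - A' x x" .
      then show "A' x x = 0" by (simp add: eq_neg_iff_add_eq_0 flip: scaleR_2)
      show "x \<bullet> A' x y = 0"
        using PKq(1) unfolding totally_antisymmetric_iff A'_def by (metis inner_commute)
    qed
    have bilA: "bilinear A'"
      unfolding A'_def bilinear_def by (auto intro!: linearI simp: contract_linear_right
        matrix_vector_bilinear)
    have m: "\<theta> c q (m q u v) = \<theta> c q (?LC c q u v) + A' (\<theta> c q u) (\<theta> c q v)" for u v
    proof -
      have "A' x y = (\<Sum>i\<in>UNIV. (\<Sum>k\<in>UNIV. \<Sum>j\<in>UNIV. y $ k * (P (K q) $ k $ i $ j * x $ j)) *\<^sub>R axis i 1)" for x y
        unfolding A'_def contract_vector vec_eq_iff
        by (simp add: matrix_vector_mult_def axis_def sum_distrib_left if_distrib[of "\<lambda>x. _ * x"] cong: if_cong)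
      then show ?thesis
        by (simp add: m_def linear_add[OF lin] linear_sum[OF lin] linear_scale[OF lin] coframe_dual[OF \<theta> c q])
    qed
    have inj: "\<theta> c q x = \<theta> c q y \<longleftrightarrow> x = y" for x y by (rule coframe_inject[OF \<theta> c q])
    have bil: "bilinear (m q)"
      unfolding bilinear_def
      by (auto intro!: linearI simp: m linear_add[OF lin] linear_scale[OF lin] bilinear_rules[OF LC] bilinear_rules[OF bilA]
          algebra_simps simp flip: inj)
    have "connection_form (\<lambda>_ _. m q) \<theta> c q u \<in> so3_LR" for u
    proof -
      have "connection_form (\<lambda>_ _. m q) \<theta> c q u = contract (K q - P (K q)) (\<theta> c q u)"
      proof (rule connection_form_eqI[OF \<theta> c q])
        fix v
        have "contract (K q - P (K q)) (\<theta> c q u) *v \<theta> c q v =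
            (\<theta> c q (?LC c q u v) - chart_deriv c (\<lambda>q. \<theta> c q v) q u) - A' (\<theta> c q v) (\<theta> c q u)"
          by (simp add: contract_linear_left matrix_vector_mult_diff_rdistrib contract_K A'_def
              connection_form_coframe[where N = ?LC, OF \<theta> c q LC])
        then show "contract (K q - P (K q)) (\<theta> c q u) *v \<theta> c q v =
            \<theta> c q (m q u v) - chart_deriv c (\<lambda>q. \<theta> c q v) q u"
          using A'(2)[of "\<theta> c q v" "\<theta> c q u"] by (simp add: m)
      qed (rule bil)
      then show ?thesis using so3_LR_contract[OF PKq(2)] by simp
    qed
    moreover have "g c q u (m q u v - m q v u) = 0" for u v
    proof -
      have "?LC c q u v = ?LC c q v u" using LC_at unfolding levi_civita_at_def by blast
      then have "\<theta> c q (m q u v - m q v u) = A' (\<theta> c q u) (\<theta> c q v) - A' (\<theta> c q v) (\<theta> c q u)"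
        by (simp only: linear_diff[OF lin] m) simp
      then show ?thesis
        unfolding met A'(2)[of "\<theta> c q v" "\<theta> c q u"] by (simp only: inner_diff_right inner_minus_right A'(3))
    qed
    ultimately show ?thesis
      using skew_torsion_at_coframe[where N = "\<lambda>_ _. m q", OF ad c q bil] by blast
  qed
  ultimately show ?thesis by blast
qed

text \<open>In any single adapted coframe the two requirements together amount to a condition on the Christoffel symbols
  that does not mention the coframe.\<close>
lemma skew_torsion_connection_iff:
  "so3_LR_connection A g \<Upsilon> \<omega> N \<and> antisymmetric_torsion A g \<Upsilon> \<omega> N \<longleftrightarrow>
    affine_connection A N \<and> (\<forall>c\<in>A. \<forall>p\<in>fst c. skew_torsion_at g \<Upsilon> c p (N c p))"
proof (cases "affine_connection A N")
  case True
  have iff: "skew_torsion_at g \<Upsilon> c p (N c p) \<longleftrightarrow> (\<forall>u. connection_form N \<theta> c p u \<in> so3_LR) \<and>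
      totally_antisymmetric (lower_index g \<theta> c p (torsion_coeff N \<theta> c p))"
    if "adapted_coframe A g \<Upsilon> \<omega> U \<theta>" "c \<in> A" "p \<in> U \<inter> fst c" for U \<theta> c p
  proof -
    have "bilinear (N c p)" using connection_smooth(2)[OF True that(2)] that(3) by blast
    then show ?thesis
      unfolding lower_index_adapted[OF that] skew_torsion_at_coframe[where N = N, OF that \<open>bilinear (N c p)\<close>]
        antisymmetric_torsion_iff[where N = N, OF that \<open>bilinear (N c p)\<close>] by blast
  qed
  show ?thesis
  proof
    assume L: "so3_LR_connection A g \<Upsilon> \<omega> N \<and> antisymmetric_torsion A g \<Upsilon> \<omega> N"
    have "skew_torsion_at g \<Upsilon> c p (N c p)" if "c \<in> A" "p \<in> fst c" for c p
    proof -
      obtain U \<theta> where U: "p \<in> U" "adapted_coframe A g \<Upsilon> \<omega> U \<theta>" by (rule adapted_coframe_exists)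
      then have pU: "p \<in> U \<inter> fst c" using that by blast
      show ?thesis
        using L iff[OF U(2) that(1) pU] U(2) that(1) pU unfolding so3_LR_connection_def antisymmetric_torsion_def by blast
    qed
    then show "affine_connection A N \<and> (\<forall>c\<in>A. \<forall>p\<in>fst c. skew_torsion_at g \<Upsilon> c p (N c p))" using True by blast
  next
    assume R: "affine_connection A N \<and> (\<forall>c\<in>A. \<forall>p\<in>fst c. skew_torsion_at g \<Upsilon> c p (N c p))"
    then show "so3_LR_connection A g \<Upsilon> \<omega> N \<and> antisymmetric_torsion A g \<Upsilon> \<omega> N"
      unfolding so3_LR_connection_def antisymmetric_torsion_def using iff True by blast
  qed
qed (auto simp: so3_LR_connection_def)

theorem skew_torsion_connection_exists_unique:
  assumes "nearly_integrable A g \<Upsilon>"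
  shows "\<exists>!N. so3_LR_connection A g \<Upsilon> \<omega> N \<and> antisymmetric_torsion A g \<Upsilon> \<omega> N"
  unfolding skew_torsion_connection_iff
proof (rule affine_connection_of_pointwise)
  fix c p assume cp: "c \<in> A" "p \<in> fst c"
  obtain U \<theta> where U: "p \<in> U" "adapted_coframe A g \<Upsilon> \<omega> U \<theta>" by (rule adapted_coframe_exists)
  show "\<exists>W m. open W \<and> p \<in> W \<and> (\<forall>q\<in>W \<inter> fst c. skew_torsion_at g \<Upsilon> c q (m q)) \<and> (\<forall>u v. chart_smooth c W (\<lambda>q. m q u v))"
    using skew_torsion_at_local[OF assms U(2) cp(1)] open_coframe[OF adapted_coframeD[OF U(2)] cp(1)] U(1) by blast
  show "bilinear n" if "skew_torsion_at g \<Upsilon> c p n" for n using that unfolding skew_torsion_at_def by blast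
qed (use skew_torsion_at_unique skew_torsion_at_pullback in blast)+

text \<open>The derivative of \<open>\<Upsilon>\<close> along \<open>x\<close> on \<open>x, x, x\<close> involves the Christoffel symbols only through
  their value on \<open>(x, x)\<close>, where the torsion makes no contribution.\<close>
theorem nearly_integrable_of_skew_torsion:
  assumes "so3_LR_connection A g \<Upsilon> \<omega> N" "antisymmetric_torsion A g \<Upsilon> \<omega> N"
  shows "nearly_integrable A g \<Upsilon>"
  unfolding nearly_integrable_def
proof (intro ballI allI)
  fix c p x assume cp: "c \<in> A" "p \<in> fst c"
  have S: "skew_torsion_at g \<Upsilon> c p (N c p)" using assms skew_torsion_connection_iff cp by blast
  have "levi_civita A g c p x x = N c p x x"
    using levi_civita_symmetric_part[where N = N, OF cp S, of x x] by (simp flip: scaleR_2)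
  moreover have "cov_deriv3 N \<Upsilon> c p x x x x = 0"
    using S unfolding skew_torsion_at_def connection_at by blast
  ultimately show "cov_deriv3 (levi_civita A g) \<Upsilon> c p x x x x = 0" by (simp add: cov_deriv3_def)
qed

text \<open>Two decompositions of the Levi-Civita coefficients differ by a tensor that is both \<open>so3_LR\<close>-valued and
  totally antisymmetric.\<close>
theorem levi_civita_determines_skew_torsion:
  assumes \<Gamma>: "so3_LR_connection A g \<Upsilon> \<omega> \<Gamma>" "antisymmetric_torsion A g \<Upsilon> \<omega> \<Gamma>"
    and ad: "adapted_coframe A g \<Upsilon> \<omega> U \<theta>" and c: "c \<in> A" and p: "p \<in> U \<inter> fst c"
  shows "(\<forall>k. (\<chi> i j. G i j k) \<in> so3_LR) \<and> totally_antisymmetric (lower_index g \<theta> c p T) \<and>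
      (\<forall>i j k. connection_coeff (levi_civita A g) \<theta> c p i j k = G i j k + 1 / 2 * T i j k)
    \<longleftrightarrow> G = connection_coeff \<Gamma> \<theta> c p \<and> T = torsion_coeff \<Gamma> \<theta> c p" (is "?L \<longleftrightarrow> ?R")
proof -
  let ?G = "connection_coeff \<Gamma> \<theta> c p" and ?T = "torsion_coeff \<Gamma> \<theta> c p"
  have S: "skew_torsion_at g \<Upsilon> c p (\<Gamma> c p)" using \<Gamma> skew_torsion_connection_iff c p by blast
  have h: "frame_tensor ?G $ k \<in> so3_LR" for k
  proof -
    have "frame_tensor ?G $ k = connection_form \<Gamma> \<theta> c p (dual_frame \<theta> c p k)"
      by (simp add: vec_eq_iff connection_coeff_def)
    then show ?thesis using \<Gamma>(1) ad c p unfolding so3_LR_connection_def by simp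
  qed
  have t: "totally_antisymmetric ?T"
    using \<Gamma>(2) ad c p lower_index_adapted[OF ad c p] unfolding antisymmetric_torsion_def by metis
  note decomposition = levi_civita_decomposition[where N = \<Gamma>, OF ad c p S]
  have G_eq: "(\<chi> i j. G i j k) = frame_tensor G $ k" for G :: "9 \<Rightarrow> 9 \<Rightarrow> 9 \<Rightarrow> real" and k
    by (simp add: vec_eq_iff)
  show ?thesis
    unfolding G_eq lower_index_adapted[OF ad c p]
  proof
    assume L: "(\<forall>k. frame_tensor G $ k \<in> so3_LR) \<and> totally_antisymmetric T \<and>
      (\<forall>i j k. connection_coeff (levi_civita A g) \<theta> c p i j k = G i j k + 1 / 2 * T i j k)"
    define D where "D = frame_tensor ?G - frame_tensor G"
    have D: "D = (1/2) *\<^sub>R (frame_tensor T - frame_tensor ?T)"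
      unfolding D_def vec_eq_iff
    proof (intro allI)
      fix k i j
      have "?G i j k + 1 / 2 * ?T i j k = G i j k + 1 / 2 * T i j k" using L decomposition by metis
      then show "(frame_tensor ?G - frame_tensor G) $ k $ i $ j = ((1/2) *\<^sub>R (frame_tensor T - frame_tensor ?T)) $ k $ i $ j"
        by (simp add: field_simps)
    qed
    have "frame_tensor T - frame_tensor ?T \<in> {A. totally_antisymmetric (\<lambda>i j k. A $ k $ i $ j)}"
      by (rule subspace_diff[OF subspace_totally_antisymmetric]) (use L t in simp_all)
    from subspace_scale[OF subspace_totally_antisymmetric this, of "1/2"]
    have "totally_antisymmetric (\<lambda>i j k. D $ k $ i $ j)" by (simp only: D mem_Collect_eq)
    moreover have "D $ k \<in> so3_LR" for k
      unfolding D_def using subspace_diff[OF subspace_so3_LR h] L by simp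
    ultimately have "D = 0"
      unfolding totally_antisymmetric_iff by (intro so3_LR_antisymmetric_zero) blast+
    then have "frame_tensor ?G = frame_tensor G" "frame_tensor T = frame_tensor ?T"
      using D by (simp_all add: D_def)
    then have "\<forall>k i j. ?G i j k = G i j k" "\<forall>k i j. T i j k = ?T i j k"
      unfolding vec_eq_iff frame_tensor_nth .
    then show ?R by (simp add: fun_eq_iff)
  next
    assume ?R
    then show "(\<forall>k. frame_tensor G $ k \<in> so3_LR) \<and> totally_antisymmetric T \<and>
      (\<forall>i j k. connection_coeff (levi_civita A g) \<theta> c p i j k = G i j k + 1 / 2 * T i j k)"
      using h t decomposition by simp
  qed
qed

end

theorem theorem5p7:
  fixes A :: "('a::{t2_space, second_countable_topology}, 9) chart set"
    and g :: "('a, 9) tensor2" and \<Upsilon> :: "('a, 9) tensor3" and \<omega> :: "('a, 9) tensor4"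
  assumes "smooth_atlas A"
    and "irreducible_geometry A g \<Upsilon> \<omega>"
  shows
    "(nearly_integrable A g \<Upsilon> \<longrightarrow>
        (\<exists>!\<Gamma>. so3_LR_connection A g \<Upsilon> \<omega> \<Gamma> \<and> antisymmetric_torsion A g \<Upsilon> \<omega> \<Gamma>) \<and>
        (\<forall>\<Gamma>. so3_LR_connection A g \<Upsilon> \<omega> \<Gamma> \<and> antisymmetric_torsion A g \<Upsilon> \<omega> \<Gamma> \<longrightarrow>
          (\<forall>U \<theta>. adapted_coframe A g \<Upsilon> \<omega> U \<theta> \<longrightarrow> (\<forall>c\<in>A. \<forall>p\<in>U \<inter> fst c. \<forall>G T.
            ((\<forall>k. (\<chi> i j. G i j k) \<in> so3_LR) \<and>
             totally_antisymmetric (lower_index g \<theta> c p T) \<and>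
             (\<forall>i j k. connection_coeff (levi_civita A g) \<theta> c p i j k = G i j k + 1 / 2 * T i j k))
            \<longleftrightarrow> G = connection_coeff \<Gamma> \<theta> c p \<and> T = torsion_coeff \<Gamma> \<theta> c p)))) \<and>
     ((\<exists>!\<Gamma>. so3_LR_connection A g \<Upsilon> \<omega> \<Gamma> \<and> antisymmetric_torsion A g \<Upsilon> \<omega> \<Gamma>) \<longrightarrow>
        nearly_integrable A g \<Upsilon>)"
proof -
  interpret irreducible_so3_geometry A g \<Upsilon> \<omega>
    by unfold_locales (fact assms)+
  show ?thesis
  proof (intro conjI impI)
    assume near: "nearly_integrable A g \<Upsilon>"
    then show "\<exists>!\<Gamma>. so3_LR_connection A g \<Upsilon> \<omega> \<Gamma> \<and> antisymmetric_torsion A g \<Upsilon> \<omega> \<Gamma>"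
      by (rule skew_torsion_connection_exists_unique)
    show "\<forall>\<Gamma>. so3_LR_connection A g \<Upsilon> \<omega> \<Gamma> \<and> antisymmetric_torsion A g \<Upsilon> \<omega> \<Gamma> \<longrightarrow>
      (\<forall>U \<theta>. adapted_coframe A g \<Upsilon> \<omega> U \<theta> \<longrightarrow> (\<forall>c\<in>A. \<forall>p\<in>U \<inter> fst c. \<forall>G T.
        ((\<forall>k. (\<chi> i j. G i j k) \<in> so3_LR) \<and>
         totally_antisymmetric (lower_index g \<theta> c p T) \<and>
         (\<forall>i j k. connection_coeff (levi_civita A g) \<theta> c p i j k = G i j k + 1 / 2 * T i j k))
        \<longleftrightarrow> G = connection_coeff \<Gamma> \<theta> c p \<and> T = torsion_coeff \<Gamma> \<theta> c p))"
      by (intro allI impI ballI) (elim conjE, rule levi_civita_determines_skew_torsion)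
  next
    assume "\<exists>!\<Gamma>. so3_LR_connection A g \<Upsilon> \<omega> \<Gamma> \<and> antisymmetric_torsion A g \<Upsilon> \<omega> \<Gamma>"
    then obtain \<Gamma> where "so3_LR_connection A g \<Upsilon> \<omega> \<Gamma>" "antisymmetric_torsion A g \<Upsilon> \<omega> \<Gamma>"
      by (elim ex1E conjE)
    then show "nearly_integrable A g \<Upsilon>" by (rule nearly_integrable_of_skew_torsion)
  qed
qed

end
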